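(* Let $T>0$ and let $\theta,\tilde\theta\in C([0,T];L^2(\mathbb R^2))$ be mild solutions on $[0,T]$ of the surface quasi-geostrophic equation $$\partial_t\theta+u\cdot\nabla\theta-\Delta\theta=0,\qquad u=\nabla^\perp\Lambda^{-1}\theta\qquad\text{in }(0,T)\times\mathbb R^2,$$ such that $\theta(0)=\tilde\theta(0)$. Then $\theta(t)=\tilde\theta(t)$ for all $t\in[0,T]$.
   Context: Here $\nabla^\perp=(-\partial_{x_2},\partial_{x_1})$, $\Lambda=(-\Delta)^{1/2}$, $L^2=L^2(\mathbb R^2)$, and $e^{t\Delta}$ is the heat semigroup on $\mathbb R^2$. Definition (mild solution). Let $T>0$ and $\theta_0\in L^2$. A function $\theta:[0,T]\times\mathbb R^2\to\mathbb R$ is called a mild solution (with initial data $\theta(0)=\theta_0$) if $\theta\in C([0,T];L^2)$ and $$\theta(t)=e^{t\Delta}\theta_0-\int_0^t\nabla\cdot e^{(t-s)\Delta}(u\theta)(s)\,ds\quad\text{in }L^2\text{ for all }t\in[0,T],$$ where $u=\nabla^\perp\Lambda^{-1}\theta$. *)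

theory Defs
  imports "HOL-Analysis.Analysis"
begin

text \<open>Elements of $L^2(\mathbb R^2)$ are represented by Lebesgue measurable functions; equality
  in $L^2$ is equality almost everywhere.\<close>

definition L2 :: "(real^2 \<Rightarrow> 'b::euclidean_space) \<Rightarrow> bool" where
  "L2 f \<longleftrightarrow> f \<in> borel_measurable lebesgue \<and> integrable lebesgue (\<lambda>x. (norm (f x))\<^sup>2)"

text \<open>Convergence in the $L^2$ norm. The squared distance is an extended nonnegative integral, so
  that it is infinite, and not zero, when the difference is not square integrable.\<close>

definition L2_tendsto ::
    "('a \<Rightarrow> real^2 \<Rightarrow> 'b::euclidean_space) \<Rightarrow> (real^2 \<Rightarrow> 'b) \<Rightarrow> 'a filter \<Rightarrow> bool" where
  "L2_tendsto f g F \<longleftrightarrow>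
     ((\<lambda>a. \<integral>\<^sup>+x. ennreal ((norm (f a x - g x))\<^sup>2) \<partial>lebesgue) \<longlongrightarrow> 0) F"

definition continuous_L2 :: "real set \<Rightarrow> (real \<Rightarrow> real^2 \<Rightarrow> real) \<Rightarrow> bool" where
  "continuous_L2 I \<theta> \<longleftrightarrow>
     (\<forall>t\<in>I. L2 (\<theta> t)) \<and> (\<forall>t\<in>I. L2_tendsto \<theta> (\<theta> t) (at t within I))"

definition fourier_integral :: "(real^2 \<Rightarrow> complex) \<Rightarrow> real^2 \<Rightarrow> complex" where
  "fourier_integral f \<xi> = (\<integral>x. cis (- (x \<bullet> \<xi>)) * f x \<partial>lebesgue)"

text \<open>The function \<open>g\<close> is the $L^2$ (Plancherel) Fourier transform of \<open>f\<close>: the $L^2$ limit of the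
  Fourier integrals of the truncations of \<open>f\<close>, which lie in $L^1 \cap L^2$.\<close>

definition is_fourier_transform_L2 :: "(real^2 \<Rightarrow> complex) \<Rightarrow> (real^2 \<Rightarrow> complex) \<Rightarrow> bool" where
  "is_fourier_transform_L2 f g \<longleftrightarrow> L2 f \<and> L2 g \<and>
     L2_tendsto (\<lambda>n::nat. fourier_integral (\<lambda>x. indicator (cball 0 (real n)) x *\<^sub>R f x)) g
       sequentially"

text \<open>\<open>g = m(D) f\<close> for the Fourier multiplier with symbol \<open>m\<close>.\<close>

definition is_fourier_multiplier ::
    "(real^2 \<Rightarrow> complex) \<Rightarrow> (real^2 \<Rightarrow> real) \<Rightarrow> (real^2 \<Rightarrow> real) \<Rightarrow> bool" where
  "is_fourier_multiplier m f g \<longleftrightarrow>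
     (\<exists>h. is_fourier_transform_L2 (\<lambda>x. complex_of_real (f x)) h \<and>
          is_fourier_transform_L2 (\<lambda>x. complex_of_real (g x)) (\<lambda>\<xi>. m \<xi> * h \<xi>))"

text \<open>$u = \nabla^\perp \Lambda^{-1} \theta$. With the above convention $\partial_{x_j}$ has symbol
  $i \xi_j$ and $\Lambda^{-1}$ has symbol $|\xi|^{-1}$. The composition is a single bounded
  multiplier; $\Lambda^{-1}\theta$ alone need not lie in $L^2$. The relation determines \<open>u\<close> up to a
  null set.\<close>

definition is_sqg_velocity :: "(real^2 \<Rightarrow> real) \<Rightarrow> (real^2 \<Rightarrow> real^2) \<Rightarrow> bool" where
  "is_sqg_velocity \<theta> u \<longleftrightarrow>
     is_fourier_multiplier (\<lambda>\<xi>. - (\<i> * complex_of_real (\<xi> $ 2)) / complex_of_real (norm \<xi>))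
       \<theta> (\<lambda>x. u x $ 1) \<and>
     is_fourier_multiplier (\<lambda>\<xi>. (\<i> * complex_of_real (\<xi> $ 1)) / complex_of_real (norm \<xi>))
       \<theta> (\<lambda>x. u x $ 2)"

definition heat_kernel :: "real \<Rightarrow> real^2 \<Rightarrow> real" where
  "heat_kernel t x = exp (- (norm x)\<^sup>2 / (4 * t)) / (4 * pi * t)"

text \<open>$e^{t\Delta} f$, used only for \<open>t \<ge> 0\<close>; it acts on vector fields componentwise.\<close>

definition heat_semigroup ::
    "real \<Rightarrow> (real^2 \<Rightarrow> 'b::euclidean_space) \<Rightarrow> real^2 \<Rightarrow> 'b" where
  "heat_semigroup t f x =
     (if t = 0 then f x else \<integral>y. heat_kernel t (x - y) *\<^sub>R f y \<partial>lebesgue)"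

definition divergence :: "(real^2 \<Rightarrow> real^2) \<Rightarrow> real^2 \<Rightarrow> real" where
  "divergence F x = (\<Sum>j\<in>UNIV. frechet_derivative (\<lambda>y. F y $ j) (at x) (axis j 1))"

text \<open>As $u\theta$ is bounded in $L^1$, the $L^1$ norm of
  $\nabla\cdot e^{(t-s)\Delta}(u\theta)(s)$ is at most a constant times $(t-s)^{-1/2}$, whereas its
  natural $L^2$ bound $(t-s)^{-1}$ is not integrable. The time integral is hence not taken as a
  Bochner integral in $L^2$ but, for almost every \<open>x\<close>, as the Lebesgue integral in \<open>s\<close>, which
  represents the Bochner integral in $L^1$. For \<open>s < t\<close> the integrand is a smooth function of \<open>x\<close>
  that does not depend on the representatives chosen for $\theta(s)$ and $u(s)$; the endpoint
  \<open>s = t\<close> is left out.\<close>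

definition mild_solution ::
    "real \<Rightarrow> (real^2 \<Rightarrow> real) \<Rightarrow> (real \<Rightarrow> real^2 \<Rightarrow> real) \<Rightarrow> bool" where
  "mild_solution T \<theta>\<^sub>0 \<theta> \<longleftrightarrow>
     L2 \<theta>\<^sub>0 \<and> continuous_L2 {0..T} \<theta> \<and>
     (\<exists>u. (\<forall>t\<in>{0..T}. is_sqg_velocity (\<theta> t) (u t)) \<and>
        (\<forall>t\<in>{0..T}. AE x in lebesgue.
           set_integrable lebesgue {0..<t}
             (\<lambda>s. divergence (heat_semigroup (t - s) (\<lambda>y. \<theta> s y *\<^sub>R u s y)) x) \<and>
           \<theta> t x = heat_semigroup t \<theta>\<^sub>0 x -
             (LINT s:{0..<t}|lebesgue.
                divergence (heat_semigroup (t - s) (\<lambda>y. \<theta> s y *\<^sub>R u s y)) x)))"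

end

theory Submission
  imports Defs "HOL-Probability.Characteristic_Functions"
begin

text \<open>The space \<open>L\<^sup>2\<close> is invariant under the scaling of the equation, and the flux \<open>u \<theta>\<close> of a mild solution
  is only in \<open>L\<^sup>1\<close>; a direct \<open>L\<^sup>2\<close> estimate of Duhamel's formula meets the kernel \<open>(t - s)\<^sup>-\<^sup>1\<close>, which
  is not integrable. What saves uniqueness is a symmetry of the nonlinearity. Let \<open>b\<close> be the Fourier
  transform of \<open>\<theta>\<close>. Up to a constant, the Fourier transform of \<open>div (u \<theta>)\<close> is the integral over \<open>\<eta>\<close> of
  \<open>cross2 \<xi> \<eta> / |\<eta>|\<close> times \<open>b \<eta> * b (\<xi> - \<eta>)\<close>, and the cross product changes sign when \<open>\<eta>\<close> and \<open>\<xi> - \<eta>\<close>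
  are exchanged. The kernel may therefore be replaced by half of
  \<open>cross2 \<xi> \<eta> * (1 / |\<eta>| - 1 / |\<xi> - \<eta>|)\<close>, which is at most \<open>|\<xi>|\<^sup>2 / max |\<eta>| |\<xi> - \<eta>|\<close> (\<open>abs_sqg_kernel_le\<close>):
  one derivative is gained.

  Let \<open>w\<close> be the difference and \<open>G\<close> the sum of the transforms of two solutions with the same initial
  value, and \<open>N\<close> the difference of the transformed fluxes, contracted with \<open>\<xi>\<close>. The symmetrized form is
  quadratic, so \<open>N\<close> is bounded by a constant times \<open>|\<xi>|\<^sup>2\<close> and the integral of \<open>|w \<eta>| |G (\<xi> - \<eta>)| / max |\<eta>| |\<xi> - \<eta>|\<close>
  (\<open>norm_flux_hat_diff_le\<close>). Duhamel's formula becomes, for each frequency, an ordinary convolution in time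
  of \<open>N\<close> with \<open>exp (- r |\<xi>|\<^sup>2)\<close> (\<open>duhamel_fourier\<close>). With the weight \<open>exp (- l t)\<close>, Young's inequality in time
  bounds the \<open>L\<^sup>2\<close> norm in time of \<open>w\<close> by that of \<open>N\<close> divided by \<open>l + |\<xi>|\<^sup>2\<close> (\<open>young_in_time\<close>). This is maximal
  regularity; the singular kernel \<open>(t - s)\<^sup>-\<^sup>1\<close> never appears.

  It remains to bound \<open>N / (l + |\<xi>|\<^sup>2)\<close> in \<open>L\<^sup>2\<close> of the frequencies at a fixed time (\<open>damped_max_form_L2\<close>).
  Convolution with the weight \<open>1 / max\<close> maps \<open>L\<^sup>2 \<times> L\<^sup>2\<close> to \<open>L\<^sup>2\<close>, so the contribution of the frequencies of
  \<open>G\<close> outside a large ball is small. Inside the ball \<open>G\<close> is integrable, and the damping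
  \<open>|\<xi>|\<^sup>2 / (l + |\<xi>|\<^sup>2)\<close> together with \<open>1 / max\<close> costs at most \<open>1 / sqrt l\<close>, which is small for large \<open>l\<close>. The
  ball can be chosen independently of time since the solutions are continuous into \<open>L\<^sup>2\<close> on a compact
  interval (\<open>L2_continuous_uniform_tail\<close>). So a finite weighted norm is at most half of itself, and it
  vanishes.

  Two points need care. Plancherel's theorem for the \<open>L\<^sup>2\<close> Fourier transform is obtained from Gaussian
  regularization and the continuity of translations in \<open>L\<^sup>2\<close>. And the chosen representatives of \<open>\<theta> t\<close> need
  not be jointly measurable in time and space; integrals over time are exchanged only for the fluxes
  smoothed by the heat semigroup and for their Fourier integrals, which are jointly continuous because
  the fluxes depend continuously on time in \<open>L\<^sup>1\<close>.\<close>

section \<open>Square integrable functions\<close>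

definition square_integrable ::
    "('a::euclidean_space \<Rightarrow> 'b::{real_normed_field, second_countable_topology, banach}) \<Rightarrow> bool"
  where "square_integrable f \<longleftrightarrow>
    f \<in> borel_measurable borel \<and> integrable lborel (\<lambda>x. (norm (f x))\<^sup>2)"

definition sq_norm ::
    "('a::euclidean_space \<Rightarrow> 'b::{real_normed_field, second_countable_topology, banach}) \<Rightarrow> real"
  where "sq_norm f = (\<integral>x. (norm (f x))\<^sup>2 \<partial>lborel)"

lemma square_integrable_measurable [measurable_dest]:
  "square_integrable f \<Longrightarrow> f \<in> borel_measurable borel"
  by (simp add: square_integrable_def)

lemma square_integrableD:
  "square_integrable f \<Longrightarrow> integrable lborel (\<lambda>x. (norm (f x))\<^sup>2)"
  by (simp add: square_integrable_def)

lemma sq_norm_nonneg [simp]: "0 \<le> sq_norm f"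
  by (simp add: sq_norm_def)

lemma nn_integral_eq_sq_norm:
  "square_integrable f \<Longrightarrow> (\<integral>\<^sup>+x. ennreal ((norm (f x))\<^sup>2) \<partial>lborel) = ennreal (sq_norm f)"
  unfolding sq_norm_def by (rule nn_integral_eq_integral) (auto simp: square_integrable_def)

lemma square_integrable_iff_nn:
  "square_integrable f \<longleftrightarrow> f \<in> borel_measurable borel \<and>
     (\<integral>\<^sup>+x. ennreal ((norm (f x))\<^sup>2) \<partial>lborel) < \<infinity>"
  by (auto simp: square_integrable_def integrable_iff_bounded)

lemma square_integrable_bound:
  assumes g: "square_integrable g" and f: "f \<in> borel_measurable borel"
    and le: "\<And>x. norm (f x) \<le> norm (g x)"
  shows "square_integrable f" "sq_norm f \<le> sq_norm g"
proof -
  show *: "square_integrable f"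
    unfolding square_integrable_def
  proof
    show "integrable lborel (\<lambda>x. (norm (f x))\<^sup>2)"
      by (rule Bochner_Integration.integrable_bound[OF square_integrableD[OF g]])
        (use f le in \<open>auto intro!: power_mono\<close>)
  qed fact
  show "sq_norm f \<le> sq_norm g"
    unfolding sq_norm_def using * g le
    by (intro integral_mono) (auto simp: square_integrable_def intro!: power_mono)
qed

lemma square_integrable_cnj: "square_integrable f \<Longrightarrow> square_integrable (\<lambda>x. cnj (f x))"
  by (rule square_integrable_bound(1)[of f])
    (auto simp: square_integrable_def intro!: borel_measurable_continuous_on[where f=cnj] continuous_intros)

lemma norm_sq_add_le: "(norm (a + b :: 'b::real_normed_vector))\<^sup>2 \<le> 2 * (norm a)\<^sup>2 + 2 * (norm b)\<^sup>2"
proof -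
  have "(norm (a + b))\<^sup>2 \<le> (norm a + norm b)\<^sup>2"
    by (intro power_mono norm_triangle_ineq) auto
  also have "\<dots> \<le> 2 * (norm a)\<^sup>2 + 2 * (norm b)\<^sup>2"
    using sum_squares_bound[of "norm a" "norm b"] by (simp add: power2_sum)
  finally show ?thesis .
qed

lemma
  assumes f: "square_integrable f" and g: "square_integrable g"
  shows square_integrable_add: "square_integrable (\<lambda>x. f x + g x)"
    and sq_norm_add_le: "sq_norm (\<lambda>x. f x + g x) \<le> 2 * sq_norm f + 2 * sq_norm g"
proof -
  have [measurable]: "f \<in> borel_measurable borel" "g \<in> borel_measurable borel"
    using f g by (auto simp: square_integrable_def)
  have I: "integrable lborel (\<lambda>x. 2 * (norm (f x))\<^sup>2 + 2 * (norm (g x))\<^sup>2)"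
    using f g by (auto simp: square_integrable_def)
  show *: "square_integrable (\<lambda>x. f x + g x)"
    unfolding square_integrable_def
    by (auto intro!: Bochner_Integration.integrable_bound[OF I] norm_sq_add_le)
  have "sq_norm (\<lambda>x. f x + g x) \<le> (\<integral>x. 2 * (norm (f x))\<^sup>2 + 2 * (norm (g x))\<^sup>2 \<partial>lborel)"
    unfolding sq_norm_def using * I
    by (intro integral_mono) (auto simp: square_integrable_def norm_sq_add_le)
  also have "\<dots> = 2 * sq_norm f + 2 * sq_norm g"
    unfolding sq_norm_def using f g by (simp add: square_integrable_def)
  finally show "sq_norm (\<lambda>x. f x + g x) \<le> 2 * sq_norm f + 2 * sq_norm g" .
qed

lemma square_integrable_uminus: "square_integrable f \<Longrightarrow> square_integrable (\<lambda>x. - f x)"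
  by (simp add: square_integrable_def)

lemma sq_norm_uminus [simp]: "sq_norm (\<lambda>x. - f x) = sq_norm f"
  by (simp add: sq_norm_def)

lemma
  assumes f: "square_integrable f" and g: "square_integrable g"
  shows square_integrable_diff: "square_integrable (\<lambda>x. f x - g x)"
    and sq_norm_diff_le: "sq_norm (\<lambda>x. f x - g x) \<le> 2 * sq_norm f + 2 * sq_norm g"
  using square_integrable_add[OF f square_integrable_uminus[OF g]]
    sq_norm_add_le[OF f square_integrable_uminus[OF g]] by simp_all

lemma sq_norm_commute: "sq_norm (\<lambda>x. f x - g x) = sq_norm (\<lambda>x. g x - f x)"
  by (simp add: sq_norm_def norm_minus_commute)

lemma
  assumes f: "square_integrable f" and g: "square_integrable g"
  shows integrable_mult_L2: "integrable lborel (\<lambda>x. f x * g x)"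
    and integral_mult_L2_le: "(\<integral>x. norm (f x) * norm (g x) \<partial>lborel) \<le> sqrt (sq_norm f * sq_norm g)"
proof -
  have [measurable]: "f \<in> borel_measurable borel" "g \<in> borel_measurable borel"
    using f g by (auto simp: square_integrable_def)
  have "(\<integral>\<^sup>+x. ennreal (norm (f x)) * ennreal (norm (g x)) \<partial>lborel)\<^sup>2 \<le> 
      (\<integral>\<^sup>+x. ennreal (norm (f x))^2 \<partial>lborel) * (\<integral>\<^sup>+x. ennreal (norm (g x))^2 \<partial>lborel)"
    by (rule Cauchy_Schwarz_nn_integral) auto
  also have "\<dots> = ennreal (sq_norm f * sq_norm g)"
    using f g by (simp add: ennreal_power nn_integral_eq_sq_norm ennreal_mult)
  finally have *: "(\<integral>\<^sup>+x. ennreal (norm (f x) * norm (g x)) \<partial>lborel)\<^sup>2 \<le> ennreal (sq_norm f * sq_norm g)"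
    by (simp add: ennreal_mult)
  then have "(\<integral>\<^sup>+x. ennreal (norm (f x) * norm (g x)) \<partial>lborel)\<^sup>2 < \<infinity>"
    using le_less_trans by fastforce
  then have fin: "(\<integral>\<^sup>+x. ennreal (norm (f x) * norm (g x)) \<partial>lborel) < \<infinity>"
    by (simp add: power_less_top_ennreal)
  then show "integrable lborel (\<lambda>x. f x * g x)"
    by (simp add: integrable_iff_bounded norm_mult)
  have I: "integrable lborel (\<lambda>x. norm (f x) * norm (g x))"
    using fin by (simp add: integrable_iff_bounded norm_mult)
  have "(\<integral>\<^sup>+x. ennreal (norm (f x) * norm (g x)) \<partial>lborel) = ennreal (\<integral>x. norm (f x) * norm (g x) \<partial>lborel)"
    by (rule nn_integral_eq_integral[OF I]) auto
  with * have "ennreal ((\<integral>x. norm (f x) * norm (g x) \<partial>lborel)\<^sup>2) \<le> ennreal (sq_norm f * sq_norm g)"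
    by (simp add: ennreal_power)
  then have "(\<integral>x. norm (f x) * norm (g x) \<partial>lborel)\<^sup>2 \<le> sq_norm f * sq_norm g"
    by (simp add: ennreal_le_iff)
  then show "(\<integral>x. norm (f x) * norm (g x) \<partial>lborel) \<le> sqrt (sq_norm f * sq_norm g)"
    by (rule real_le_rsqrt)
qed

text \<open>The identity \<open>fn gn - f g = (fn - f) (gn - g) + (fn - f) g + f (gn - g)\<close> and the Cauchy-Schwarz
  inequality. This is the source of the continuity in time of the flux.\<close>

lemma L1_tendsto_mult_L2:
  fixes f g :: "'a::euclidean_space \<Rightarrow> 'b::{real_normed_field, second_countable_topology, banach}"
  assumes fn: "\<And>n. square_integrable (fn n)" and gn: "\<And>n. square_integrable (gn n)"
    and f: "square_integrable f" and g: "square_integrable g"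
    and F: "(\<lambda>n. sq_norm (\<lambda>x. fn n x - f x)) \<longlonglongrightarrow> 0"
    and G: "(\<lambda>n. sq_norm (\<lambda>x. gn n x - g x)) \<longlonglongrightarrow> 0"
  shows "(\<lambda>n. \<integral>x. norm (fn n x * gn n x - f x * g x) \<partial>lborel) \<longlonglongrightarrow> 0"
proof (rule real_tendsto_sandwich[where f="\<lambda>n. 0"])
  let ?F = "\<lambda>n x. fn n x - f x" and ?G = "\<lambda>n x. gn n x - g x"
  note dF = square_integrable_diff[OF fn f] and dG = square_integrable_diff[OF gn g]
  let ?b = "\<lambda>n. sqrt (sq_norm (?F n) * sq_norm (?G n)) + sqrt (sq_norm (?F n) * sq_norm g) 
            + sqrt (sq_norm f * sq_norm (?G n))"
  have "(\<integral>x. norm (fn n x * gn n x - f x * g x) \<partial>lborel) \<le> ?b n" for n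
  proof -
    have I: "integrable lborel (\<lambda>x. norm (?F n x) * norm (?G n x))"
      "integrable lborel (\<lambda>x. norm (?F n x) * norm (g x))"
      "integrable lborel (\<lambda>x. norm (f x) * norm (?G n x))"
      using integrable_mult_L2[OF dF dG, THEN integrable_norm]
        integrable_mult_L2[OF dF g, THEN integrable_norm]
        integrable_mult_L2[OF f dG, THEN integrable_norm] by (simp_all add: norm_mult)
    have "(\<integral>x. norm (fn n x * gn n x - f x * g x) \<partial>lborel) \<le>
       (\<integral>x. norm (?F n x) * norm (?G n x) + norm (?F n x) * norm (g x) + norm (f x) * norm (?G n x) \<partial>lborel)"
    proof (rule integral_mono)
      show "integrable lborel (\<lambda>x. norm (fn n x * gn n x - f x * g x))"
        using integrable_mult_L2[OF fn gn] integrable_mult_L2[OF f g] by auto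
      show "integrable lborel (\<lambda>x. norm (?F n x) * norm (?G n x) + norm (?F n x) * norm (g x) + norm (f x) * norm (?G n x))"
        using I by auto
      fix x
      have "fn n x * gn n x - f x * g x = ?F n x * ?G n x + ?F n x * g x + f x * ?G n x"
        by (simp add: algebra_simps)
      then show "norm (fn n x * gn n x - f x * g x) \<le>
          norm (?F n x) * norm (?G n x) + norm (?F n x) * norm (g x) + norm (f x) * norm (?G n x)"
        by (metis (no_types, lifting) norm_mult norm_triangle_le add_mono_thms_linordered_semiring(3) norm_triangle_ineq)
    qed
    also have "\<dots> \<le> ?b n"
      using I integral_mult_L2_le[OF dF dG, of n n] integral_mult_L2_le[OF dF g, of n] integral_mult_L2_le[OF f dG, of n]
      by simp
    finally show ?thesis .
  qed
  then show "eventually (\<lambda>n. (\<integral>x. norm (fn n x * gn n x - f x * g x) \<partial>lborel) \<le> ?b n) sequentially"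
    by auto
  have "?b \<longlonglongrightarrow> sqrt (0 * 0) + sqrt (0 * sq_norm g) + sqrt (sq_norm f * 0)"
    by (intro tendsto_intros F G)
  then show "?b \<longlonglongrightarrow> 0" by simp
qed auto

lemma integral_tendsto_of_L1:
  fixes f :: "'a \<Rightarrow> 'b::{banach, second_countable_topology}"
  assumes "\<And>n. integrable M (fn n)" "integrable M f"
    and "(\<lambda>n. \<integral>x. norm (fn n x - f x) \<partial>M) \<longlonglongrightarrow> 0"
  shows "(\<lambda>n. integral\<^sup>L M (fn n)) \<longlonglongrightarrow> integral\<^sup>L M f"
proof (rule LIM_zero_cancel, rule Lim_null_comparison[OF _ assms(3)], rule always_eventually, rule allI)
  fix n
  have "integral\<^sup>L M (fn n) - integral\<^sup>L M f = (\<integral>x. fn n x - f x \<partial>M)"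
    using assms by simp
  then show "norm (integral\<^sup>L M (fn n) - integral\<^sup>L M f) \<le> (\<integral>x. norm (fn n x - f x) \<partial>M)"
    by simp
qed

lemma integral_mult_tendsto_L2:
  fixes f g :: "'a::euclidean_space \<Rightarrow> 'b::{real_normed_field, second_countable_topology, banach}"
  assumes fn: "\<And>n. square_integrable (fn n)" and gn: "\<And>n. square_integrable (gn n)"
    and f: "square_integrable f" and g: "square_integrable g"
    and F: "(\<lambda>n. sq_norm (\<lambda>x. fn n x - f x)) \<longlonglongrightarrow> 0"
    and G: "(\<lambda>n. sq_norm (\<lambda>x. gn n x - g x)) \<longlonglongrightarrow> 0"
  shows "(\<lambda>n. \<integral>x. fn n x * gn n x \<partial>lborel) \<longlonglongrightarrow> (\<integral>x. f x * g x \<partial>lborel)"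
  using assms by (intro integral_tendsto_of_L1 integrable_mult_L2 L1_tendsto_mult_L2)

text \<open>Fatou's lemma identifies an \<open>L\<^sup>2\<close> limit with a pointwise limit directly, without passing to a
  subsequence.\<close>

lemma L2_limit_unique:
  assumes fn: "\<And>n. square_integrable (\<lambda>x. fn n x - g x)"
    and lim: "(\<lambda>n. sq_norm (\<lambda>x. fn n x - g x)) \<longlonglongrightarrow> 0"
    and g[measurable]: "g \<in> borel_measurable borel" and f[measurable]: "f \<in> borel_measurable borel"
    and pw: "AE x in lborel. (\<lambda>n. fn n x) \<longlonglongrightarrow> f x"
  shows "AE x in lborel. f x = g x"
proof -
  have [measurable]: "(\<lambda>x. fn n x - g x) \<in> borel_measurable borel" for n
    using fn by (simp add: square_integrable_def)
  have "(\<integral>\<^sup>+x. ennreal ((norm (f x - g x))\<^sup>2) \<partial>lborel)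
      = (\<integral>\<^sup>+x. liminf (\<lambda>n. ennreal ((norm (fn n x - g x))\<^sup>2)) \<partial>lborel)"
  proof (rule nn_integral_cong_AE, use pw in eventually_elim)
    case (elim x)
    have "(\<lambda>n. ennreal ((norm (fn n x - g x))\<^sup>2)) \<longlonglongrightarrow> ennreal ((norm (f x - g x))\<^sup>2)"
      by (intro tendsto_intros elim)
    from lim_imp_Liminf[OF _ this] show ?case by simp
  qed
  also have "\<dots> \<le> liminf (\<lambda>n. \<integral>\<^sup>+x. ennreal ((norm (fn n x - g x))\<^sup>2) \<partial>lborel)"
    by (rule nn_integral_liminf) auto
  also have "\<dots> = liminf (\<lambda>n. ennreal (sq_norm (\<lambda>x. fn n x - g x)))"
    by (simp add: nn_integral_eq_sq_norm[OF fn])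
  also have "\<dots> = 0"
    using lim_imp_Liminf[OF _ tendsto_ennrealI[OF lim]] by simp
  finally have "(\<integral>\<^sup>+x. ennreal ((norm (f x - g x))\<^sup>2) \<partial>lborel) = 0" by simp
  then have "AE x in lborel. ennreal ((norm (f x - g x))\<^sup>2) = 0"
    by (subst (asm) nn_integral_0_iff_AE) auto
  then show ?thesis
    by eventually_elim (simp add: ennreal_eq_0_iff)
qed

lemma lborel_distr_reflect: "distr lborel borel (\<lambda>x. a - x) = (lborel :: 'a::euclidean_space measure)"
  by (subst lborel_affine[of "-1" a]) (auto simp: density_1)

lemma nn_integral_lborel_reflect:
  fixes f :: "'a::euclidean_space \<Rightarrow> ennreal"
  assumes "f \<in> borel_measurable borel"
  shows "(\<integral>\<^sup>+x. f (a - x) \<partial>lborel) = (\<integral>\<^sup>+x. f x \<partial>lborel)"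
  by (subst (2) lborel_distr_reflect[of a, symmetric], subst nn_integral_distr) (use assms in auto)

lemma nn_integral_lborel_shift:
  fixes f :: "'a::euclidean_space \<Rightarrow> ennreal"
  assumes "f \<in> borel_measurable borel"
  shows "(\<integral>\<^sup>+x. f (x - a) \<partial>lborel) = (\<integral>\<^sup>+x. f x \<partial>lborel)"
  by (subst (2) lborel_distr_plus[of "-a", symmetric], subst nn_integral_distr) (use assms in auto)

lemma integral_lborel_reflect:
  fixes f :: "'a::euclidean_space \<Rightarrow> 'b::{banach, second_countable_topology}"
  assumes "f \<in> borel_measurable borel"
  shows "(\<integral>x. f (a - x) \<partial>lborel) = (\<integral>x. f x \<partial>lborel)"
  by (subst (2) lborel_distr_reflect[of a, symmetric], subst integral_distr) (use assms in auto)

lemma integrable_lborel_reflect: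
  fixes f :: "'a::euclidean_space \<Rightarrow> 'b::{banach, second_countable_topology}"
  assumes "integrable lborel f"
  shows "integrable lborel (\<lambda>x. f (a - x))"
proof -
  have [measurable]: "f \<in> borel_measurable borel" using assms by auto
  have "integrable (distr lborel borel (\<lambda>x. a - x)) f"
    using assms by (simp add: lborel_distr_reflect)
  then show ?thesis by (subst (asm) integrable_distr_eq) auto
qed

lemma integrable_lborel_shift:
  fixes f :: "'a::euclidean_space \<Rightarrow> 'b::{banach, second_countable_topology}"
  assumes "integrable lborel f"
  shows "integrable lborel (\<lambda>x. f (x - a))"
  using integrable_lborel_reflect[OF integrable_lborel_reflect[OF assms, of 0], of a]
  by simp

lemma integral_lborel_shift:
  fixes f :: "'a::euclidean_space \<Rightarrow> 'b::{banach, second_countable_topology}"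
  assumes [measurable]: "f \<in> borel_measurable borel"
  shows "(\<integral>x. f (x - a) \<partial>lborel) = (\<integral>x. f x \<partial>lborel)"
  using integral_lborel_reflect[of "\<lambda>x. f (0 - x)" a] integral_lborel_reflect[of f 0] by simp

lemma
  fixes f :: "'a::euclidean_space \<Rightarrow> 'b::{real_normed_field, second_countable_topology, banach}"
  assumes "square_integrable f"
  shows square_integrable_reflect: "square_integrable (\<lambda>x. f (a - x))"
    and sq_norm_reflect: "sq_norm (\<lambda>x. f (a - x)) = sq_norm f"
    and square_integrable_shift: "square_integrable (\<lambda>x. f (x - a))"
    and sq_norm_shift: "sq_norm (\<lambda>x. f (x - a)) = sq_norm f"
proof -
  have [measurable]: "f \<in> borel_measurable borel" using assms by measurable
  show "square_integrable (\<lambda>x. f (a - x))" "square_integrable (\<lambda>x. f (x - a))"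
    using integrable_lborel_reflect[OF square_integrableD[OF assms], of a]
      integrable_lborel_shift[OF square_integrableD[OF assms], of a]
    by (auto simp: square_integrable_def)
  show "sq_norm (\<lambda>x. f (a - x)) = sq_norm f" "sq_norm (\<lambda>x. f (x - a)) = sq_norm f"
    unfolding sq_norm_def
    using integral_lborel_reflect[of "\<lambda>x. (norm (f x))\<^sup>2" a] integral_lborel_shift[of "\<lambda>x. (norm (f x))\<^sup>2" a]
    by auto
qed

text \<open>The truncations in the definition of the Plancherel transform.\<close>

definition truncate_ball :: "nat \<Rightarrow> ('a::euclidean_space \<Rightarrow> 'b::real_vector) \<Rightarrow> 'a \<Rightarrow> 'b" where
  "truncate_ball n f x = indicator (cball 0 (real n)) x *\<^sub>R f x"

lemma eventually_truncate_ball: "eventually (\<lambda>n. truncate_ball n f x = f x) sequentially"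
proof -
  obtain N :: nat where "norm x \<le> real N" using real_arch_simple by blast
  then show ?thesis
    by (auto simp: truncate_ball_def eventually_sequentially intro!: exI[of _ N])
qed

lemma
  fixes f :: "'a::euclidean_space \<Rightarrow> 'b::{real_normed_field, second_countable_topology, banach}"
  assumes f: "square_integrable f"
  shows square_integrable_truncate_ball: "square_integrable (truncate_ball n f)"
    and integrable_truncate_ball: "integrable lborel (truncate_ball n f)"
    and truncate_ball_L2_tendsto: "(\<lambda>n. sq_norm (\<lambda>x. truncate_ball n f x - f x)) \<longlonglongrightarrow> 0"
proof -
  have [measurable]: "f \<in> borel_measurable borel" using f by measurable
  have m[measurable]: "truncate_ball n f \<in> borel_measurable borel" for n
    unfolding truncate_ball_def
    by (intro borel_measurable_scaleR borel_measurable_indicator) (auto simp: f square_integrable_measurable)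
  show "square_integrable (truncate_ball n f)"
    by (rule square_integrable_bound[OF f m]) (auto simp: truncate_ball_def indicator_def)
  let ?g = "\<lambda>x. indicator (cball 0 (real n)) x + (norm (f x))\<^sup>2 :: real"
  have "integrable lborel ?g"
    using square_integrableD[OF f] emeasure_bounded_finite[of "cball 0 (real n)"]
    by (intro Bochner_Integration.integrable_add integrable_real_indicator) auto
  then show "integrable lborel (truncate_ball n f)"
  proof (rule Bochner_Integration.integrable_bound)
    show "AE x in lborel. norm (truncate_ball n f x) \<le> norm (?g x)"
    proof (rule AE_I2)
      fix x
      \<comment> \<open>On a ball the constant 1 is integrable, so that \<open>L\<^sup>2\<close> is contained in \<open>L\<^sup>1\<close> there.\<close>
      have "norm (f x) \<le> 1 + (norm (f x))\<^sup>2"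
        using zero_le_power2[of "norm (f x) - 1/2"] unfolding power2_diff
        by (simp add: power2_eq_square algebra_simps)
      then show "norm (truncate_ball n f x) \<le> norm (?g x)"
        by (auto simp: truncate_ball_def indicator_def)
    qed
  qed simp
  have "(\<lambda>n. \<integral>x. (norm (truncate_ball n f x - f x))\<^sup>2 \<partial>lborel) \<longlonglongrightarrow> (\<integral>x. 0 \<partial>(lborel :: 'a measure))"
  proof (rule integral_dominated_convergence[where w="\<lambda>x. (norm (f x))\<^sup>2"])
    show "AE x in lborel. (\<lambda>n. (norm (truncate_ball n f x - f x))\<^sup>2) \<longlonglongrightarrow> 0"
    proof (rule AE_I2)
      fix x
      show "(\<lambda>n. (norm (truncate_ball n f x - f x))\<^sup>2) \<longlonglongrightarrow> 0"
        by (rule tendsto_eventually, rule eventually_mono[OF eventually_truncate_ball[of f x]]) simp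
    qed
    show "AE x in lborel. norm ((norm (truncate_ball n f x - f x))\<^sup>2) \<le> (norm (f x))\<^sup>2" for n
      by (auto simp: truncate_ball_def indicator_def)
  qed (use square_integrableD[OF f] in auto)
  then show "(\<lambda>n. sq_norm (\<lambda>x. truncate_ball n f x - f x)) \<longlonglongrightarrow> 0"
    by (simp add: sq_norm_def)
qed

lemma cis_measurable [measurable]: "cis \<in> borel_measurable borel"
  by (intro borel_measurable_continuous_onI continuous_intros)

section \<open>Continuity of translation\<close>

text \<open>Take an open superset \<open>U\<close> of \<open>A\<close> of almost the same measure. For \<open>x\<close> in \<open>A\<close> the point \<open>x + Z n\<close> is
  eventually in \<open>U\<close>, so by dominated convergence the translate of \<open>A\<close> leaves \<open>U\<close> only in small measure.
  As both indicators have the same integral, the integral of the absolute difference is twice that of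
  its positive part.\<close>

lemma translation_indicator_L1:
  fixes A :: "'a::euclidean_space set"
  assumes A[measurable]: "A \<in> sets borel" and fin: "emeasure lborel A < \<infinity>" and Z: "Z \<longlonglongrightarrow> 0"
  shows "(\<lambda>n. \<integral>x. \<bar>indicator A (x - Z n) - indicator A x\<bar> \<partial>lborel :: real) \<longlonglongrightarrow> 0"
proof -
  have intA: "integrable lborel (\<lambda>x. indicator A x :: real)"
    using fin by (intro integrable_real_indicator) auto
  have intAs: "integrable lborel (\<lambda>x. indicator A (x - a) :: real)" for a
    using integrable_lborel_shift[OF intA] .
  show ?thesis
  proof (rule order_tendstoI)
    fix a :: real assume "a < 0"
    then show "\<forall>\<^sub>F n in sequentially. a < (\<integral>x. \<bar>indicator A (x - Z n) - indicator A x\<bar> \<partial>lborel)"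
      by (intro always_eventually allI) (rule less_le_trans[where y=0], auto)
  next
    fix a :: real assume a: "0 < a"
    obtain U where U: "open U" "A \<subseteq> U" "emeasure lborel (U - A) < ennreal (a / 4)"
      using outer_regular_lborel[OF A, of "a / 4"] a by auto
    have [measurable]: "U \<in> sets borel" using U by auto
    have mUA: "measure lborel (U - A) < a / 4"
    proof -
      have "emeasure lborel (U - A) = ennreal (measure lborel (U - A))"
        using U(3) by (intro emeasure_eq_ennreal_measure) auto
      then show ?thesis using U(3) by (simp add: ennreal_less_iff)
    qed
    have intUA: "integrable lborel (\<lambda>x. indicator (U - A) x :: real)"
      using U(3) by (intro integrable_real_indicator) (auto intro: order.strict_trans)
    let ?k = "\<lambda>n x. indicator A x * (1 - indicator U (x + Z n)) :: real"
    have "(\<lambda>n. \<integral>x. ?k n x \<partial>lborel) \<longlonglongrightarrow> (\<integral>x. 0 \<partial>(lborel :: 'a measure))"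
    proof (rule integral_dominated_convergence[where w="indicator A"])
      show "AE x in lborel. (\<lambda>n. ?k n x) \<longlonglongrightarrow> 0"
      proof (rule AE_I2, rule tendsto_eventually)
        fix x
        have "(\<lambda>n. x + Z n) \<longlonglongrightarrow> x + 0" by (intro tendsto_intros Z)
        then have "\<forall>\<^sub>F n in sequentially. x + Z n \<in> U" if "x \<in> A"
          using that U by (auto dest: topological_tendstoD)
        then show "\<forall>\<^sub>F n in sequentially. ?k n x = 0"
          by (cases "x \<in> A") (auto elim: eventually_mono)
      qed
    qed (use intA in \<open>auto split: split_indicator\<close>)
    then have "\<forall>\<^sub>F n in sequentially. (\<integral>x. ?k n x \<partial>lborel) < a / 4"
      using a by (intro order_tendstoD) auto
    then show "\<forall>\<^sub>F n in sequentially. (\<integral>x. \<bar>indicator A (x - Z n) - indicator A x\<bar> \<partial>lborel) < a"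
    proof eventually_elim
      case (elim n)
      let ?f = "\<lambda>x. indicator A (x - Z n) :: real" and ?g = "\<lambda>x. indicator A x :: real"
      have intk: "integrable lborel (\<lambda>x. ?k n x)"
        by (rule Bochner_Integration.integrable_bound[OF intA]) (auto split: split_indicator)
      have ints: "integrable lborel (\<lambda>x. ?k n (x - Z n))"
        by (rule integrable_lborel_shift[OF intk])
      have "(\<integral>x. \<bar>?f x - ?g x\<bar> \<partial>lborel) \<le> (\<integral>x. 2 * (?k n (x - Z n) + indicator (U - A) x) - (?f x - ?g x) \<partial>lborel)"
      proof (rule integral_mono)
        show "integrable lborel (\<lambda>x. \<bar>?f x - ?g x\<bar>)"
          using intA intAs[of "Z n"] by (intro integrable_abs Bochner_Integration.integrable_diff) auto
        show "integrable lborel (\<lambda>x. 2 * (?k n (x - Z n) + indicator (U - A) x) - (?f x - ?g x))"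
          using intA intAs[of "Z n"] intUA ints by auto
        show "\<bar>?f x - ?g x\<bar> \<le> 2 * (?k n (x - Z n) + indicator (U - A) x) - (?f x - ?g x)" for x
          using U(2) by (auto split: split_indicator)
      qed
      also have "\<dots> = 2 * ((\<integral>x. ?k n (x - Z n) \<partial>lborel) + measure lborel (U - A))
            - ((\<integral>x. ?f x \<partial>lborel) - (\<integral>x. ?g x \<partial>lborel))"
        using intA intAs[of "Z n"] intUA ints by simp
      also have "(\<integral>x. ?k n (x - Z n) \<partial>lborel) = (\<integral>x. ?k n x \<partial>lborel)"
        by (rule integral_lborel_shift) measurable
      also have "(\<integral>x. ?f x \<partial>lborel) = (\<integral>x. ?g x \<partial>lborel)"
        by (rule integral_lborel_shift[of "indicator A"]) measurable
      finally show ?case using elim mUA by simp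
    qed
  qed
qed

lemma translation_L1_tendsto:
  fixes f :: "'a::euclidean_space \<Rightarrow> 'b::{banach, second_countable_topology}"
  assumes f: "integrable lborel f" and Z: "Z \<longlonglongrightarrow> 0"
  shows "(\<lambda>n. \<integral>x. norm (f (x - Z n) - f x) \<partial>lborel) \<longlonglongrightarrow> 0"
  using f
proof (induct f rule: integrable_induct)
  case (base A c)
  have "(\<lambda>n. (\<integral>x. \<bar>indicator A (x - Z n) - indicator A x\<bar> \<partial>lborel) * norm c) \<longlonglongrightarrow> 0 * norm c"
    using base by (intro tendsto_intros translation_indicator_L1 Z) auto
  then show ?case
    by (simp flip: scaleR_diff_left integral_mult_left_zero)
next
  case (add f g)
  have "(\<integral>x. norm (f (x - Z n) + g (x - Z n) - (f x + g x)) \<partial>lborel) \<le>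
     (\<integral>x. norm (f (x - Z n) - f x) \<partial>lborel) + (\<integral>x. norm (g (x - Z n) - g x) \<partial>lborel)" for n
  proof -
    have I: "integrable lborel (\<lambda>x. norm (f (x - Z n) - f x))" "integrable lborel (\<lambda>x. norm (g (x - Z n) - g x))"
       "integrable lborel (\<lambda>x. norm (f (x - Z n) + g (x - Z n) - (f x + g x)))"
      using add integrable_lborel_shift[OF add(1)] integrable_lborel_shift[OF add(3)] by auto
    have "norm (f (x - Z n) + g (x - Z n) - (f x + g x)) \<le> norm (f (x - Z n) - f x) + norm (g (x - Z n) - g x)" for x
      using norm_triangle_ineq[of "f (x - Z n) - f x" "g (x - Z n) - g x"] by (simp add: algebra_simps)
    then have "(\<integral>x. norm (f (x - Z n) + g (x - Z n) - (f x + g x)) \<partial>lborel) \<le>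
        (\<integral>x. norm (f (x - Z n) - f x) + norm (g (x - Z n) - g x) \<partial>lborel)"
      using I by (intro integral_mono) auto
    then show ?thesis using I by simp
  qed
  moreover have "(\<lambda>n. (\<integral>x. norm (f (x - Z n) - f x) \<partial>lborel) + (\<integral>x. norm (g (x - Z n) - g x) \<partial>lborel)) \<longlonglongrightarrow> 0"
    using tendsto_add[OF add(2,4)] by simp
  ultimately show ?case
    by - (rule Lim_null_comparison[OF always_eventually], simp_all)
next
  case (lim f s)
  have [measurable]: "f \<in> borel_measurable borel" "s i \<in> borel_measurable borel" for i
    using borel_measurable_integrable[OF lim(1)] borel_measurable_integrable[OF lim(5)] by auto
  have "(\<lambda>i. \<integral>x. norm (s i x - f x) \<partial>lborel) \<longlonglongrightarrow> (\<integral>x. 0 \<partial>(lborel :: 'a measure))"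
  proof (rule integral_dominated_convergence[where w="\<lambda>x. 3 * norm (f x)"])
    show "AE x in lborel. (\<lambda>i. norm (s i x - f x)) \<longlonglongrightarrow> 0"
      using lim(3) by (auto intro!: tendsto_norm_zero LIM_zero)
    show "AE x in lborel. norm (norm (s i x - f x)) \<le> 3 * norm (f x)" for i
    proof (rule AE_I2)
      fix x
      show "norm (norm (s i x - f x)) \<le> 3 * norm (f x)"
        using lim(4)[of x i] norm_triangle_ineq4[of "s i x" "f x"] by simp
    qed
  qed (use lim(5) in auto)
  then have s: "(\<lambda>i. \<integral>x. norm (s i x - f x) \<partial>lborel) \<longlonglongrightarrow> 0" by simp
  show ?case
  proof (rule order_tendstoI)
    fix a :: real assume "a < 0"
    then show "\<forall>\<^sub>F n in sequentially. a < (\<integral>x. norm (f (x - Z n) - f x) \<partial>lborel)"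
      by (intro always_eventually allI) (rule less_le_trans[where y=0], auto)
  next
    fix a :: real assume a: "0 < a"
    obtain i where i: "(\<integral>x. norm (s i x - f x) \<partial>lborel) < a / 3"
      using order_tendstoD(2)[OF s, of "a/3"] a by (auto simp: eventually_sequentially)
    have "\<forall>\<^sub>F n in sequentially. (\<integral>x. norm (s i (x - Z n) - s i x) \<partial>lborel) < a / 3"
      using order_tendstoD(2)[OF lim(2)[of i], of "a/3"] a by auto
    then show "\<forall>\<^sub>F n in sequentially. (\<integral>x. norm (f (x - Z n) - f x) \<partial>lborel) < a"
    proof eventually_elim
      case (elim n)
      have I: "integrable lborel (\<lambda>x. norm (s i (x - Z n) - f (x - Z n)))" "integrable lborel (\<lambda>x. norm (s i (x - Z n) - s i x))"
        "integrable lborel (\<lambda>x. norm (s i x - f x))" "integrable lborel (\<lambda>x. norm (f (x - Z n) - f x))"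
        using lim integrable_lborel_shift[OF lim(1)[of i], of "Z n"] integrable_lborel_shift[OF lim(5), of "Z n"] by auto
      have "norm (f (x - Z n) - f x) \<le> norm (s i (x - Z n) - f (x - Z n)) + norm (s i (x - Z n) - s i x) + norm (s i x - f x)" for x
        by (smt (verit) norm_diff_triangle_le norm_minus_commute)
      then have "(\<integral>x. norm (f (x - Z n) - f x) \<partial>lborel) \<le> 
         (\<integral>x. norm (s i (x - Z n) - f (x - Z n)) + norm (s i (x - Z n) - s i x) + norm (s i x - f x) \<partial>lborel)"
        using I by (intro integral_mono) auto
      also have "\<dots> = (\<integral>x. norm (s i (x - Z n) - f (x - Z n)) \<partial>lborel) + (\<integral>x. norm (s i (x - Z n) - s i x) \<partial>lborel) + (\<integral>x. norm (s i x - f x) \<partial>lborel)"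
        using I by simp
      also have "(\<integral>x. norm (s i (x - Z n) - f (x - Z n)) \<partial>lborel) = (\<integral>x. norm (s i x - f x) \<partial>lborel)"
        by (rule integral_lborel_shift[of "\<lambda>x. norm (s i x - f x)"]) measurable
      finally show ?case using i elim by simp
    qed
  qed
qed

text \<open>Bounded integrable functions \<open>g m\<close> approximate \<open>f\<close> in \<open>L\<^sup>2\<close>, and for them the square of the difference
  is at most \<open>2 m\<close> times the difference, to which the \<open>L\<^sup>1\<close> statement applies.\<close>

lemma translation_L2_tendsto:
  fixes f :: "'a::euclidean_space \<Rightarrow> 'b::{real_normed_field, second_countable_topology, banach}"
  assumes f: "square_integrable f" and Z: "Z \<longlonglongrightarrow> 0"
  shows "(\<lambda>n. sq_norm (\<lambda>x. f (x - Z n) - f x)) \<longlonglongrightarrow> 0"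
proof -
  have [measurable]: "f \<in> borel_measurable borel" using f by measurable
  define g where "g m x = (if norm (f x) \<le> real m then truncate_ball m f x else 0)" for m :: nat and x
  have ball[measurable]: "cball 0 r \<in> sets borel" for r :: real by simp
  have trm[measurable]: "truncate_ball m f \<in> borel_measurable borel" for m
    using square_integrable_truncate_ball[OF f] by measurable
  have gm[measurable]: "g m \<in> borel_measurable borel" for m
    unfolding g_def by measurable
  have gle: "norm (g m x) \<le> norm (f x)" "norm (g m x) \<le> real m" "norm (g m x) \<le> norm (truncate_ball m f x)" for m x
    by (auto simp: g_def truncate_ball_def indicator_def)
  have gsq: "square_integrable (g m)" for m
    by (rule square_integrable_bound[OF f gm gle(1)])
  have gint: "integrable lborel (g m)" for m
    by (rule Bochner_Integration.integrable_bound[OF integrable_truncate_ball[OF f, of m]]) (use gle in auto)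
  have "(\<lambda>m. \<integral>x. (norm (g m x - f x))\<^sup>2 \<partial>lborel) \<longlonglongrightarrow> (\<integral>x. 0 \<partial>(lborel :: 'a measure))"
  proof (rule integral_dominated_convergence[where w="\<lambda>x. (norm (f x))\<^sup>2"])
    show "AE x in lborel. (\<lambda>m. (norm (g m x - f x))\<^sup>2) \<longlonglongrightarrow> 0"
    proof (rule AE_I2)
      fix x
      obtain N :: nat where "norm (f x) \<le> real N" using real_arch_simple by blast
      then have "\<forall>\<^sub>F m in sequentially. norm (f x) \<le> real m"
        by (auto simp: eventually_sequentially intro!: exI[of _ N])
      from eventually_conj[OF this eventually_truncate_ball[of f x]]
      have "\<forall>\<^sub>F m in sequentially. (norm (g m x - f x))\<^sup>2 = 0"
        by (rule eventually_mono) (simp add: g_def)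
      then show "(\<lambda>m. (norm (g m x - f x))\<^sup>2) \<longlonglongrightarrow> 0"
        by (rule tendsto_eventually)
    qed
    show "AE x in lborel. norm ((norm (g m x - f x))\<^sup>2) \<le> (norm (f x))\<^sup>2" for m
      by (auto simp: g_def truncate_ball_def indicator_def)
  qed (use square_integrableD[OF f] in auto)
  then have gconv: "(\<lambda>m. sq_norm (\<lambda>x. g m x - f x)) \<longlonglongrightarrow> 0"
    by (simp add: sq_norm_def)
  show ?thesis
  proof (rule order_tendstoI)
    fix a :: real assume "a < 0"
    then show "\<forall>\<^sub>F n in sequentially. a < sq_norm (\<lambda>x. f (x - Z n) - f x)"
      by (intro always_eventually allI) (rule less_le_trans[where y=0], auto)
  next
    fix a :: real assume a: "0 < a"
    obtain m where m: "sq_norm (\<lambda>x. g m x - f x) < a / 16"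
      using order_tendstoD(2)[OF gconv, of "a/16"] a by (auto simp: eventually_sequentially)
    let ?r = "\<lambda>x. f x - g m x"
    have r: "square_integrable ?r" by (intro square_integrable_diff f gsq)
    have "(\<lambda>n. 4 * real m * (\<integral>x. norm (g m (x - Z n) - g m x) \<partial>lborel)) \<longlonglongrightarrow> 4 * real m * 0"
      by (intro tendsto_intros translation_L1_tendsto gint Z)
    then have "\<forall>\<^sub>F n in sequentially. 4 * real m * (\<integral>x. norm (g m (x - Z n) - g m x) \<partial>lborel) < a / 2"
      using a by (intro order_tendstoD) auto
    then show "\<forall>\<^sub>F n in sequentially. sq_norm (\<lambda>x. f (x - Z n) - f x) < a"
    proof eventually_elim
      case (elim n)
      have Ig: "integrable lborel (\<lambda>x. g m (x - Z n) - g m x)"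
        by (intro Bochner_Integration.integrable_diff integrable_lborel_shift gint)
      have sg: "square_integrable (\<lambda>x. g m (x - Z n) - g m x)" "square_integrable (\<lambda>x. ?r (x - Z n) - ?r x)"
        using square_integrable_diff[OF square_integrable_shift[OF gsq[of m], of "Z n"] gsq[of m]]
          square_integrable_diff[OF square_integrable_shift[OF r, of "Z n"] r] by auto
      have "sq_norm (\<lambda>x. g m (x - Z n) - g m x) \<le> (\<integral>x. 2 * real m * norm (g m (x - Z n) - g m x) \<partial>lborel)"
        unfolding sq_norm_def
      proof (rule integral_mono)
        fix x
        have "norm (g m (x - Z n) - g m x) \<le> 2 * real m"
          using gle(2)[of m x] gle(2)[of m "x - Z n"] norm_triangle_ineq4[of "g m (x - Z n)" "g m x"] by simp
        then show "(norm (g m (x - Z n) - g m x))\<^sup>2 \<le> 2 * real m * norm (g m (x - Z n) - g m x)"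
          by (simp add: power2_eq_square mult_right_mono)
      qed (use Ig square_integrableD[OF sg(1)] in auto)
      moreover have "sq_norm (\<lambda>x. ?r (x - Z n) - ?r x) \<le> 4 * sq_norm ?r"
        using sq_norm_diff_le[OF square_integrable_shift[OF r, of "Z n"] r] sq_norm_shift[OF r, of "Z n"] by simp
      moreover have "sq_norm (\<lambda>x. f (x - Z n) - f x) \<le>
          2 * sq_norm (\<lambda>x. g m (x - Z n) - g m x) + 2 * sq_norm (\<lambda>x. ?r (x - Z n) - ?r x)"
        using sq_norm_add_le[OF sg] by (simp add: algebra_simps)
      ultimately show ?case
        using m elim sq_norm_commute[of "g m" f] by simp
    qed
  qed
qed

lemma norm_cis_mult [simp]: "norm (cis x * z) = norm z"
  by (simp add: norm_mult)

lemma integrable_cis_mult: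
  fixes f :: "'a::euclidean_space \<Rightarrow> complex"
  assumes "integrable lborel f" and [measurable]: "c \<in> borel_measurable borel"
  shows "integrable lborel (\<lambda>x. cis (c x) * f x)"
  by (rule Bochner_Integration.integrable_bound[OF assms(1)]) (use assms in auto)

section \<open>The Gauss kernel\<close>

lemma normal_density_scale:
  assumes "\<sigma> > 0"
  shows "normal_density 0 \<sigma> (\<sigma> * x) = std_normal_density x / \<sigma>"
  using assms by (simp add: normal_density_def real_sqrt_mult power_mult_distrib field_simps)

lemma normal_density_fourier:
  assumes "\<sigma> > 0"
  shows "(\<integral>x. cis (- (x * \<xi>)) * complex_of_real (normal_density 0 \<sigma> x) \<partial>lborel) = exp (- (\<sigma>\<^sup>2 * \<xi>\<^sup>2) / 2)"
proof -
  have "complex_of_real (exp (- ((- \<sigma> * \<xi>)\<^sup>2) / 2)) = char std_normal_distribution (- \<sigma> * \<xi>)"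
    by (simp add: char_std_normal_distribution)
  also have "\<dots> = (\<integral>x. std_normal_density x *\<^sub>R cis (- (\<sigma> * x * \<xi>)) \<partial>lborel)"
    unfolding char_def
    by (subst integral_density) (auto simp: normal_density_nonneg cis_conv_exp mult_ac)
  also have "\<dots> = \<sigma> *\<^sub>R (\<integral>x. cis (- ((0 + \<sigma> * x) * \<xi>)) * complex_of_real (normal_density 0 \<sigma> (0 + \<sigma> * x)) \<partial>lborel)"
    using assms by (subst integral_scaleR_right[symmetric])
      (auto intro!: Bochner_Integration.integral_cong simp: normal_density_scale scaleR_conv_of_real)
  also have "\<dots> = (\<integral>x. cis (- (x * \<xi>)) * complex_of_real (normal_density 0 \<sigma> x) \<partial>lborel)"
    using assms lborel_integral_real_affine[of \<sigma> "\<lambda>x. cis (- (x * \<xi>)) * complex_of_real (normal_density 0 \<sigma> x)" 0]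
    by simp
  finally show ?thesis by (simp add: power_mult_distrib)
qed

lemma has_derivative_normal_density:
  assumes "\<sigma> > 0"
  shows "(normal_density 0 \<sigma> has_real_derivative - x / \<sigma>\<^sup>2 * normal_density 0 \<sigma> x) (at x)"
  unfolding normal_density_def[abs_def] using assms
  by (auto intro!: derivative_eq_intros simp: field_simps power2_eq_square)

lemma normal_density_tendsto_0:
  assumes "\<sigma> > 0"
  shows "(normal_density 0 \<sigma> \<longlongrightarrow> 0) at_top" "(normal_density 0 \<sigma> \<longlongrightarrow> 0) at_bot"
proof -
  have "filterlim (\<lambda>x::real. x\<^sup>2) at_top at_top" 
    by (rule filterlim_pow_at_top) (auto simp: filterlim_ident)
  then have "filterlim (\<lambda>x::real. (1 / (2 * \<sigma>\<^sup>2)) * x\<^sup>2) at_top at_top" 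
    using assms by (intro filterlim_tendsto_pos_mult_at_top[OF tendsto_const]) auto
  then have "filterlim (\<lambda>x::real. - ((1 / (2 * \<sigma>\<^sup>2)) * x\<^sup>2)) at_bot at_top" 
    by (simp add: filterlim_uminus_at_top)
  then have "((\<lambda>x. 1 / sqrt (2 * pi * \<sigma>\<^sup>2) * exp (- ((1 / (2 * \<sigma>\<^sup>2)) * x\<^sup>2))) \<longlongrightarrow> 1 / sqrt (2 * pi * \<sigma>\<^sup>2) * 0) at_top" 
    by (intro tendsto_intros filterlim_compose[OF exp_at_bot])
  then show *: "(normal_density 0 \<sigma> \<longlongrightarrow> 0) at_top"
    by (simp add: normal_density_def[abs_def] mult.commute)
  show "(normal_density 0 \<sigma> \<longlongrightarrow> 0) at_bot"
    unfolding filterlim_at_bot_mirror using * by (simp add: normal_density_def[abs_def])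
qed

text \<open>Integration by parts on the whole line: the derivative of \<open>cis (- (x * \<xi>)) * normal_density 0 \<sigma> x\<close>
  integrates to zero.\<close>

lemma normal_density_deriv_fourier:
  assumes "\<sigma> > 0"
  shows "(\<integral>x. cis (- (x * \<xi>)) * complex_of_real (- x / \<sigma>\<^sup>2 * normal_density 0 \<sigma> x) \<partial>lborel)
     = \<i> * \<xi> * exp (- (\<sigma>\<^sup>2 * \<xi>\<^sup>2) / 2)"
proof -
  let ?n = "normal_density 0 \<sigma>"
  let ?A = "\<lambda>x. cis (- (x * \<xi>)) * complex_of_real (- x / \<sigma>\<^sup>2 * ?n x)"
  let ?B = "\<lambda>x. cis (- (x * \<xi>)) * complex_of_real (?n x)"
  have iA: "integrable lborel ?A"
  proof (rule Bochner_Integration.integrable_bound)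
    show "integrable lborel (\<lambda>x. ?n x * \<bar>x\<bar> / \<sigma>\<^sup>2)"
      using integrable_normal_moment_abs[OF assms, of 0 1] by simp
  qed (use assms in \<open>auto simp: norm_mult norm_divide norm_power normal_density_nonneg abs_mult mult_ac\<close>)
  have iB: "integrable lborel ?B"
    by (rule Bochner_Integration.integrable_bound[OF integrable_normal_density[OF assms, of 0]])
      (auto simp: norm_mult normal_density_nonneg)
  have der: "(?B has_vector_derivative ?A x - \<i> * \<xi> * ?B x) (at x)" for x
  proof -
    have 1: "((\<lambda>x. complex_of_real (?n x)) has_vector_derivative complex_of_real (- x / \<sigma>\<^sup>2 * ?n x)) (at x)"
      by (intro has_vector_derivative_of_real has_derivative_normal_density assms)
    have 2: "((\<lambda>x. cis (- (x * \<xi>))) has_vector_derivative (- \<xi>) *\<^sub>R (\<i> * cis (- (x * \<xi>)))) (at x)"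
      unfolding cis_conv_exp
      by (auto intro!: derivative_eq_intros simp: Re_exp Im_exp has_vector_derivative_complex_iff)
    show ?thesis
      using has_vector_derivative_mult[OF 2 1] by (simp add: scaleR_conv_of_real mult_ac)
  qed
  have "(LBINT x=-\<infinity>..\<infinity>. ?A x - \<i> * \<xi> * ?B x) = 0 - 0"
  proof (rule interval_integral_FTC_integrable[where F="?B"])
    have "continuous_on UNIV ?n"
      using DERIV_isCont[OF has_derivative_normal_density[OF assms]] by (simp add: continuous_on_eq_continuous_at)
    then have "continuous_on UNIV (\<lambda>x. ?A x - \<i> * \<xi> * ?B x)"
      using assms by (intro continuous_intros) auto
    then show "isCont (\<lambda>x. ?A x - \<i> * \<xi> * ?B x) x" for x
      by (simp add: continuous_on_eq_continuous_at)
    show "set_integrable lborel (einterval (- \<infinity>) \<infinity>) (\<lambda>x. ?A x - \<i> * \<xi> * ?B x)"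
      using iA iB by (simp add: set_integrable_def)
    have t: "(?B \<longlongrightarrow> 0) at_top" "(?B \<longlongrightarrow> 0) at_bot"
      using normal_density_tendsto_0[OF assms]
      by - (rule tendsto_norm_zero_cancel, simp add: tendsto_rabs_zero)+
    show "((?B \<circ> real_of_ereal) \<longlongrightarrow> 0) (at_right (- \<infinity>))" "((?B \<circ> real_of_ereal) \<longlongrightarrow> 0) (at_left \<infinity>)"
      using t by (simp_all add: ereal_tendsto_simps1)
  qed (use der in auto)
  then have "(\<integral>x. ?A x - \<i> * \<xi> * ?B x \<partial>lborel) = 0"
    by (simp add: interval_lebesgue_integral_def set_lebesgue_integral_def)
  then have "(\<integral>x. ?A x \<partial>lborel) = \<i> * \<xi> * (\<integral>x. ?B x \<partial>lborel)"
    using iA iB by simp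
  then show ?thesis by (simp add: normal_density_fourier[OF assms])
qed

subsection \<open>Products of functions of one variable\<close>

lemma vector2_measurable [measurable]: 
  "(\<lambda>p. vector [fst p, snd p] :: real^2) \<in> borel_measurable (lborel \<Otimes>\<^sub>M lborel)"
proof -
  have eq: "(\<lambda>p. vector [fst p, snd p] :: real^2) = (\<lambda>p. \<chi> i. if i = 1 then fst p else snd p)"
    by (auto simp: fun_eq_iff vec_eq_iff forall_2)
  have "continuous_on UNIV (\<lambda>p::real\<times>real. if i = 1 then fst p else snd p)" for i :: 2
    by (cases "i = 1") (auto intro: continuous_intros)
  then have "(\<lambda>p. vector [fst p, snd p] :: real^2) \<in> borel_measurable borel"
    unfolding eq by (intro borel_measurable_continuous_onI continuous_on_vec_lambda)
  then show ?thesis unfolding lborel_prod by simp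
qed

text \<open>Fubini's theorem in the two coordinates of \<open>real^2\<close>, needed because the plane is here a type of
  vectors and not a product type.\<close>

lemma lborel_real2_eq: "(lborel :: (real^2) measure) = distr (lborel \<Otimes>\<^sub>M lborel) borel (\<lambda>p. vector [fst p, snd p])"
  (is "_ = distr _ _ ?v")
proof (rule lborel_eqI)
  fix l u :: "real^2" assume le: "\<And>b. b \<in> Basis \<Longrightarrow> l \<bullet> b \<le> u \<bullet> b"
  have le': "l $ i \<le> u $ i" for i using le[of "axis i 1"] by (auto simp: inner_axis axis_in_Basis_iff)
  have B: "(Basis :: (real^2) set) = {axis 1 1, axis 2 1}"
    by (auto simp: Basis_vec_def UNIV_2)
  have ne: "axis 1 1 \<noteq> (axis 2 1 :: real^2)" by (simp add: axis_eq_axis)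
  have "?v -` box l u = {l$1<..<u$1} \<times> {l$2<..<u$2}"
    by (auto simp: mem_box_cart forall_2)
  then have "emeasure (distr (lborel \<Otimes>\<^sub>M lborel) borel ?v) (box l u) =
      emeasure (lborel \<Otimes>\<^sub>M lborel) ({l$1<..<u$1} \<times> {l$2<..<u$2})"
    by (subst emeasure_distr) (auto simp: space_pair_measure)
  also have "\<dots> = ennreal (u$1 - l$1) * ennreal (u$2 - l$2)"
    using le' by (subst lborel.emeasure_pair_measure_Times) auto
  also have "\<dots> = (\<Prod>b\<in>Basis. (u - l) \<bullet> b)"
    unfolding B using ne le' by (simp add: inner_axis ennreal_mult)
  finally show "emeasure (distr (lborel \<Otimes>\<^sub>M lborel) borel ?v) (box l u) = (\<Prod>b\<in>Basis. (u - l) \<bullet> b)" .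
qed simp

lemma vec_nth_measurable [measurable]: "(\<lambda>z::real^2. z $ i) \<in> borel_measurable borel"
  by (intro borel_measurable_continuous_onI continuous_intros)

lemma
  fixes f g :: "real \<Rightarrow> complex"
  assumes f: "integrable lborel f" and g: "integrable lborel g"
  shows integrable_prod_real2: "integrable lborel (\<lambda>z::real^2. f (z $ 1) * g (z $ 2))"
    and integral_prod_real2: "(\<integral>z. f (z $ 1) * g (z $ 2) \<partial>(lborel :: (real^2) measure)) = (\<integral>x. f x \<partial>lborel) * (\<integral>x. g x \<partial>lborel)"
proof -
  have [measurable]: "f \<in> borel_measurable borel" "g \<in> borel_measurable borel" using f g by auto
  have I: "integrable (lborel \<Otimes>\<^sub>M lborel) (\<lambda>p. f (fst p) * g (snd p))"
    by (rule lborel_pair.Fubini_integrable) (use f g in \<open>auto simp: norm_mult\<close>)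
  have "integrable (distr (lborel \<Otimes>\<^sub>M lborel) borel (\<lambda>p. vector [fst p, snd p] :: real^2)) (\<lambda>z. f (z $ 1) * g (z $ 2))"
    using I by (subst integrable_distr_eq) auto
  then show "integrable lborel (\<lambda>z::real^2. f (z $ 1) * g (z $ 2))"
    by (simp only: lborel_real2_eq[symmetric])
  have "(\<integral>z. f (z $ 1) * g (z $ 2) \<partial>(lborel :: (real^2) measure)) = (\<integral>p. f (fst p) * g (snd p) \<partial>(lborel \<Otimes>\<^sub>M lborel))"
    by (subst lborel_real2_eq, subst integral_distr) auto
  also have "\<dots> = (\<integral>x. f x \<partial>lborel) * (\<integral>x. g x \<partial>lborel)"
    using lborel_pair.integral_fst'[OF I] by simp
  finally show "(\<integral>z. f (z $ 1) * g (z $ 2) \<partial>(lborel :: (real^2) measure)) = (\<integral>x. f x \<partial>lborel) * (\<integral>x. g x \<partial>lborel)" .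
qed

definition FT :: "('a::euclidean_space \<Rightarrow> complex) \<Rightarrow> 'a \<Rightarrow> complex" where
  "FT f \<xi> = (\<integral>x. cis (- (x \<bullet> \<xi>)) * f x \<partial>lborel)"

text \<open>The partial derivatives of the heat kernel.\<close>

definition heat_grad :: "real \<Rightarrow> 2 \<Rightarrow> real^2 \<Rightarrow> real" where
  "heat_grad r j z = - (z $ j) / (2 * r) * heat_kernel r z"

lemma norm_real2: "(norm (z :: real^2))\<^sup>2 = (z $ 1)\<^sup>2 + (z $ 2)\<^sup>2"
  by (subst power2_norm_eq_inner) (simp add: inner_vec_def sum_2 power2_eq_square)

lemma inner_real2: "(z :: real^2) \<bullet> w = z $ 1 * w $ 1 + z $ 2 * w $ 2"
  by (simp add: inner_vec_def sum_2)

lemma heat_kernel_eq_prod: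
  assumes "r > 0"
  shows "heat_kernel r z = normal_density 0 (sqrt (2 * r)) (z $ 1) * normal_density 0 (sqrt (2 * r)) (z $ 2)"
  using assms by (simp add: heat_kernel_def normal_density_def norm_real2 exp_add[symmetric] field_simps)

lemma heat_kernel_measurable [measurable]: "heat_kernel r \<in> borel_measurable borel"
  unfolding heat_kernel_def by measurable

lemma heat_grad_measurable [measurable]: "heat_grad r j \<in> borel_measurable borel"
  unfolding heat_grad_def by measurable

text \<open>In each coordinate the heat kernel is the normal density of variance \<open>2 r\<close>, and \<open>heat_grad\<close> is a
  product of that density and its derivative; all five claims reduce to one variable. The last one
  gives the integrable singularity \<open>r\<^sup>-\<^sup>1\<^sup>/\<^sup>2\<close> in Duhamel's formula.\<close>

lemma
  assumes r: "r > 0"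
  shows integrable_heat_kernel: "integrable lborel (heat_kernel r)"
    and heat_kernel_fourier: "FT (\<lambda>x. complex_of_real (heat_kernel r x)) \<xi> = exp (- r * (norm \<xi>)\<^sup>2)"
    and integrable_heat_grad: "integrable lborel (heat_grad r j)"
    and heat_grad_fourier: "FT (\<lambda>x. complex_of_real (heat_grad r j x)) \<xi> = \<i> * (\<xi> $ j) * exp (- r * (norm \<xi>)\<^sup>2)"
    and heat_grad_L1: "(\<integral>x. \<bar>heat_grad r j x\<bar> \<partial>lborel) = 1 / sqrt (pi * r)"
proof -
  define \<sigma> where "\<sigma> = sqrt (2 * r)"
  have \<sigma>: "\<sigma> > 0" "\<sigma>\<^sup>2 = 2 * r" using r by (auto simp: \<sigma>_def)
  let ?n = "normal_density 0 \<sigma>" and ?d = "\<lambda>x. - x / \<sigma>\<^sup>2 * normal_density 0 \<sigma> x"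
  have hk: "heat_kernel r z = ?n (z $ 1) * ?n (z $ 2)" for z
    using heat_kernel_eq_prod[OF r] by (simp add: \<sigma>_def)
  have hg: "heat_grad r 1 z = ?d (z $ 1) * ?n (z $ 2)" "heat_grad r 2 z = ?n (z $ 1) * ?d (z $ 2)" for z
    by (simp_all add: heat_grad_def hk \<sigma>)
  have i: "integrable lborel (\<lambda>x. complex_of_real (?n x))" 
    using integrable_normal_density[OF \<sigma>(1), of 0] by simp
  have id: "integrable lborel ?d"
    by (rule Bochner_Integration.integrable_bound[OF integrable_divide[OF integrable_normal_moment_abs[OF \<sigma>(1), of 0 1], of "\<sigma>\<^sup>2"]])
      (auto simp: normal_density_nonneg abs_mult mult_ac)
  then have di: "integrable lborel (\<lambda>x. complex_of_real (?d x))" by (rule integrable_of_real)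
  have iad: "integrable lborel (\<lambda>x. complex_of_real \<bar>?d x\<bar>)"
    using id by (intro integrable_of_real integrable_abs)
  have real: "integrable lborel (\<lambda>x. complex_of_real (f x)) \<Longrightarrow> integrable lborel f" for f :: "real^2 \<Rightarrow> real"
    using integrable_Re[of lborel "\<lambda>x. complex_of_real (f x)"] by simp
  show "integrable lborel (heat_kernel r)"
    using integrable_prod_real2[OF i i] by (intro real) (simp add: hk)
  show "integrable lborel (heat_grad r j)"
  proof (rule real)
    show "integrable lborel (\<lambda>x. complex_of_real (heat_grad r j x))"
      using integrable_prod_real2[OF i di] integrable_prod_real2[OF di i] exhaust_2[of j] hg by auto
  qed
  have cm: "integrable lborel f \<Longrightarrow> integrable lborel (\<lambda>x. cis (- (x * c)) * f x)" for f :: "real \<Rightarrow> complex" and c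
    by (rule integrable_cis_mult) measurable
  have split: "FT (\<lambda>z. f (z $ 1) * g (z $ 2)) \<xi> = (\<integral>x. cis (- (x * \<xi> $ 1)) * f x \<partial>lborel) * (\<integral>x. cis (- (x * \<xi> $ 2)) * g x \<partial>lborel)"
    if "integrable lborel f" "integrable lborel g" for f g
  proof -
    have eq: "cis (- (z \<bullet> \<xi>)) * (f (z $ 1) * g (z $ 2)) = (cis (- (z $ 1 * \<xi> $ 1)) * f (z $ 1)) * (cis (- (z $ 2 * \<xi> $ 2)) * g (z $ 2))" for z
    proof -
      have "cis (- (z \<bullet> \<xi>)) = cis (- (z $ 1 * \<xi> $ 1)) * cis (- (z $ 2 * \<xi> $ 2))"
        by (simp add: inner_real2 cis_mult)
      then show ?thesis by (simp only: mult_ac)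
    qed
    show ?thesis
      unfolding FT_def eq by (rule integral_prod_real2[OF cm[OF that(1)] cm[OF that(2)]])
  qed
  have e: "exp (- (\<sigma>\<^sup>2 * (\<xi> $ 1)\<^sup>2) / 2) * exp (- (\<sigma>\<^sup>2 * (\<xi> $ 2)\<^sup>2) / 2) = exp (- r * (norm \<xi>)\<^sup>2)"
    by (simp add: \<sigma> norm_real2 exp_add[symmetric] algebra_simps)
  show "FT (\<lambda>x. complex_of_real (heat_kernel r x)) \<xi> = exp (- r * (norm \<xi>)\<^sup>2)"
    using split[OF i i] normal_density_fourier[OF \<sigma>(1)] e
    by (simp add: hk flip: of_real_mult)
  show "FT (\<lambda>x. complex_of_real (heat_grad r j x)) \<xi> = \<i> * (\<xi> $ j) * exp (- r * (norm \<xi>)\<^sup>2)"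
    using exhaust_2[of j]
  proof
    assume j: "j = 1"
    have "FT (\<lambda>x. complex_of_real (heat_grad r j x)) \<xi> = FT (\<lambda>z. complex_of_real (?d (z $ 1)) * complex_of_real (?n (z $ 2))) \<xi>"
      by (simp add: j hg)
    also have "\<dots> = \<i> * (\<xi> $ j) * complex_of_real (exp (- (\<sigma>\<^sup>2 * (\<xi> $ 1)\<^sup>2) / 2) * exp (- (\<sigma>\<^sup>2 * (\<xi> $ 2)\<^sup>2) / 2))"
      unfolding split[OF di i] normal_density_fourier[OF \<sigma>(1)] normal_density_deriv_fourier[OF \<sigma>(1)]
      by (simp add: j)
    finally show ?thesis unfolding e .
  next
    assume j: "j = 2"
    have "FT (\<lambda>x. complex_of_real (heat_grad r j x)) \<xi> = FT (\<lambda>z. complex_of_real (?n (z $ 1)) * complex_of_real (?d (z $ 2))) \<xi>"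
      by (simp add: j hg)
    also have "\<dots> = \<i> * (\<xi> $ j) * complex_of_real (exp (- (\<sigma>\<^sup>2 * (\<xi> $ 1)\<^sup>2) / 2) * exp (- (\<sigma>\<^sup>2 * (\<xi> $ 2)\<^sup>2) / 2))"
      unfolding split[OF i di] normal_density_fourier[OF \<sigma>(1)] normal_density_deriv_fourier[OF \<sigma>(1)]
      by (simp add: j)
    finally show ?thesis unfolding e .
  qed
  have "(\<integral>x. \<bar>?d x\<bar> \<partial>lborel) = (\<integral>x. ?n x * \<bar>x - 0\<bar>^(2*0+1) / \<sigma>\<^sup>2 \<partial>lborel)"
    by (auto intro!: Bochner_Integration.integral_cong simp: normal_density_nonneg abs_mult)
  also have "\<dots> = sqrt (2 / pi) * \<sigma> / \<sigma>\<^sup>2"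
    using integral_normal_moment_abs_odd[OF \<sigma>(1), of 0 0] by simp
  also have "\<dots> = 1 / sqrt (pi * r)"
    using r unfolding \<sigma> unfolding \<sigma>_def by (simp add: real_sqrt_mult real_sqrt_divide field_simps)
  finally have d1: "(\<integral>x. \<bar>?d x\<bar> \<partial>lborel) = 1 / sqrt (pi * r)" .
  have cd1: "(\<integral>x. complex_of_real \<bar>?d x\<bar> \<partial>lborel) = 1 / sqrt (pi * r)"
    using d1 by (simp only: integral_complex_of_real) 
  have n1: "(\<integral>x. complex_of_real (?n x) \<partial>lborel) = 1"
    using integral_normal_density[OF \<sigma>(1), of 0] by (simp only: integral_complex_of_real of_real_1)
  have "complex_of_real (\<integral>x. \<bar>heat_grad r j x\<bar> \<partial>lborel) = (\<integral>x. complex_of_real \<bar>heat_grad r j x\<bar> \<partial>lborel)"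
    by (simp only: integral_complex_of_real)
  also have "\<dots> = complex_of_real (1 / sqrt (pi * r))"
    using exhaust_2[of j]
  proof
    assume j: "j = 1"
    have eq: "complex_of_real \<bar>heat_grad r j z\<bar> = complex_of_real \<bar>?d (z $ 1)\<bar> * complex_of_real (?n (z $ 2))" for z
      by (simp add: j hg abs_mult normal_density_nonneg)
    show ?thesis unfolding eq integral_prod_real2[OF iad i] cd1 n1 by simp
  next
    assume j: "j = 2"
    have eq: "complex_of_real \<bar>heat_grad r j z\<bar> = complex_of_real (?n (z $ 1)) * complex_of_real \<bar>?d (z $ 2)\<bar>" for z
      by (simp add: j hg abs_mult normal_density_nonneg)
    show ?thesis unfolding eq integral_prod_real2[OF i iad] cd1 n1 by simp
  qed
  finally show "(\<integral>x. \<bar>heat_grad r j x\<bar> \<partial>lborel) = 1 / sqrt (pi * r)"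
    by (simp only: of_real_eq_iff)
qed

text \<open>The Gauss function in the frequency variable is a multiple of the heat kernel at time
  \<open>1 / (4 * \<epsilon>)\<close>.\<close>

lemma gaussian_fourier:
  assumes "\<epsilon> > 0"
  shows "FT (\<lambda>\<xi>. complex_of_real (exp (- \<epsilon> * (norm \<xi>)\<^sup>2))) x = complex_of_real (4 * pi\<^sup>2 * heat_kernel \<epsilon> x)"
    and "integrable lborel (\<lambda>\<xi>::real^2. exp (- \<epsilon> * (norm \<xi>)\<^sup>2))"
proof -
  have e: "exp (- \<epsilon> * (norm \<xi>)\<^sup>2) = pi / \<epsilon> * heat_kernel (1 / (4 * \<epsilon>)) \<xi>" for \<xi> :: "real^2"
    using assms by (simp add: heat_kernel_def field_simps)
  have r: "1 / (4 * \<epsilon>) > 0" using assms by simp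
  show "integrable lborel (\<lambda>\<xi>::real^2. exp (- \<epsilon> * (norm \<xi>)\<^sup>2))"
    unfolding e by (intro integrable_mult_right integrable_heat_kernel r)
  have "FT (\<lambda>\<xi>. complex_of_real (exp (- \<epsilon> * (norm \<xi>)\<^sup>2))) x =
     complex_of_real (pi / \<epsilon>) * FT (\<lambda>\<xi>. complex_of_real (heat_kernel (1 / (4 * \<epsilon>)) \<xi>)) x"
    unfolding FT_def e by (subst integral_mult_right_zero[symmetric]) (simp add: mult_ac)
  also have "\<dots> = complex_of_real (4 * pi\<^sup>2 * heat_kernel \<epsilon> x)"
    unfolding heat_kernel_fourier[OF r] using assms
    by (simp add: heat_kernel_def power2_eq_square field_simps)
  finally show "FT (\<lambda>\<xi>. complex_of_real (exp (- \<epsilon> * (norm \<xi>)\<^sup>2))) x = complex_of_real (4 * pi\<^sup>2 * heat_kernel \<epsilon> x)" .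
qed

section \<open>Parseval's identity\<close>

lemma FT_measurable [measurable]:
  assumes [measurable]: "f \<in> borel_measurable borel"
  shows "FT f \<in> borel_measurable borel"
  unfolding FT_def by measurable

lemma norm_FT_le:
  assumes "integrable lborel f"
  shows "norm (FT f \<xi>) \<le> (\<integral>x. norm (f x) \<partial>lborel)"
  unfolding FT_def using integral_norm_bound[of lborel "\<lambda>x. cis (- (x \<bullet> \<xi>)) * f x"] by simp

lemma FT_diff:
  assumes "integrable lborel f" "integrable lborel g"
  shows "FT (\<lambda>x. f x - g x) \<xi> = FT f \<xi> - FT g \<xi>"
  unfolding FT_def right_diff_distrib
  by (intro Bochner_Integration.integral_diff integrable_cis_mult assms) measurable

text \<open>Both sides are the double integral of \<open>cis (- (x \<bullet> \<xi>)) * f x * g \<xi>\<close>.\<close>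

lemma FT_multiplication:
  assumes f: "integrable lborel f" and g: "integrable lborel g"
  shows "(\<integral>\<xi>. FT f \<xi> * g \<xi> \<partial>lborel) = (\<integral>x. f x * FT g x \<partial>lborel)"
proof -
  have [measurable]: "f \<in> borel_measurable borel" "g \<in> borel_measurable borel" using f g by auto
  let ?h = "\<lambda>\<xi> x. cis (- (x \<bullet> \<xi>)) * (f x * g \<xi>)"
  have I: "integrable (lborel \<Otimes>\<^sub>M lborel) (case_prod ?h)"
  proof (rule lborel_pair.Fubini_integrable)
    have "integrable lborel (?h \<xi>)" for \<xi>
      using f by (intro integrable_cis_mult integrable_mult_left) auto
    then show "AE \<xi> in lborel. integrable lborel (\<lambda>x. case (\<xi>, x) of (\<xi>, x) \<Rightarrow> ?h \<xi> x)" by simp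
    have "(\<integral>x. norm (?h \<xi> x) \<partial>lborel) = (\<integral>x. norm (f x) \<partial>lborel) * norm (g \<xi>)" for \<xi>
      by (simp add: norm_mult)
    moreover have "integrable lborel (\<lambda>\<xi>. (\<integral>x. norm (f x) \<partial>lborel) * norm (g \<xi>))"
      using g by (intro integrable_mult_right integrable_norm)
    ultimately show "integrable lborel (\<lambda>\<xi>. \<integral>x. norm (case (\<xi>, x) of (\<xi>, x) \<Rightarrow> ?h \<xi> x) \<partial>lborel)" by simp
  qed measurable
  have "(\<integral>\<xi>. FT f \<xi> * g \<xi> \<partial>lborel) = (\<integral>\<xi>. (\<integral>x. ?h \<xi> x \<partial>lborel) \<partial>lborel)"
    unfolding FT_def by (simp add: mult.assoc flip: integral_mult_left_zero)
  also have "\<dots> = (\<integral>x. (\<integral>\<xi>. ?h \<xi> x \<partial>lborel) \<partial>lborel)"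
    by (rule lborel_pair.Fubini_integral[symmetric, OF I])
  also have "\<dots> = (\<integral>x. f x * FT g x \<partial>lborel)"
    unfolding FT_def by (simp add: mult_ac inner_commute flip: integral_mult_right_zero)
  finally show ?thesis .
qed

lemma FT_modulate: "FT (\<lambda>x. cis (- (x \<bullet> a)) * f x) \<xi> = FT f (\<xi> + a)"
  unfolding FT_def by (simp add: cis_mult inner_add_right flip: mult.assoc) 

lemma FT_cnj: "FT (\<lambda>x. cnj (f x)) \<xi> = cnj (FT f (- \<xi>))"
proof -
  have "cnj (FT f (- \<xi>)) = (\<integral>x. cnj (cis (- (x \<bullet> - \<xi>)) * f x) \<partial>lborel)"
    unfolding FT_def by (rule Bochner_Integration.integral_cnj[symmetric])
  then show ?thesis by (simp add: FT_def cis_cnj)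
qed

text \<open>Applying \<open>FT_multiplication\<close> twice moves both transforms to the Gauss function. The bilinear form, with
  \<open>- \<xi>\<close> in the second factor in place of a complex conjugate, is the one that later yields the
  convolution theorem.\<close>

lemma FT_gaussian_identity:
  fixes f g :: "real^2 \<Rightarrow> complex"
  assumes f: "integrable lborel f" and g: "integrable lborel g" and \<epsilon>: "\<epsilon> > 0"
  shows "(\<integral>\<xi>. FT f \<xi> * FT g (- \<xi>) * exp (- \<epsilon> * (norm \<xi>)\<^sup>2) \<partial>lborel) =
    4 * pi\<^sup>2 * (\<integral>x. f x * (\<integral>y. g y * heat_kernel \<epsilon> (y - x) \<partial>lborel) \<partial>lborel)"
proof -
  have [measurable]: "f \<in> borel_measurable borel" "g \<in> borel_measurable borel" using f g by auto
  have G: "integrable lborel (\<lambda>\<xi>::real^2. complex_of_real (exp (- \<epsilon> * (norm \<xi>)\<^sup>2)))"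
    using gaussian_fourier(2)[OF \<epsilon>] by (rule integrable_of_real)
  let ?\<phi> = "\<lambda>\<xi>. FT g (- \<xi>) * complex_of_real (exp (- \<epsilon> * (norm \<xi>)\<^sup>2))"
  have \<phi>: "integrable lborel ?\<phi>"
  proof (rule Bochner_Integration.integrable_bound)
    show "integrable lborel (\<lambda>\<xi>::real^2. (\<integral>x. norm (g x) \<partial>lborel) * exp (- \<epsilon> * (norm \<xi>)\<^sup>2))"
      by (intro integrable_mult_right gaussian_fourier(2) \<epsilon>)
  qed (auto simp: norm_mult intro!: mult_right_mono norm_FT_le[OF g] order_trans[OF norm_FT_le[OF g] abs_ge_self])
  have "FT ?\<phi> x = 4 * pi\<^sup>2 * (\<integral>y. g y * heat_kernel \<epsilon> (y - x) \<partial>lborel)" for x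
  proof -
    let ?e = "\<lambda>\<zeta>. cis (- (\<zeta> \<bullet> - x)) * complex_of_real (exp (- \<epsilon> * (norm \<zeta>)\<^sup>2))"
    have "FT ?\<phi> x = (\<integral>\<zeta>. FT g \<zeta> * ?e \<zeta> \<partial>lborel)"
      unfolding FT_def[of ?\<phi>]
      using integral_lborel_reflect[of "\<lambda>\<zeta>. FT g \<zeta> * ?e \<zeta>" 0] by (simp add: mult_ac)
    also have "\<dots> = (\<integral>y. g y * FT ?e y \<partial>lborel)"
      by (rule FT_multiplication[OF g integrable_cis_mult[OF G]]) measurable
    also have "\<dots> = (\<integral>y. g y * complex_of_real (4 * pi\<^sup>2 * heat_kernel \<epsilon> (y - x)) \<partial>lborel)"
      unfolding FT_modulate gaussian_fourier(1)[OF \<epsilon>] by simp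
    finally show ?thesis by (simp add: mult_ac flip: integral_mult_right_zero)
  qed
  then show ?thesis
    using FT_multiplication[OF f \<phi>] by (simp add: mult_ac flip: integral_mult_right_zero)
qed

lemma integral_lborel_scale:
  fixes h :: "real^2 \<Rightarrow> 'b::{banach, second_countable_topology}"
  assumes [measurable]: "h \<in> borel_measurable borel" and c: "c > 0"
  shows "(\<integral>x. h x \<partial>lborel) = c\<^sup>2 *\<^sub>R (\<integral>x. h (c *\<^sub>R x) \<partial>lborel)"
  using c by (subst lborel_affine[of c 0]) (auto simp: integral_density integral_distr)

lemma heat_kernel_scale:
  assumes "r > 0" shows "r * heat_kernel r (sqrt r *\<^sub>R z) = heat_kernel 1 z"
  using assms by (simp add: heat_kernel_def power_mult_distrib)

lemma heat_kernel_nonneg: "r > 0 \<Longrightarrow> 0 \<le> heat_kernel r z"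
  by (simp add: heat_kernel_def)

lemma integral_heat_kernel:
  assumes "r > 0" shows "(\<integral>z. heat_kernel r z \<partial>lborel) = 1"
proof -
  have "complex_of_real (\<integral>z. heat_kernel r z \<partial>lborel) = FT (\<lambda>x. complex_of_real (heat_kernel r x)) 0"
    by (simp add: FT_def)
  also have "\<dots> = 1" using heat_kernel_fourier[OF assms, of 0] by simp
  finally show ?thesis by (simp only: of_real_eq_1_iff)
qed

text \<open>The double integral is the mean of the correlation \<open>A z\<close>, the integral of \<open>f x * g (x + z)\<close>, against the
  heat kernel. The scaling \<open>z = sqrt r *\<^sub>R z'\<close> turns it into a mean of \<open>A (sqrt r *\<^sub>R z')\<close> against a fixed
  density, and \<open>A\<close> is bounded and continuous at \<open>0\<close> by the continuity of translations in \<open>L\<^sup>2\<close>.\<close>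

lemma heat_kernel_approx_identity:
  fixes f g :: "real^2 \<Rightarrow> complex"
  assumes f: "integrable lborel f" "square_integrable f" and g: "integrable lborel g" "square_integrable g"
    and \<epsilon>: "\<And>n. \<epsilon> n > 0" "\<epsilon> \<longlonglongrightarrow> 0"
  shows "(\<lambda>n. \<integral>x. f x * (\<integral>y. g y * heat_kernel (\<epsilon> n) (y - x) \<partial>lborel) \<partial>lborel) \<longlonglongrightarrow> (\<integral>x. f x * g x \<partial>lborel)"
proof -
  have [measurable]: "f \<in> borel_measurable borel" "g \<in> borel_measurable borel" using f g by auto
  let ?K = "\<lambda>r z. complex_of_real (heat_kernel r z)"
  define A where "A z = (\<integral>x. f x * g (x + z) \<partial>lborel)" for z
  have gs: "square_integrable (\<lambda>x. g (x + z))" "sq_norm (\<lambda>x. g (x + z)) = sq_norm g" for z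
    using square_integrable_shift[OF g(2), of "-z"] sq_norm_shift[OF g(2), of "-z"] by auto
  have A_le: "norm (A z) \<le> sqrt (sq_norm f * sq_norm g)" for z
    using integral_norm_bound[of lborel "\<lambda>x. f x * g (x + z)"] integral_mult_L2_le[OF f(2) gs(1), of z]
    unfolding A_def norm_mult gs(2) by (rule order_trans)
  have [measurable]: "A \<in> borel_measurable borel"
    unfolding A_def by measurable
  have A_lim: "(\<lambda>n. A (Z n)) \<longlonglongrightarrow> A 0" if "Z \<longlonglongrightarrow> 0" for Z
  proof -
    have "(\<lambda>n. - Z n) \<longlonglongrightarrow> 0" using tendsto_minus[OF that] by simp
    from translation_L2_tendsto[OF g(2) this] show ?thesis
      unfolding A_def by (intro integral_mult_tendsto_L2) (auto simp: f g gs sq_norm_def)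
  qed
  have eq: "(\<integral>x. f x * (\<integral>y. g y * ?K r (y - x) \<partial>lborel) \<partial>lborel) = (\<integral>z. ?K 1 z * A (sqrt r *\<^sub>R z) \<partial>lborel)"
    if r: "r > 0" for r
  proof -
    let ?h = "\<lambda>x z. f x * (g (x + z) * ?K r z)"
    have I: "integrable (lborel \<Otimes>\<^sub>M lborel) (case_prod (\<lambda>z x. ?h x z))"
    proof (rule lborel_pair.Fubini_integrable)
      have [measurable]: "(\<lambda>z. \<integral>x. norm (f x) * norm (g (x + z)) \<partial>lborel) \<in> borel_measurable borel"
        by measurable
      have le: "(\<integral>x. norm (f x) * norm (g (x + z)) \<partial>lborel) \<le> sqrt (sq_norm f * sq_norm g)" for z
        using integral_mult_L2_le[OF f(2) gs(1), of z] gs(2)[of z] by simp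
      show "integrable lborel (\<lambda>z. \<integral>x. norm (case (z, x) of (z, x) \<Rightarrow> ?h x z) \<partial>lborel)"
      proof (rule Bochner_Integration.integrable_bound)
        show "integrable lborel (\<lambda>z. heat_kernel r z * sqrt (sq_norm f * sq_norm g))"
          by (intro integrable_mult_left integrable_heat_kernel r)
        show "AE z in lborel. norm (\<integral>x. norm (case (z, x) of (z, x) \<Rightarrow> ?h x z) \<partial>lborel) \<le>
             norm (heat_kernel r z * sqrt (sq_norm f * sq_norm g))"
        proof (rule AE_I2)
          fix z
          have "(\<integral>x. norm (case (z, x) of (z, x) \<Rightarrow> ?h x z) \<partial>lborel) = heat_kernel r z * (\<integral>x. norm (f x) * norm (g (x + z)) \<partial>lborel)"
            using heat_kernel_nonneg[OF r, of z] by (simp add: norm_mult mult_ac flip: integral_mult_right_zero)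
          moreover have "0 \<le> (\<integral>x. norm (f x) * norm (g (x + z)) \<partial>lborel)" by simp
          ultimately show "norm (\<integral>x. norm (case (z, x) of (z, x) \<Rightarrow> ?h x z) \<partial>lborel) \<le> norm (heat_kernel r z * sqrt (sq_norm f * sq_norm g))"
            using heat_kernel_nonneg[OF r, of z] le[of z] by (simp add: abs_mult mult_left_mono)
        qed
      qed measurable
      show "AE z in lborel. integrable lborel (\<lambda>x. case (z, x) of (z, x) \<Rightarrow> ?h x z)"
      proof (rule AE_I2)
        fix z
        have "integrable lborel (\<lambda>x. (f x * g (x + z)) * ?K r z)"
          by (intro integrable_mult_left integrable_mult_L2 f gs)
        then show "integrable lborel (\<lambda>x. case (z, x) of (z, x) \<Rightarrow> ?h x z)" by (simp add: mult_ac)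
      qed
    qed measurable
    have "(\<integral>x. f x * (\<integral>y. g y * ?K r (y - x) \<partial>lborel) \<partial>lborel) = (\<integral>x. (\<integral>z. ?h x z \<partial>lborel) \<partial>lborel)"
      using integral_lborel_shift[of "\<lambda>z. g (x + z) * ?K r z" x for x] by simp
    also have "\<dots> = (\<integral>z. (\<integral>x. ?h x z \<partial>lborel) \<partial>lborel)"
      by (rule lborel_pair.Fubini_integral[OF I])
    also have "\<dots> = (\<integral>z. ?K r z * A z \<partial>lborel)"
      unfolding A_def by (simp add: mult_ac flip: integral_mult_right_zero)
    also have "\<dots> = r *\<^sub>R (\<integral>z. ?K r (sqrt r *\<^sub>R z) * A (sqrt r *\<^sub>R z) \<partial>lborel)"
      using r by (subst integral_lborel_scale[of _ "sqrt r"]) auto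
    also have "\<dots> = (\<integral>z. ?K 1 z * A (sqrt r *\<^sub>R z) \<partial>lborel)"
      unfolding heat_kernel_scale[OF r, symmetric]
      by (subst integral_scaleR_right[symmetric]) (simp_all add: scaleR_conv_of_real mult_ac)
    finally show ?thesis .
  qed
  have "(\<lambda>n. \<integral>z. ?K 1 z * A (sqrt (\<epsilon> n) *\<^sub>R z) \<partial>lborel) \<longlonglongrightarrow> (\<integral>z. ?K 1 z * A 0 \<partial>lborel)"
  proof (rule integral_dominated_convergence[where w="\<lambda>z. heat_kernel 1 z * sqrt (sq_norm f * sq_norm g)"])
    show "integrable lborel (\<lambda>z. heat_kernel 1 z * sqrt (sq_norm f * sq_norm g))"
      by (intro integrable_mult_left integrable_heat_kernel) simp
    show "AE z in lborel. (\<lambda>n. ?K 1 z * A (sqrt (\<epsilon> n) *\<^sub>R z)) \<longlonglongrightarrow> ?K 1 z * A 0"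
    proof (rule AE_I2, intro tendsto_intros A_lim)
      fix z :: "real^2"
      have "(\<lambda>n. sqrt (\<epsilon> n) *\<^sub>R z) \<longlonglongrightarrow> sqrt 0 *\<^sub>R z"
        by (intro tendsto_intros \<epsilon>)
      then show "(\<lambda>n. sqrt (\<epsilon> n) *\<^sub>R z) \<longlonglongrightarrow> 0" by simp
    qed
    show "AE z in lborel. norm (?K 1 z * A (sqrt (\<epsilon> n) *\<^sub>R z)) \<le> heat_kernel 1 z * sqrt (sq_norm f * sq_norm g)" for n
      using heat_kernel_nonneg[of 1] A_le by (auto simp: norm_mult intro!: mult_left_mono)
  qed measurable
  also have "(\<integral>z. ?K 1 z * A 0 \<partial>lborel) = A 0"
    using integral_heat_kernel[of 1] by simp
  finally show ?thesis
    using eq[OF \<epsilon>(1)] by (simp add: A_def)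
qed

text \<open>With the conjugate of \<open>f\<close> as second function, \<open>FT_gaussian_identity\<close> shows that the integrals of
  \<open>|FT f|\<^sup>2\<close> against the Gauss functions converge; Fatou's lemma then removes the Gauss functions. This
  has to precede Parseval's identity, where it provides the dominating function.\<close>

lemma square_integrable_FT:
  fixes f :: "real^2 \<Rightarrow> complex"
  assumes f: "integrable lborel f" "square_integrable f"
  shows "square_integrable (FT f)"
proof -
  have [measurable]: "f \<in> borel_measurable borel" using f by auto
  define \<epsilon> where "\<epsilon> n = inverse (real (Suc n))" for n
  have \<epsilon>: "\<epsilon> n > 0" "\<epsilon> \<longlonglongrightarrow> 0" for n
    unfolding \<epsilon>_def using LIMSEQ_inverse_real_of_nat by auto
  let ?g = "\<lambda>x. cnj (f x)"
  have g: "integrable lborel ?g" "square_integrable ?g"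
    using f by (auto intro: square_integrable_cnj)
  let ?q = "\<lambda>n \<xi>. (norm (FT f \<xi>))\<^sup>2 * exp (- \<epsilon> n * (norm \<xi>)\<^sup>2)"
  have q: "complex_of_real (?q n \<xi>) = FT f \<xi> * FT ?g (- \<xi>) * exp (- \<epsilon> n * (norm \<xi>)\<^sup>2)" for n \<xi>
    unfolding of_real_mult complex_norm_square FT_cnj by simp
  have iq: "integrable lborel (?q n)" for n
  proof (rule Bochner_Integration.integrable_bound)
    show "integrable lborel (\<lambda>\<xi>::real^2. (\<integral>x. norm (f x) \<partial>lborel)\<^sup>2 * exp (- \<epsilon> n * (norm \<xi>)\<^sup>2))"
      by (intro integrable_mult_right gaussian_fourier(2) \<epsilon>)
  qed (auto simp: norm_FT_le[OF f(1)] intro!: mult_right_mono power_mono)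
  have e: "complex_of_real (\<integral>\<xi>. ?q n \<xi> \<partial>lborel) =
     4 * pi\<^sup>2 * (\<integral>x. f x * (\<integral>y. ?g y * heat_kernel (\<epsilon> n) (y - x) \<partial>lborel) \<partial>lborel)" for n
    unfolding FT_gaussian_identity[OF f(1) g(1) \<epsilon>(1)[of n], symmetric] q[symmetric]
    by (simp only: integral_complex_of_real)
  have "(\<lambda>n. complex_of_real (\<integral>\<xi>. ?q n \<xi> \<partial>lborel)) \<longlonglongrightarrow> 4 * pi\<^sup>2 * (\<integral>x. f x * ?g x \<partial>lborel)"
    unfolding e by (intro tendsto_intros heat_kernel_approx_identity f g \<epsilon>)
  from tendsto_Re[OF this] obtain L where "(\<lambda>n. (\<integral>\<xi>. ?q n \<xi> \<partial>lborel)) \<longlonglongrightarrow> L"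
    unfolding Re_complex_of_real by blast
  then have lim: "(\<lambda>n. ennreal (\<integral>\<xi>. ?q n \<xi> \<partial>lborel)) \<longlonglongrightarrow> ennreal L"
    by (rule tendsto_ennrealI)
  have "(\<integral>\<^sup>+\<xi>. ennreal ((norm (FT f \<xi>))\<^sup>2) \<partial>lborel) = (\<integral>\<^sup>+\<xi>. liminf (\<lambda>n. ennreal (?q n \<xi>)) \<partial>lborel)"
  proof (rule nn_integral_cong)
    fix \<xi> :: "real^2"
    have "(\<lambda>n. ?q n \<xi>) \<longlonglongrightarrow> (norm (FT f \<xi>))\<^sup>2 * exp (- 0 * (norm \<xi>)\<^sup>2)"
      by (intro tendsto_intros \<epsilon>)
    then have "(\<lambda>n. ennreal (?q n \<xi>)) \<longlonglongrightarrow> ennreal ((norm (FT f \<xi>))\<^sup>2)"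
      by (intro tendsto_ennrealI) simp
    from lim_imp_Liminf[OF _ this] show "ennreal ((norm (FT f \<xi>))\<^sup>2) = liminf (\<lambda>n. ennreal (?q n \<xi>))" by simp
  qed
  also have "\<dots> \<le> liminf (\<lambda>n. \<integral>\<^sup>+\<xi>. ennreal (?q n \<xi>) \<partial>lborel)"
    by (rule nn_integral_liminf) measurable
  also have "\<dots> = liminf (\<lambda>n. ennreal (\<integral>\<xi>. ?q n \<xi> \<partial>lborel))"
    by (subst nn_integral_eq_integral[OF iq]) auto
  also have "\<dots> = ennreal L" using lim_imp_Liminf[OF _ lim] by simp
  finally show ?thesis
    unfolding square_integrable_iff_nn by (auto intro: le_less_trans)
qed

lemma Parseval_L1_L2:
  fixes f g :: "real^2 \<Rightarrow> complex"
  assumes f: "integrable lborel f" "square_integrable f" and g: "integrable lborel g" "square_integrable g"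
  shows "(\<integral>\<xi>. FT f \<xi> * FT g (- \<xi>) \<partial>lborel) = 4 * pi\<^sup>2 * (\<integral>x. f x * g x \<partial>lborel)"
proof (rule LIMSEQ_unique)
  have [measurable]: "f \<in> borel_measurable borel" "g \<in> borel_measurable borel" using f g by auto
  define \<epsilon> where "\<epsilon> n = inverse (real (Suc n))" for n
  have \<epsilon>: "\<epsilon> n > 0" "\<epsilon> \<longlonglongrightarrow> 0" for n
    unfolding \<epsilon>_def using LIMSEQ_inverse_real_of_nat by auto
  have gr: "square_integrable (\<lambda>\<xi>. FT g (- \<xi>))"
    using square_integrable_reflect[OF square_integrable_FT[OF g], of 0] by simp
  let ?e = "\<lambda>n \<xi>::real^2. complex_of_real (exp (- \<epsilon> n * (norm \<xi>)\<^sup>2))"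
  show "(\<lambda>n. \<integral>\<xi>. FT f \<xi> * FT g (- \<xi>) * ?e n \<xi> \<partial>lborel) \<longlonglongrightarrow> (\<integral>\<xi>. FT f \<xi> * FT g (- \<xi>) \<partial>lborel)"
  proof (rule integral_dominated_convergence)
    show "integrable lborel (\<lambda>\<xi>. norm (FT f \<xi> * FT g (- \<xi>)))"
      by (intro integrable_norm integrable_mult_L2 square_integrable_FT f gr)
    show "AE \<xi> in lborel. (\<lambda>n. FT f \<xi> * FT g (- \<xi>) * ?e n \<xi>) \<longlonglongrightarrow> FT f \<xi> * FT g (- \<xi>)"
    proof (rule AE_I2)
      fix \<xi> :: "real^2"
      have "(\<lambda>n. FT f \<xi> * FT g (- \<xi>) * ?e n \<xi>) \<longlonglongrightarrow> FT f \<xi> * FT g (- \<xi>) * complex_of_real (exp (- 0 * (norm \<xi>)\<^sup>2))"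
        by (intro tendsto_intros \<epsilon>)
      then show "(\<lambda>n. FT f \<xi> * FT g (- \<xi>) * ?e n \<xi>) \<longlonglongrightarrow> FT f \<xi> * FT g (- \<xi>)" by simp
    qed
    show "AE \<xi> in lborel. norm (FT f \<xi> * FT g (- \<xi>) * ?e n \<xi>) \<le> norm (FT f \<xi> * FT g (- \<xi>))" for n
      using \<epsilon>(1)[of n] by (auto simp: norm_mult intro!: mult_left_le mult_nonneg_nonneg)
  qed measurable
  show "(\<lambda>n. \<integral>\<xi>. FT f \<xi> * FT g (- \<xi>) * ?e n \<xi> \<partial>lborel) \<longlonglongrightarrow> 4 * pi\<^sup>2 * (\<integral>x. f x * g x \<partial>lborel)"
    unfolding FT_gaussian_identity[OF f(1) g(1) \<epsilon>(1)]
    by (intro tendsto_intros heat_kernel_approx_identity f g \<epsilon>)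
qed

section \<open>The Fourier transform in \<open>L\<^sup>2\<close>\<close>

text \<open>The Plancherel transform for Borel functions and \<open>lborel\<close>. Tonelli's theorem will be applied to functions of
  \<open>(\<xi>, \<eta>)\<close> that involve \<open>f (\<xi> - \<eta>)\<close>; on a product of measure spaces their measurability is clear for Borel
  \<open>f\<close>, but not for a Lebesgue measurable one.\<close>

definition L2_fourier :: "(real^2 \<Rightarrow> complex) \<Rightarrow> (real^2 \<Rightarrow> complex) \<Rightarrow> bool" where
  "L2_fourier f h \<longleftrightarrow> square_integrable f \<and> square_integrable h \<and>
     (\<lambda>n. sq_norm (\<lambda>\<xi>. FT (truncate_ball n f) \<xi> - h \<xi>)) \<longlonglongrightarrow> 0"

lemma L2_fourierD:
  assumes "L2_fourier f h"
  shows "square_integrable f" "square_integrable h"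
  using assms by (auto simp: L2_fourier_def)

lemma square_integrable_FT_truncate:
  "square_integrable f \<Longrightarrow> square_integrable (FT (truncate_ball n f))" for f :: "real^2 \<Rightarrow> complex"
  by (intro square_integrable_FT integrable_truncate_ball square_integrable_truncate_ball)

lemma Parseval_L2:
  fixes f g fh gh :: "real^2 \<Rightarrow> complex"
  assumes f: "L2_fourier f fh" and g: "L2_fourier g gh"
  shows "(\<integral>\<xi>. fh \<xi> * gh (- \<xi>) \<partial>lborel) = 4 * pi\<^sup>2 * (\<integral>x. f x * g x \<partial>lborel)"
proof (rule LIMSEQ_unique)
  note sf = L2_fourierD[OF f] and sg = L2_fourierD[OF g]
  have r: "square_integrable (\<lambda>\<xi>. h (- \<xi>))" "sq_norm (\<lambda>\<xi>. h (- \<xi>)) = sq_norm h" if "square_integrable h" for h :: "real^2 \<Rightarrow> complex"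
    using square_integrable_reflect[OF that, of 0] sq_norm_reflect[OF that, of 0] by auto
  show "(\<lambda>n. \<integral>\<xi>. FT (truncate_ball n f) \<xi> * FT (truncate_ball n g) (- \<xi>) \<partial>lborel) \<longlonglongrightarrow> (\<integral>\<xi>. fh \<xi> * gh (- \<xi>) \<partial>lborel)"
  proof (rule integral_mult_tendsto_L2)
    show "(\<lambda>n. sq_norm (\<lambda>\<xi>. FT (truncate_ball n g) (- \<xi>) - gh (- \<xi>))) \<longlonglongrightarrow> 0"
      using g r(2)[OF square_integrable_diff[OF square_integrable_FT_truncate[OF sg(1)] sg(2)]]
      by (simp add: L2_fourier_def)
    show "(\<lambda>n. sq_norm (\<lambda>\<xi>. FT (truncate_ball n f) \<xi> - fh \<xi>)) \<longlonglongrightarrow> 0"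
      using f by (simp add: L2_fourier_def)
  qed (intro r square_integrable_FT_truncate sf sg)+
  show "(\<lambda>n. \<integral>\<xi>. FT (truncate_ball n f) \<xi> * FT (truncate_ball n g) (- \<xi>) \<partial>lborel) \<longlonglongrightarrow> 4 * pi\<^sup>2 * (\<integral>x. f x * g x \<partial>lborel)"
    unfolding Parseval_L1_L2[OF integrable_truncate_ball[OF sf(1)] square_integrable_truncate_ball[OF sf(1)]
       integrable_truncate_ball[OF sg(1)] square_integrable_truncate_ball[OF sg(1)]]
    by (intro tendsto_intros integral_mult_tendsto_L2 square_integrable_truncate_ball truncate_ball_L2_tendsto sf sg)
qed

lemma L2_fourier_diff:
  assumes f: "L2_fourier f fh" and g: "L2_fourier g gh"
  shows "L2_fourier (\<lambda>x. f x - g x) (\<lambda>\<xi>. fh \<xi> - gh \<xi>)"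
  unfolding L2_fourier_def
proof (intro conjI square_integrable_diff)
  note sf = L2_fourierD[OF f] and sg = L2_fourierD[OF g]
  show "square_integrable f" "square_integrable g" "square_integrable fh" "square_integrable gh"
    using sf sg by auto
  let ?F = "\<lambda>n \<xi>. FT (truncate_ball n f) \<xi> - fh \<xi>" and ?G = "\<lambda>n \<xi>. FT (truncate_ball n g) \<xi> - gh \<xi>"
  have eq: "FT (truncate_ball n (\<lambda>x. f x - g x)) \<xi> = FT (truncate_ball n f) \<xi> - FT (truncate_ball n g) \<xi>" for n \<xi>
  proof -
    have "truncate_ball n (\<lambda>x. f x - g x) = (\<lambda>x. truncate_ball n f x - truncate_ball n g x)"
      by (auto simp: truncate_ball_def scaleR_diff_right)
    then show ?thesis using FT_diff[OF integrable_truncate_ball[OF sf(1)] integrable_truncate_ball[OF sg(1)]] by simp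
  qed
  have le: "sq_norm (\<lambda>\<xi>. FT (truncate_ball n (\<lambda>x. f x - g x)) \<xi> - (fh \<xi> - gh \<xi>)) \<le> 2 * sq_norm (?F n) + 2 * sq_norm (?G n)" for n
    unfolding eq
    using sq_norm_diff_le[OF square_integrable_diff[OF square_integrable_FT_truncate[OF sf(1)] sf(2)]
        square_integrable_diff[OF square_integrable_FT_truncate[OF sg(1)] sg(2)], of n n]
    by (simp add: algebra_simps)
  have "(\<lambda>n. 2 * sq_norm (?F n) + 2 * sq_norm (?G n)) \<longlonglongrightarrow> 2 * 0 + 2 * 0"
    using f g unfolding L2_fourier_def by (intro tendsto_intros) auto
  then show "(\<lambda>n. sq_norm (\<lambda>\<xi>. FT (truncate_ball n (\<lambda>x. f x - g x)) \<xi> - (fh \<xi> - gh \<xi>))) \<longlonglongrightarrow> 0"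
    by - (rule Lim_null_comparison[OF always_eventually], use le in simp_all)
qed

lemma L2_fourier_cnj:
  assumes "L2_fourier f fh"
  shows "L2_fourier (\<lambda>x. cnj (f x)) (\<lambda>\<xi>. cnj (fh (- \<xi>)))"
proof -
  note sf = L2_fourierD[OF assms]
  have eq: "truncate_ball n (\<lambda>x. cnj (f x)) = (\<lambda>x. cnj (truncate_ball n f x))" for n
    by (auto simp: truncate_ball_def)
  have "sq_norm (\<lambda>\<xi>. FT (truncate_ball n (\<lambda>x. cnj (f x))) \<xi> - cnj (fh (- \<xi>))) = sq_norm (\<lambda>\<xi>. FT (truncate_ball n f) \<xi> - fh \<xi>)" for n
  proof -
    have "sq_norm (\<lambda>\<xi>. FT (truncate_ball n (\<lambda>x. cnj (f x))) \<xi> - cnj (fh (- \<xi>))) = sq_norm (\<lambda>\<xi>. FT (truncate_ball n f) (0 - \<xi>) - fh (0 - \<xi>))"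
      unfolding sq_norm_def eq FT_cnj by (simp flip: complex_cnj_diff)
    also have "\<dots> = sq_norm (\<lambda>\<xi>. FT (truncate_ball n f) \<xi> - fh \<xi>)"
      by (rule sq_norm_reflect[OF square_integrable_diff[OF square_integrable_FT_truncate[OF sf(1)] sf(2)]])
    finally show ?thesis .
  qed
  then show ?thesis
    using assms square_integrable_cnj[OF sf(1)] square_integrable_cnj[OF square_integrable_reflect[OF sf(2), of 0]]
    by (simp add: L2_fourier_def)
qed

lemma Plancherel_L2:
  assumes "L2_fourier f fh"
  shows "sq_norm fh = 4 * pi\<^sup>2 * sq_norm f"
proof -
  have c: "complex_of_real (sq_norm h) = (\<integral>x. h x * cnj (h x) \<partial>lborel)" for h :: "real^2 \<Rightarrow> complex"
    unfolding sq_norm_def integral_complex_of_real[symmetric] by (simp only: complex_norm_square)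
  have "complex_of_real (sq_norm fh) = complex_of_real (4 * pi\<^sup>2 * sq_norm f)"
    using Parseval_L2[OF assms L2_fourier_cnj[OF assms]] by (simp add: c)
  then show ?thesis by (simp only: of_real_eq_iff)
qed

lemma L2_fourier_modulate:
  assumes "L2_fourier f fh"
  shows "L2_fourier (\<lambda>x. cis (- (x \<bullet> a)) * f x) (\<lambda>\<xi>. fh (\<xi> + a))"
proof -
  note sf = L2_fourierD[OF assms]
  have [measurable]: "f \<in> borel_measurable borel" using sf by measurable
  have eq: "truncate_ball n (\<lambda>x. cis (- (x \<bullet> a)) * f x) = (\<lambda>x. cis (- (x \<bullet> a)) * truncate_ball n f x)" for n
    by (auto simp: truncate_ball_def)
  have "sq_norm (\<lambda>\<xi>. FT (truncate_ball n (\<lambda>x. cis (- (x \<bullet> a)) * f x)) \<xi> - fh (\<xi> + a)) = sq_norm (\<lambda>\<xi>. FT (truncate_ball n f) \<xi> - fh \<xi>)" for n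
    unfolding eq FT_modulate
    using sq_norm_shift[OF square_integrable_diff[OF square_integrable_FT_truncate[OF sf(1)] sf(2)], of n "-a"] by simp
  moreover have "square_integrable (\<lambda>x. cis (- (x \<bullet> a)) * f x)"
    by (rule square_integrable_bound(1)[OF sf(1)]) auto
  ultimately show ?thesis
    using assms square_integrable_shift[OF sf(2), of "-a"] by (simp add: L2_fourier_def)
qed

text \<open>Parseval's identity for \<open>f\<close> and the modulation of \<open>g\<close> by \<open>\<xi>\<close>, whose transform is a translate of \<open>gh\<close>.
  The left side is the transform of an integrable function, hence defined at every \<open>\<xi>\<close>.\<close>

lemma FT_mult_L2:
  fixes f g fh gh :: "real^2 \<Rightarrow> complex"
  assumes f: "L2_fourier f fh" and g: "L2_fourier g gh"
  shows "4 * pi\<^sup>2 * FT (\<lambda>x. f x * g x) \<xi> = (\<integral>\<eta>. fh \<eta> * gh (\<xi> - \<eta>) \<partial>lborel)"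
  using Parseval_L2[OF f L2_fourier_modulate[OF g, of \<xi>]]
  by (simp add: FT_def mult_ac)

text \<open>For an integrable \<open>f\<close> the transforms of its truncations converge at every point, to \<open>FT f\<close>.\<close>

lemma L2_fourier_unique:
  assumes f: "L2_fourier f h" and i: "integrable lborel f"
  shows "AE \<xi> in lborel. h \<xi> = FT f \<xi>"
proof -
  note sf = L2_fourierD[OF f]
  have [measurable]: "f \<in> borel_measurable borel" using i by auto
  have "AE \<xi> in lborel. FT f \<xi> = h \<xi>"
  proof (rule L2_limit_unique[where fn="\<lambda>n. FT (truncate_ball n f)"])
    show "(\<lambda>n. sq_norm (\<lambda>\<xi>. FT (truncate_ball n f) \<xi> - h \<xi>)) \<longlonglongrightarrow> 0"
      using f by (simp add: L2_fourier_def)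
    show "AE \<xi> in lborel. (\<lambda>n. FT (truncate_ball n f) \<xi>) \<longlonglongrightarrow> FT f \<xi>"
    proof (rule AE_I2)
      fix \<xi>
      have [measurable]: "truncate_ball n f \<in> borel_measurable borel" for n
        using integrable_truncate_ball[OF sf(1)] by auto
      show "(\<lambda>n. FT (truncate_ball n f) \<xi>) \<longlonglongrightarrow> FT f \<xi>"
        unfolding FT_def
      proof (rule integral_dominated_convergence[where w="\<lambda>x. norm (f x)"])
        show "AE x in lborel. (\<lambda>n. cis (- (x \<bullet> \<xi>)) * truncate_ball n f x) \<longlonglongrightarrow> cis (- (x \<bullet> \<xi>)) * f x"
          by (intro AE_I2 tendsto_intros tendsto_eventually[OF eventually_truncate_ball])
        show "AE x in lborel. norm (cis (- (x \<bullet> \<xi>)) * truncate_ball n f x) \<le> norm (f x)" for n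
          by (auto simp: truncate_ball_def indicator_def)
      qed (use i in auto)
    qed
  qed (use sf in \<open>auto intro!: square_integrable_diff square_integrable_FT_truncate square_integrable_measurable\<close>)
  then show ?thesis by eventually_elim simp
qed

section \<open>The bilinear estimate\<close>

lemma ennreal_sum_square_le: "(a + b)\<^sup>2 \<le> 2 * a\<^sup>2 + 2 * (b::ennreal)\<^sup>2"
proof (cases a; cases b)
  fix x y assume "a = ennreal x" "b = ennreal y" "0 \<le> x" "0 \<le> y"
  moreover have "(x + y)\<^sup>2 \<le> 2 * x\<^sup>2 + 2 * y\<^sup>2"
    using sum_squares_bound[of x y] by (simp add: power2_sum)
  ultimately show ?thesis
    by (simp add: ennreal_power ennreal_plus[symmetric] ennreal_mult'[symmetric] ennreal_numeral[symmetric]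
        del: ennreal_plus ennreal_numeral)
qed (auto simp: power2_eq_square ennreal_mult_top ennreal_top_mult)

lemma emeasure_cball_real2: "0 \<le> r \<Longrightarrow> emeasure lborel (cball (c::real^2) r) = ennreal (pi * r\<^sup>2)"
  by (simp add: emeasure_cball unit_ball_vol_2)

text \<open>The Cauchy-Schwarz inequality in both variables, with \<open>k \<xi> * h \<eta>\<close> as one factor. The square of the
  other factor integrates to \<open>pi\<close> times that of \<open>g\<close>, because the disc of the \<open>\<eta>\<close> with \<open>|\<eta>| \<le> |\<zeta>|\<close> has area
  \<open>pi * |\<zeta>|\<^sup>2\<close>. Here \<open>1 / 0 = 0\<close> makes the weight at \<open>\<zeta> = 0\<close> harmless.\<close>

lemma max_kernel_half:
  fixes h g k :: "real^2 \<Rightarrow> ennreal"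
  assumes [measurable]: "h \<in> borel_measurable borel" "g \<in> borel_measurable borel" "k \<in> borel_measurable borel"
  shows "(\<integral>\<^sup>+\<xi>. k \<xi> * (\<integral>\<^sup>+\<eta>. h \<eta> * (g (\<xi> - \<eta>) * ennreal (if norm \<eta> \<le> norm (\<xi> - \<eta>) then 1 / norm (\<xi> - \<eta>) else 0)) \<partial>lborel) \<partial>lborel)\<^sup>2
    \<le> pi * ((\<integral>\<^sup>+x. (h x)\<^sup>2 \<partial>lborel) * (\<integral>\<^sup>+x. (g x)\<^sup>2 \<partial>lborel) * (\<integral>\<^sup>+x. (k x)\<^sup>2 \<partial>lborel))"
    (is "?T\<^sup>2 \<le> _ * (?H * ?G * ?K)")
proof -
  let ?w = "\<lambda>(\<eta>::real^2) (\<zeta>::real^2). ennreal (if norm \<eta> \<le> norm \<zeta> then 1 / norm \<zeta> else 0)"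
  let ?F = "\<lambda>(\<xi>, \<eta>). k \<xi> * h \<eta>" and ?E = "\<lambda>(\<xi>, \<eta>). g (\<xi> - \<eta>) * ?w \<eta> (\<xi> - \<eta>)"
  have "(\<integral>\<^sup>+p. (?E p)\<^sup>2 \<partial>(lborel \<Otimes>\<^sub>M lborel)) = (\<integral>\<^sup>+\<eta>. (\<integral>\<^sup>+\<xi>. (g (\<xi> - \<eta>))\<^sup>2 * (?w \<eta> (\<xi> - \<eta>))\<^sup>2 \<partial>lborel) \<partial>lborel)"
    by (subst lborel_pair.nn_integral_snd[symmetric]) (auto simp: power_mult_distrib)
  also have "\<dots> = (\<integral>\<^sup>+\<eta>. (\<integral>\<^sup>+\<zeta>. (g \<zeta>)\<^sup>2 * (?w \<eta> \<zeta>)\<^sup>2 \<partial>lborel) \<partial>lborel)"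
    using nn_integral_lborel_shift[of "\<lambda>\<zeta>. (g \<zeta>)\<^sup>2 * (?w \<eta> \<zeta>)\<^sup>2" \<eta> for \<eta>] by simp
  also have "\<dots> = (\<integral>\<^sup>+\<zeta>. (\<integral>\<^sup>+\<eta>. (g \<zeta>)\<^sup>2 * (?w \<eta> \<zeta>)\<^sup>2 \<partial>lborel) \<partial>lborel)"
    by (rule lborel_pair.Fubini') measurable
  also have "\<dots> = (\<integral>\<^sup>+\<zeta>. (g \<zeta>)\<^sup>2 * (\<integral>\<^sup>+\<eta>. (?w \<eta> \<zeta>)\<^sup>2 \<partial>lborel) \<partial>lborel)"
    by (simp add: nn_integral_cmult)
  also have "\<dots> \<le> (\<integral>\<^sup>+\<zeta>. (g \<zeta>)\<^sup>2 * pi \<partial>lborel)"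
  proof (intro nn_integral_mono mult_left_mono)
    fix \<zeta> :: "real^2"
    have "(\<integral>\<^sup>+\<eta>. (?w \<eta> \<zeta>)\<^sup>2 \<partial>lborel) = (\<integral>\<^sup>+\<eta>. ennreal ((1 / norm \<zeta>)\<^sup>2) * indicator (cball (0::real^2) (norm \<zeta>)) \<eta> \<partial>lborel)"
      by (intro nn_integral_cong) (auto simp: ennreal_power indicator_def)
    also have "\<dots> = ennreal ((1 / norm \<zeta>)\<^sup>2) * ennreal (pi * (norm \<zeta>)\<^sup>2)"
      by (subst nn_integral_cmult_indicator) (simp_all add: emeasure_cball_real2)
    also have "\<dots> \<le> ennreal pi"
      by (cases "\<zeta> = 0") (simp_all add: ennreal_mult'[symmetric] power_divide)
    finally show "(\<integral>\<^sup>+\<eta>. (?w \<eta> \<zeta>)\<^sup>2 \<partial>lborel) \<le> ennreal pi" .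
  qed simp
  also have "\<dots> = ?G * pi" by (simp add: nn_integral_multc)
  finally have E: "(\<integral>\<^sup>+p. (?E p)\<^sup>2 \<partial>(lborel \<Otimes>\<^sub>M lborel)) \<le> ?G * pi" .
  have "?T = (\<integral>\<^sup>+\<xi>. (\<integral>\<^sup>+\<eta>. ?F (\<xi>, \<eta>) * ?E (\<xi>, \<eta>) \<partial>lborel) \<partial>lborel)"
    by (subst nn_integral_cmult[symmetric]) (auto simp: mult_ac)
  also have "\<dots> = (\<integral>\<^sup>+p. ?F p * ?E p \<partial>(lborel \<Otimes>\<^sub>M lborel))"
    by (rule lborel.nn_integral_fst) measurable
  also have "\<dots>\<^sup>2 \<le> (\<integral>\<^sup>+p. (?F p)\<^sup>2 \<partial>(lborel \<Otimes>\<^sub>M lborel)) * (\<integral>\<^sup>+p. (?E p)\<^sup>2 \<partial>(lborel \<Otimes>\<^sub>M lborel))"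
    by (rule Cauchy_Schwarz_nn_integral) measurable
  also have "(\<integral>\<^sup>+p. (?F p)\<^sup>2 \<partial>(lborel \<Otimes>\<^sub>M lborel)) = (\<integral>\<^sup>+\<xi>. (\<integral>\<^sup>+\<eta>. (k \<xi>)\<^sup>2 * (h \<eta>)\<^sup>2 \<partial>lborel) \<partial>lborel)"
    by (subst lborel.nn_integral_fst[symmetric]) (auto simp: power_mult_distrib)
  also have "\<dots> = ?K * ?H"
    by (simp add: nn_integral_cmult nn_integral_multc)
  also have "?K * ?H * (\<integral>\<^sup>+p. (?E p)\<^sup>2 \<partial>(lborel \<Otimes>\<^sub>M lborel)) \<le> ?K * ?H * (?G * pi)"
    by (intro mult_left_mono E) simp
  finally show ?thesis by (simp add: mult_ac)
qed

text \<open>The convolution of \<open>h\<close> and \<open>g\<close> damped by the larger of the two frequencies.\<close>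

definition max_form :: "(real^2 \<Rightarrow> ennreal) \<Rightarrow> (real^2 \<Rightarrow> ennreal) \<Rightarrow> real^2 \<Rightarrow> ennreal" where
  "max_form h g \<xi> = (\<integral>\<^sup>+\<eta>. h \<eta> * (g (\<xi> - \<eta>) * ennreal (1 / max (norm \<eta>) (norm (\<xi> - \<eta>)))) \<partial>lborel)"

lemma max_form_measurable [measurable]:
  assumes [measurable]: "h \<in> borel_measurable borel" "g \<in> borel_measurable borel"
  shows "max_form h g \<in> borel_measurable borel"
  unfolding max_form_def by measurable

text \<open>Split the domain according to which of \<open>|\<eta>|\<close> and \<open>|\<xi> - \<eta>|\<close> is larger; the substitution \<open>\<eta> \<mapsto> \<xi> - \<eta>\<close>
  exchanges the two halves. By duality this is the boundedness of \<open>max_form\<close> from \<open>L\<^sup>2 \<times> L\<^sup>2\<close> to \<open>L\<^sup>2\<close>.\<close>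

lemma max_form_L2:
  assumes [measurable]: "h \<in> borel_measurable borel" "g \<in> borel_measurable borel" "k \<in> borel_measurable borel"
  shows "(\<integral>\<^sup>+\<xi>. k \<xi> * max_form h g \<xi> \<partial>lborel)\<^sup>2
    \<le> 4 * pi * ((\<integral>\<^sup>+x. (h x)\<^sup>2 \<partial>lborel) * (\<integral>\<^sup>+x. (g x)\<^sup>2 \<partial>lborel) * (\<integral>\<^sup>+x. (k x)\<^sup>2 \<partial>lborel))"
    (is "_ \<le> _ * (?H * ?G * ?K)")
proof -
  let ?w = "\<lambda>(\<eta>::real^2) (\<zeta>::real^2). ennreal (if norm \<eta> \<le> norm \<zeta> then 1 / norm \<zeta> else 0)"
  let ?P = "\<lambda>h g \<xi>. \<integral>\<^sup>+\<eta>. h \<eta> * (g (\<xi> - \<eta>) * ?w \<eta> (\<xi> - \<eta>)) \<partial>lborel"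
  have "max_form h g \<xi> \<le> ?P h g \<xi> + ?P g h \<xi>" for \<xi>
  proof -
    have "max_form h g \<xi> \<le> (\<integral>\<^sup>+\<eta>. h \<eta> * (g (\<xi> - \<eta>) * ?w \<eta> (\<xi> - \<eta>)) + h \<eta> * (g (\<xi> - \<eta>) * ?w (\<xi> - \<eta>) \<eta>) \<partial>lborel)"
      unfolding max_form_def
      by (intro nn_integral_mono) (auto simp: max_def distrib_left[symmetric] intro!: mult_left_mono add_increasing2)
    also have "\<dots> = ?P h g \<xi> + (\<integral>\<^sup>+\<eta>. h \<eta> * (g (\<xi> - \<eta>) * ?w (\<xi> - \<eta>) \<eta>) \<partial>lborel)"
      by (rule nn_integral_add) measurable
    also have "(\<integral>\<^sup>+\<eta>. h \<eta> * (g (\<xi> - \<eta>) * ?w (\<xi> - \<eta>) \<eta>) \<partial>lborel) = ?P g h \<xi>"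
      using nn_integral_lborel_reflect[of "\<lambda>\<eta>. h \<eta> * (g (\<xi> - \<eta>) * ?w (\<xi> - \<eta>) \<eta>)" \<xi>]
      by (simp add: mult_ac)
    finally show ?thesis .
  qed
  then have "(\<integral>\<^sup>+\<xi>. k \<xi> * max_form h g \<xi> \<partial>lborel) \<le> (\<integral>\<^sup>+\<xi>. k \<xi> * ?P h g \<xi> + k \<xi> * ?P g h \<xi> \<partial>lborel)"
    by (intro nn_integral_mono) (simp add: distrib_left[symmetric] mult_left_mono)
  also have "\<dots> = (\<integral>\<^sup>+\<xi>. k \<xi> * ?P h g \<xi> \<partial>lborel) + (\<integral>\<^sup>+\<xi>. k \<xi> * ?P g h \<xi> \<partial>lborel)"
    by (rule nn_integral_add) measurable
  finally have "(\<integral>\<^sup>+\<xi>. k \<xi> * max_form h g \<xi> \<partial>lborel)\<^sup>2 \<le> \<dots>\<^sup>2"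
    by (intro power_mono) auto
  also have "\<dots> \<le> 2 * (\<integral>\<^sup>+\<xi>. k \<xi> * ?P h g \<xi> \<partial>lborel)\<^sup>2 + 2 * (\<integral>\<^sup>+\<xi>. k \<xi> * ?P g h \<xi> \<partial>lborel)\<^sup>2"
    by (rule ennreal_sum_square_le)
  also have "\<dots> \<le> 2 * (pi * (?H * ?G * ?K)) + 2 * (pi * (?G * ?H * ?K))"
    by (intro add_mono mult_left_mono max_kernel_half) auto
  also have "\<dots> = 4 * pi * (?H * ?G * ?K)"
    by (simp add: mult_ac ennreal_mult' distrib_right[symmetric] flip: mult_2)
  finally show ?thesis .
qed

text \<open>Young's inequality, tested against \<open>k\<close>. The integrable factor is written as a square \<open>s\<^sup>2\<close> so that
  the Cauchy-Schwarz inequality can distribute it over both factors without square roots of extended reals.\<close>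

lemma convolution_L2_L1:
  fixes h s k :: "real^2 \<Rightarrow> ennreal"
  assumes [measurable]: "h \<in> borel_measurable borel" "s \<in> borel_measurable borel" "k \<in> borel_measurable borel"
  shows "(\<integral>\<^sup>+\<xi>. k \<xi> * (\<integral>\<^sup>+\<eta>. h \<eta> * (s (\<xi> - \<eta>))\<^sup>2 \<partial>lborel) \<partial>lborel)\<^sup>2
    \<le> (\<integral>\<^sup>+x. (h x)\<^sup>2 \<partial>lborel) * (\<integral>\<^sup>+x. (s x)\<^sup>2 \<partial>lborel)\<^sup>2 * (\<integral>\<^sup>+x. (k x)\<^sup>2 \<partial>lborel)"
    (is "?T\<^sup>2 \<le> ?H * ?S\<^sup>2 * ?K")
proof -
  let ?F = "\<lambda>(\<xi>, \<eta>). k \<xi> * s (\<xi> - \<eta>)" and ?E = "\<lambda>(\<xi>, \<eta>). h \<eta> * s (\<xi> - \<eta>)"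
  have "?T = (\<integral>\<^sup>+\<xi>. (\<integral>\<^sup>+\<eta>. ?F (\<xi>, \<eta>) * ?E (\<xi>, \<eta>) \<partial>lborel) \<partial>lborel)"
    by (subst nn_integral_cmult[symmetric]) (auto simp: mult_ac power2_eq_square)
  also have "\<dots> = (\<integral>\<^sup>+p. ?F p * ?E p \<partial>(lborel \<Otimes>\<^sub>M lborel))"
    by (rule lborel.nn_integral_fst) measurable
  also have "\<dots>\<^sup>2 \<le> (\<integral>\<^sup>+p. (?F p)\<^sup>2 \<partial>(lborel \<Otimes>\<^sub>M lborel)) * (\<integral>\<^sup>+p. (?E p)\<^sup>2 \<partial>(lborel \<Otimes>\<^sub>M lborel))"
    by (rule Cauchy_Schwarz_nn_integral) measurable
  also have "(\<integral>\<^sup>+p. (?F p)\<^sup>2 \<partial>(lborel \<Otimes>\<^sub>M lborel)) = (\<integral>\<^sup>+\<xi>. (k \<xi>)\<^sup>2 * (\<integral>\<^sup>+\<eta>. (s (\<xi> - \<eta>))\<^sup>2 \<partial>lborel) \<partial>lborel)"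
    by (subst lborel.nn_integral_fst[symmetric]) (auto simp: power_mult_distrib nn_integral_cmult)
  also have "\<dots> = ?K * ?S"
    using nn_integral_lborel_reflect[of "\<lambda>x. (s x)\<^sup>2"] by (simp add: nn_integral_multc)
  also have "(\<integral>\<^sup>+p. (?E p)\<^sup>2 \<partial>(lborel \<Otimes>\<^sub>M lborel)) = (\<integral>\<^sup>+\<eta>. (h \<eta>)\<^sup>2 * (\<integral>\<^sup>+\<xi>. (s (\<xi> - \<eta>))\<^sup>2 \<partial>lborel) \<partial>lborel)"
    by (subst lborel_pair.nn_integral_snd[symmetric]) (auto simp: power_mult_distrib nn_integral_cmult)
  also have "\<dots> = ?H * ?S"
    using nn_integral_lborel_shift[of "\<lambda>x. (s x)\<^sup>2"] by (simp add: nn_integral_multc)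
  finally show ?thesis by (simp add: mult_ac power2_eq_square)
qed

lemma ennreal_le_of_square_le:
  assumes "(K::ennreal)\<^sup>2 \<le> Q * K" "K < \<infinity>"
  shows "K \<le> Q"
proof (cases "K = 0")
  case False
  have "K * K \<le> K * Q" using assms by (simp add: power2_eq_square mult.commute)
  then show ?thesis using False assms(2) by (subst (asm) ennreal_mult_le_mult_iff) auto
qed simp

text \<open>Since \<open>\<mu> \<le> 2 * max a b\<close>, the left side is at most \<open>2 * \<mu> / (l + \<mu>\<^sup>2)\<close>, and \<open>2 * \<mu> * sqrt l \<le> l + \<mu>\<^sup>2\<close>.\<close>

lemma low_frequency_factor:
  assumes "l > 0" "\<mu> \<ge> 0" "a \<ge> 0" "b \<ge> 0" "\<mu> \<le> a + b"
  shows "\<mu>\<^sup>2 / (l + \<mu>\<^sup>2) * (1 / max a b) \<le> 1 / sqrt l"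
proof (cases "\<mu> = 0")
  case False
  then have m: "max a b \<ge> \<mu> / 2" "\<mu> > 0" using assms by auto
  have p: "l + \<mu>\<^sup>2 > 0" using assms(1) by (simp add: add_pos_nonneg)
  have "1 / max a b \<le> 2 / \<mu>" using m by (simp add: field_simps) 
  then have "\<mu>\<^sup>2 / (l + \<mu>\<^sup>2) * (1 / max a b) \<le> \<mu>\<^sup>2 / (l + \<mu>\<^sup>2) * (2 / \<mu>)"
    using p by (intro mult_left_mono) auto
  also have "\<dots> = 2 * \<mu> / (l + \<mu>\<^sup>2)" using m by (simp add: power2_eq_square)
  also have "\<dots> \<le> 1 / sqrt l"
  proof -
    have "2 * \<mu> * sqrt l \<le> \<mu>\<^sup>2 + (sqrt l)\<^sup>2" by (rule sum_squares_bound)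
    then have "2 * \<mu> * sqrt l \<le> l + \<mu>\<^sup>2" using assms(1) by simp
    then show ?thesis using p assms(1) by (simp add: field_simps)
  qed
  finally show ?thesis .
qed (use assms in auto)

text \<open>The bound at a fixed time that makes the uniqueness argument a contraction: the first summand is small
  when \<open>R\<close> is large, and then the second one when \<open>l\<close> is large. The part of \<open>g\<close> outside \<open>cball 0 R\<close> is
  treated by \<open>max_form_L2\<close> without the damping; for the part inside, \<open>low_frequency_factor\<close> replaces the
  kernel by \<open>1 / sqrt l\<close>, and the area of the ball turns the \<open>L\<^sup>2\<close> norm of \<open>g\<close> into an \<open>L\<^sup>1\<close> norm. Testing
  against \<open>m\<close> itself, cut off to balls, gives \<open>K\<^sup>2 \<le> Q * K\<close> for the integral \<open>K\<close> of the squares; the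
  finiteness of \<open>K\<close> permits the cancellation.\<close>

lemma damped_max_form_L2:
  fixes h m :: "real^2 \<Rightarrow> ennreal" and g :: "real^2 \<Rightarrow> real" and c R l :: real
  assumes [measurable]: "h \<in> borel_measurable borel" "g \<in> borel_measurable borel" "m \<in> borel_measurable borel"
    and g0: "\<And>x. g x \<ge> 0" and l: "l > 0" and R: "R \<ge> 0" and c: "c \<ge> 0"
    and m: "\<And>\<xi>. m \<xi> \<le> c * (ennreal ((norm \<xi>)\<^sup>2 / (l + (norm \<xi>)\<^sup>2)) * max_form h g \<xi>)"
    and fin: "\<And>n::nat. (\<integral>\<^sup>+\<xi>. (m \<xi> * indicator (cball 0 n) \<xi>)\<^sup>2 \<partial>lborel) < \<infinity>"
  shows "(\<integral>\<^sup>+\<xi>. (m \<xi>)\<^sup>2 \<partial>lborel) \<le> ennreal (2 * pi * c\<^sup>2) *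
     ((4 * (\<integral>\<^sup>+x. (ennreal (g x * indicator (- cball 0 R) x))\<^sup>2 \<partial>lborel) + ennreal (R\<^sup>2 / l) * (\<integral>\<^sup>+x. (ennreal (g x))\<^sup>2 \<partial>lborel))
      * (\<integral>\<^sup>+x. (h x)\<^sup>2 \<partial>lborel))" (is "_ \<le> _ * ((4 * ?G1 + _ * ?G) * ?H)")
proof -
  have cb[measurable]: "cball (0::real^2) r \<in> sets borel" "- cball (0::real^2) r \<in> sets borel" for r by auto
  let ?g1 = "\<lambda>x. ennreal (g x * indicator (- cball 0 R) x)" and ?g2 = "\<lambda>x. ennreal (g x * indicator (cball 0 R) x)"
  let ?s = "\<lambda>x. ennreal (sqrt (g x * indicator (cball 0 R) x))"
  let ?C = "\<lambda>\<xi>. \<integral>\<^sup>+\<eta>. h \<eta> * (?s (\<xi> - \<eta>))\<^sup>2 \<partial>lborel"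
  have s2: "(?s x)\<^sup>2 = ?g2 x" for x
    using g0[of x] by (simp add: ennreal_power indicator_def)
  have split: "m \<xi> \<le> c * (max_form h ?g1 \<xi> + ennreal (1 / sqrt l) * ?C \<xi>)" for \<xi>
  proof -
    let ?q = "(norm \<xi>)\<^sup>2 / (l + (norm \<xi>)\<^sup>2)"
    have q: "0 \<le> ?q" "?q \<le> 1" using l by (auto simp: divide_simps add_pos_nonneg intro: add_nonneg_nonneg)
    have "ennreal ?q * max_form h g \<xi> = (\<integral>\<^sup>+\<eta>. ennreal ?q * (h \<eta> * (ennreal (g (\<xi> - \<eta>)) * ennreal (1 / max (norm \<eta>) (norm (\<xi> - \<eta>))))) \<partial>lborel)"
      unfolding max_form_def by (rule nn_integral_cmult[symmetric]) measurable
    also have "\<dots> \<le> (\<integral>\<^sup>+\<eta>. h \<eta> * (?g1 (\<xi> - \<eta>) * ennreal (1 / max (norm \<eta>) (norm (\<xi> - \<eta>)))) + ennreal (1 / sqrt l) * (h \<eta> * (?s (\<xi> - \<eta>))\<^sup>2) \<partial>lborel)"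
    proof (rule nn_integral_mono)
      fix \<eta>
      let ?M = "1 / max (norm \<eta>) (norm (\<xi> - \<eta>))"
      show "ennreal ?q * (h \<eta> * (ennreal (g (\<xi> - \<eta>)) * ennreal ?M)) \<le>
         h \<eta> * (?g1 (\<xi> - \<eta>) * ennreal ?M) + ennreal (1 / sqrt l) * (h \<eta> * (?s (\<xi> - \<eta>))\<^sup>2)"
      proof (cases "\<xi> - \<eta> \<in> cball 0 R")
        case True
        have "?q * ?M \<le> 1 / sqrt l"
          using norm_triangle_ineq[of \<eta> "\<xi> - \<eta>"] l by (intro low_frequency_factor) auto
        then have "ennreal ?q * ennreal ?M \<le> ennreal (1 / sqrt l)"
          using q by (simp add: ennreal_mult'[symmetric] ennreal_leI)
        then have "h \<eta> * ennreal (g (\<xi> - \<eta>)) * (ennreal ?q * ennreal ?M) \<le> h \<eta> * ennreal (g (\<xi> - \<eta>)) * ennreal (1 / sqrt l)"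
          by (rule mult_left_mono) simp
        then show ?thesis using True unfolding s2 by (simp add: mult_ac)
      next
        case False
        have "ennreal ?q * (h \<eta> * (ennreal (g (\<xi> - \<eta>)) * ennreal ?M)) \<le> 1 * (h \<eta> * (ennreal (g (\<xi> - \<eta>)) * ennreal ?M))"
          using q by (intro mult_right_mono) auto
        then show ?thesis using False unfolding s2 by simp
      qed
    qed
    also have "\<dots> = max_form h ?g1 \<xi> + ennreal (1 / sqrt l) * ?C \<xi>"
      unfolding max_form_def by (subst nn_integral_add) (auto simp: nn_integral_cmult)
    finally show ?thesis using order_trans[OF m mult_left_mono] by auto
  qed
  have G2: "(\<integral>\<^sup>+x. (?s x)\<^sup>2 \<partial>lborel)\<^sup>2 \<le> ennreal (pi * R\<^sup>2) * ?G"
  proof -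
    have "(\<integral>\<^sup>+x. (?s x)\<^sup>2 \<partial>lborel) = (\<integral>\<^sup>+x. indicator (cball 0 R) x * ennreal (g x) \<partial>lborel)"
      unfolding s2 by (intro nn_integral_cong) (auto simp: indicator_def)
    also have "\<dots>\<^sup>2 \<le> (\<integral>\<^sup>+x. (indicator (cball 0 R) (x::real^2))\<^sup>2 \<partial>lborel) * ?G"
      by (rule Cauchy_Schwarz_nn_integral) measurable
    also have "(\<integral>\<^sup>+x. (indicator (cball 0 R) (x::real^2))\<^sup>2 \<partial>lborel) = (\<integral>\<^sup>+x. indicator (cball 0 R) (x::real^2) \<partial>lborel)"
      by (intro nn_integral_cong) (auto simp: indicator_def)
    also have "\<dots> = ennreal (pi * R\<^sup>2)" using R by (simp add: emeasure_cball_real2)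
    finally show ?thesis .
  qed
  let ?Q = "ennreal (2 * pi * c\<^sup>2) * ((4 * ?G1 + ennreal (R\<^sup>2 / l) * ?G) * ?H)"
  have part: "(\<integral>\<^sup>+\<xi>. (m \<xi> * indicator (cball 0 (real n)) \<xi>)\<^sup>2 \<partial>lborel) \<le> ?Q" for n :: nat
  proof (rule ennreal_le_of_square_le[OF _ fin])
    let ?k = "\<lambda>\<xi>. m \<xi> * indicator (cball 0 (real n)) \<xi>"
    let ?K = "\<integral>\<^sup>+\<xi>. (?k \<xi>)\<^sup>2 \<partial>lborel"
    have "?K \<le> (\<integral>\<^sup>+\<xi>. ennreal c * (?k \<xi> * max_form h ?g1 \<xi>) + ennreal c * (ennreal (1 / sqrt l) * (?k \<xi> * ?C \<xi>)) \<partial>lborel)"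
    proof (rule nn_integral_mono)
      fix \<xi>
      have "(?k \<xi>)\<^sup>2 = ?k \<xi> * m \<xi>" by (auto simp: power2_eq_square indicator_def)
      also have "\<dots> \<le> ?k \<xi> * (c * (max_form h ?g1 \<xi> + ennreal (1 / sqrt l) * ?C \<xi>))"
        by (intro mult_left_mono split) simp
      finally show "(?k \<xi>)\<^sup>2 \<le> ennreal c * (?k \<xi> * max_form h ?g1 \<xi>) + ennreal c * (ennreal (1 / sqrt l) * (?k \<xi> * ?C \<xi>))"
        by (simp add: algebra_simps)
    qed
    also have "\<dots> = ennreal c * (\<integral>\<^sup>+\<xi>. ?k \<xi> * max_form h ?g1 \<xi> \<partial>lborel) + ennreal c * (ennreal (1 / sqrt l) * (\<integral>\<^sup>+\<xi>. ?k \<xi> * ?C \<xi> \<partial>lborel))"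
      (is "_ = ennreal c * ?A + ennreal c * (_ * ?B)")
      by (subst nn_integral_add) (simp_all add: nn_integral_cmult)
    finally have "?K\<^sup>2 \<le> (ennreal c * ?A + ennreal c * (ennreal (1 / sqrt l) * ?B))\<^sup>2"
      by (intro power_mono) auto
    also have "\<dots> \<le> 2 * (ennreal c * ?A)\<^sup>2 + 2 * (ennreal c * (ennreal (1 / sqrt l) * ?B))\<^sup>2"
      by (rule ennreal_sum_square_le)
    also have "\<dots> = 2 * (ennreal (c\<^sup>2) * ?A\<^sup>2) + 2 * (ennreal (c\<^sup>2) * (ennreal (1 / l) * ?B\<^sup>2))"
      using c l by (simp add: power_mult_distrib ennreal_power power_divide)
    also have "\<dots> \<le> 2 * (ennreal (c\<^sup>2) * (4 * pi * (?H * ?G1 * ?K))) + 2 * (ennreal (c\<^sup>2) * (ennreal (1 / l) * (?H * (ennreal (pi * R\<^sup>2) * ?G) * ?K)))"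
    proof (intro add_mono mult_left_mono)
      show "?A\<^sup>2 \<le> ennreal (4 * pi) * (?H * ?G1 * ?K)"
        by (rule max_form_L2) measurable
      have "?B\<^sup>2 \<le> ?H * (\<integral>\<^sup>+x. (?s x)\<^sup>2 \<partial>lborel)\<^sup>2 * ?K"
        by (rule convolution_L2_L1) measurable
      also have "\<dots> \<le> ?H * (ennreal (pi * R\<^sup>2) * ?G) * ?K"
        by (intro mult_left_mono mult_right_mono G2) auto
      finally show "?B\<^sup>2 \<le> ?H * (ennreal (pi * R\<^sup>2) * ?G) * ?K" .
    qed auto
    also have "\<dots> = ?Q * ?K"
    proof -
      have 1: "ennreal (4 * pi) = 4 * ennreal pi" "ennreal (2 * pi * c\<^sup>2) = 2 * ennreal pi * ennreal (c\<^sup>2)"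
        "ennreal (pi * R\<^sup>2) = ennreal pi * ennreal (R\<^sup>2)"
        by (simp_all add: ennreal_mult)
      have 2: "ennreal (R\<^sup>2 / l) = ennreal (1 / l) * ennreal (R\<^sup>2)"
        using l by (subst ennreal_mult[symmetric]) auto
      show ?thesis unfolding 1 2 by (simp add: algebra_simps)
    qed
    finally show "?K\<^sup>2 \<le> ?Q * ?K" .
  qed
  have "(\<integral>\<^sup>+\<xi>. (m \<xi>)\<^sup>2 \<partial>lborel) = (\<integral>\<^sup>+\<xi>. (SUP n::nat. (m \<xi> * indicator (cball 0 (real n)) \<xi>)\<^sup>2) \<partial>lborel)"
  proof (rule nn_integral_cong)
    fix \<xi> :: "real^2"
    obtain N :: nat where N: "norm \<xi> \<le> real N" using real_arch_simple by blast
    show "(m \<xi>)\<^sup>2 = (SUP n::nat. (m \<xi> * indicator (cball 0 (real n)) \<xi>)\<^sup>2)"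
    proof (rule antisym)
      show "(m \<xi>)\<^sup>2 \<le> (SUP n::nat. (m \<xi> * indicator (cball 0 (real n)) \<xi>)\<^sup>2)"
        using N by (intro SUP_upper2[of N]) auto
      show "(SUP n::nat. (m \<xi> * indicator (cball 0 (real n)) \<xi>)\<^sup>2) \<le> (m \<xi>)\<^sup>2"
        by (intro SUP_least) (auto simp: indicator_def)
    qed
  qed
  also have "\<dots> = (SUP n::nat. \<integral>\<^sup>+\<xi>. (m \<xi> * indicator (cball 0 (real n)) \<xi>)\<^sup>2 \<partial>lborel)"
    by (rule nn_integral_monotone_convergence_SUP)
      (auto simp: incseq_def le_fun_def indicator_def)
  also have "\<dots> \<le> ?Q"
    by (intro SUP_least part)
  finally show ?thesis .
qed

section \<open>Borel representatives\<close>

lemma borel_representative_real: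
  fixes f :: "real^2 \<Rightarrow> real"
  assumes "f \<in> borel_measurable lebesgue"
  obtains g where "g \<in> borel_measurable borel" "AE x in lborel. f x = g x"
  using completion_ex_borel_measurable_real[OF assms] by auto

lemma borel_representative_complex:
  fixes f :: "real^2 \<Rightarrow> complex"
  assumes f: "f \<in> borel_measurable lebesgue"
  obtains g where "g \<in> borel_measurable borel" "AE x in lborel. f x = g x"
proof -
  have "(\<lambda>x. Re (f x)) \<in> borel_measurable lebesgue" "(\<lambda>x. Im (f x)) \<in> borel_measurable lebesgue"
    using f by measurable
  then have r: "(\<lambda>x. Re (f x)) \<in> borel_measurable lebesgue" and i: "(\<lambda>x. Im (f x)) \<in> borel_measurable lebesgue"
    by auto
  obtain p where p: "p \<in> borel_measurable borel" "AE x in lborel. Re (f x) = p x"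
    using borel_representative_real[OF r] .
  obtain q where q: "q \<in> borel_measurable borel" "AE x in lborel. Im (f x) = q x"
    using borel_representative_real[OF i] .
  have "AE x in lborel. f x = Complex (p x) (q x)"
    using p(2) q(2) by eventually_elim (simp add: complex_eq_iff)
  moreover have "(\<lambda>x. Complex (p x) (q x)) \<in> borel_measurable borel"
    using p(1) q(1) unfolding Complex_eq by measurable
  ultimately show ?thesis using that by blast
qed

lemma measurable_lebesgue_of_borel: "f \<in> borel_measurable borel \<Longrightarrow> f \<in> borel_measurable lebesgue"
  by (rule measurable_completion) simp

lemma AE_lborel_lebesgue: "(AE x in lborel. P x) \<Longrightarrow> AE x in lebesgue. P x"
  by (rule AE_completion)

lemma square_integrable_of_L2:
  fixes f g :: "real^2 \<Rightarrow> 'b::{real_normed_field, euclidean_space}"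
  assumes f: "L2 f" and g: "g \<in> borel_measurable borel" and eq: "AE x in lborel. f x = g x"
  shows "square_integrable g"
proof -
  have "integrable lebesgue (\<lambda>x. (norm (g x))\<^sup>2)"
  proof (subst integrable_cong_AE)
    show "AE x in lebesgue. (norm (g x))\<^sup>2 = (norm (f x))\<^sup>2"
      using AE_lborel_lebesgue[OF eq] by eventually_elim simp
    show "(\<lambda>x. (norm (g x))\<^sup>2) \<in> borel_measurable lebesgue"
      using measurable_lebesgue_of_borel[OF g] by measurable
  qed (use f in \<open>auto simp: L2_def\<close>)
  then show ?thesis
    using g by (simp add: square_integrable_def integrable_completion)
qed

text \<open>Passage from representatives modulo null sets to Borel functions.\<close>

lemma L2_tendsto_sq_norm:
  fixes f :: "'a \<Rightarrow> real^2 \<Rightarrow> 'b::{real_normed_field, euclidean_space}"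
  assumes lim: "L2_tendsto f g F"
    and fe: "\<And>n. AE x in lborel. f n x = f' n x" and ge: "AE x in lborel. g x = g' x"
    and sq: "\<And>n. square_integrable (\<lambda>x. f' n x - g' x)"
  shows "((\<lambda>n. sq_norm (\<lambda>x. f' n x - g' x)) \<longlongrightarrow> 0) F"
proof -
  have "(\<integral>\<^sup>+x. ennreal ((norm (f n x - g x))\<^sup>2) \<partial>lebesgue) = ennreal (sq_norm (\<lambda>x. f' n x - g' x))" for n
    unfolding nn_integral_completion nn_integral_eq_sq_norm[OF sq, symmetric]
    by (rule nn_integral_cong_AE, use fe[of n] ge in eventually_elim) simp
  then have "((\<lambda>n. ennreal (sq_norm (\<lambda>x. f' n x - g' x))) \<longlongrightarrow> ennreal 0) F"
    using lim by (simp add: L2_tendsto_def)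
  then show ?thesis by (rule tendsto_ennrealD) auto
qed

lemma fourier_integral_eq_FT:
  assumes f: "f \<in> borel_measurable lebesgue" and g: "g \<in> borel_measurable borel" and eq: "AE x in lborel. f x = g x"
  shows "fourier_integral (\<lambda>x. indicator (cball 0 (real n)) x *\<^sub>R f x) \<xi> = FT (truncate_ball n g) \<xi>"
proof -
  have [measurable]: "(\<lambda>x. indicator (cball 0 (real n)) x *\<^sub>R f x) \<in> borel_measurable lebesgue"
    using f by (intro borel_measurable_scaleR borel_measurable_indicator) auto
  have gm[measurable]: "truncate_ball n g \<in> borel_measurable borel"
    unfolding truncate_ball_def using g by (intro borel_measurable_scaleR borel_measurable_indicator) auto
  have [measurable]: "truncate_ball n g \<in> borel_measurable lebesgue"
    by (rule measurable_lebesgue_of_borel[OF gm])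
  have [measurable]: "(\<lambda>x. cis (- (x \<bullet> \<xi>))) \<in> borel_measurable lebesgue"
    by (rule measurable_lebesgue_of_borel) measurable
  have "fourier_integral (\<lambda>x. indicator (cball 0 (real n)) x *\<^sub>R f x) \<xi> = (\<integral>x. cis (- (x \<bullet> \<xi>)) * truncate_ball n g x \<partial>lebesgue)"
    unfolding fourier_integral_def
  proof (rule integral_cong_AE)
    show "AE x in lebesgue. cis (- (x \<bullet> \<xi>)) * indicator (cball 0 (real n)) x *\<^sub>R f x = cis (- (x \<bullet> \<xi>)) * truncate_ball n g x"
      using AE_lborel_lebesgue[OF eq] by eventually_elim (simp add: truncate_ball_def)
  qed measurable
  also have "\<dots> = FT (truncate_ball n g) \<xi>"
    unfolding FT_def by (rule integral_completion) measurable
  finally show ?thesis .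
qed

lemma L2_fourier_of_transform:
  assumes tr: "is_fourier_transform_L2 f h"
    and g: "g \<in> borel_measurable borel" "AE x in lborel. f x = g x"
    and k: "k \<in> borel_measurable borel" "AE x in lborel. h x = k x"
  shows "L2_fourier g k"
  unfolding L2_fourier_def
proof (intro conjI)
  have L: "L2 f" "L2 h" using tr by (auto simp: is_fourier_transform_L2_def)
  show sg: "square_integrable g" by (rule square_integrable_of_L2[OF L(1) g])
  show sk: "square_integrable k" by (rule square_integrable_of_L2[OF L(2) k])
  show "(\<lambda>n. sq_norm (\<lambda>\<xi>. FT (truncate_ball n g) \<xi> - k \<xi>)) \<longlonglongrightarrow> 0"
  proof (rule L2_tendsto_sq_norm)
    show "L2_tendsto (\<lambda>n::nat. fourier_integral (\<lambda>x. indicator (cball 0 (real n)) x *\<^sub>R f x)) h sequentially"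
      using tr by (simp add: is_fourier_transform_L2_def)
    show "AE x in lborel. fourier_integral (\<lambda>x. indicator (cball 0 (real n)) x *\<^sub>R f x) x = FT (truncate_ball n g) x" for n
      using fourier_integral_eq_FT[OF _ g] L(1) by (simp add: L2_def)
  qed (use k sg sk in \<open>auto intro!: square_integrable_diff square_integrable_FT_truncate\<close>)
qed

lemma L2_fourier_cong_AE:
  assumes f: "L2_fourier f h" and k: "k \<in> borel_measurable borel" "AE x in lborel. h x = k x"
  shows "L2_fourier f k"
proof -
  note s = L2_fourierD[OF f]
  have hm: "h \<in> borel_measurable borel" using s by measurable
  have "sq_norm (\<lambda>\<xi>. FT (truncate_ball n f) \<xi> - h \<xi>) = sq_norm (\<lambda>\<xi>. FT (truncate_ball n f) \<xi> - k \<xi>)" for n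
  proof -
    have tm: "FT (truncate_ball n f) \<in> borel_measurable borel" using square_integrable_FT_truncate[OF s(1)] by measurable
    show ?thesis
      unfolding sq_norm_def
    proof (rule integral_cong_AE)
      show "AE x in lborel. (norm (FT (truncate_ball n f) x - h x))\<^sup>2 = (norm (FT (truncate_ball n f) x - k x))\<^sup>2"
        using k(2) by eventually_elim simp
    qed (use hm k(1) tm in measurable)
  qed
  moreover have "square_integrable k"
  proof -
    have "AE x in lborel. ennreal ((norm (k x))\<^sup>2) = ennreal ((norm (h x))\<^sup>2)"
      using k(2) by eventually_elim simp
    from nn_integral_cong_AE[OF this] show ?thesis
      using s(2) k(1) by (simp add: square_integrable_iff_nn)
  qed
  ultimately show ?thesis using f by (simp add: L2_fourier_def)
qed

lemma AE_eq_0_of_sq_norm: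
  assumes "square_integrable f" "sq_norm f = 0"
  shows "AE x in lborel. f x = 0"
proof -
  have "AE x in lborel. (norm (f x))\<^sup>2 = 0"
    using assms integral_nonneg_eq_0_iff_AE[OF square_integrableD[OF assms(1)]] by (simp add: sq_norm_def)
  then show ?thesis by eventually_elim simp
qed

lemma L2_fourier_unique_AE:
  assumes "L2_fourier f h" "L2_fourier f k"
  shows "AE \<xi> in lborel. h \<xi> = k \<xi>"
proof -
  note d = L2_fourier_diff[OF assms]
  have "sq_norm (\<lambda>\<xi>. h \<xi> - k \<xi>) = 0"
    using Plancherel_L2[OF d] by (simp add: sq_norm_def)
  from AE_eq_0_of_sq_norm[OF L2_fourierD(2)[OF d] this] show ?thesis
    by eventually_elim simp
qed

section \<open>The velocity and the flux\<close>

text \<open>The symbols of the two components of the map from the active scalar to its velocity.\<close>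

definition sqg_symbol :: "2 \<Rightarrow> real^2 \<Rightarrow> complex" where
  "sqg_symbol j \<xi> = (if j = 1 then - (\<i> * complex_of_real (\<xi> $ 2)) / complex_of_real (norm \<xi>)
     else (\<i> * complex_of_real (\<xi> $ 1)) / complex_of_real (norm \<xi>))"

lemma sqg_symbol_measurable [measurable]: "sqg_symbol j \<in> borel_measurable borel"
  unfolding sqg_symbol_def[abs_def] by (cases "j = 1") simp_all

lemma norm_sqg_symbol_le: "norm (sqg_symbol j \<xi>) \<le> 1"
  using component_le_norm_cart[of \<xi> 1] component_le_norm_cart[of \<xi> 2]
  by (cases "\<xi> = 0") (auto simp: sqg_symbol_def norm_divide norm_mult field_simps)

text \<open>A Borel representative \<open>B\<close> of the active scalar, the components \<open>U\<close> of its velocity, and the transform \<open>b\<close>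
  of \<open>B\<close>, with one and the same \<open>b\<close> for all three relations.\<close>

definition sqg_rep :: "(real^2 \<Rightarrow> real) \<Rightarrow> (2 \<Rightarrow> real^2 \<Rightarrow> real) \<Rightarrow> (real^2 \<Rightarrow> complex) \<Rightarrow> bool" where
  "sqg_rep B U b \<longleftrightarrow> L2_fourier (\<lambda>x. complex_of_real (B x)) b \<and>
     (\<forall>j. L2_fourier (\<lambda>x. complex_of_real (U j x)) (\<lambda>\<xi>. sqg_symbol j \<xi> * b \<xi>))"

lemma sqg_rep_exists:
  assumes \<theta>: "L2 \<theta>" and u: "is_sqg_velocity \<theta> u"
  obtains B U b where "sqg_rep B U b" "AE x in lborel. \<theta> x = B x" "\<And>j. AE x in lborel. u x $ j = U j x"
    "B \<in> borel_measurable borel" "\<And>j. U j \<in> borel_measurable borel"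
    "\<And>j. (\<lambda>x. u x $ j) \<in> borel_measurable lebesgue"
proof -
  obtain B where B: "B \<in> borel_measurable borel" "AE x in lborel. \<theta> x = B x"
    by (rule borel_representative_real[of \<theta>]) (use \<theta> in \<open>auto simp: L2_def\<close>)
  have sym: "(\<lambda>\<xi>. - (\<i> * complex_of_real (\<xi> $ 2)) / complex_of_real (norm \<xi>)) = sqg_symbol 1"
    "(\<lambda>\<xi>. (\<i> * complex_of_real (\<xi> $ 1)) / complex_of_real (norm \<xi>)) = sqg_symbol 2"
    by (auto simp: sqg_symbol_def)
  have mult: "is_fourier_multiplier (sqg_symbol j) \<theta> (\<lambda>x. u x $ j)" for j
    using u exhaust_2[of j] unfolding is_sqg_velocity_def sym by auto
  have ex: "\<exists>b U. L2_fourier (\<lambda>x. complex_of_real (B x)) b \<and> U \<in> borel_measurable borel \<and> (\<lambda>x. u x $ j) \<in> borel_measurable lebesgue \<and>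
     (AE x in lborel. u x $ j = U x) \<and> L2_fourier (\<lambda>x. complex_of_real (U x)) (\<lambda>\<xi>. sqg_symbol j \<xi> * b \<xi>)" for j
  proof -
    obtain h where h: "is_fourier_transform_L2 (\<lambda>x. complex_of_real (\<theta> x)) h"
      "is_fourier_transform_L2 (\<lambda>x. complex_of_real (u x $ j)) (\<lambda>\<xi>. sqg_symbol j \<xi> * h \<xi>)"
      using mult[of j] by (auto simp: is_fourier_multiplier_def)
    have hm: "h \<in> borel_measurable lebesgue" "(\<lambda>x. complex_of_real (u x $ j)) \<in> borel_measurable lebesgue"
      using h by (auto simp: is_fourier_transform_L2_def L2_def)
    have um: "(\<lambda>x. u x $ j) \<in> borel_measurable lebesgue"
      using measurable_compose[OF hm(2) borel_measurable_Re] by simp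
    obtain b where b: "b \<in> borel_measurable borel" "AE x in lborel. h x = b x"
      using borel_representative_complex[OF hm(1)] .
    obtain U where U: "U \<in> borel_measurable borel" "AE x in lborel. u x $ j = U x"
      using borel_representative_real[OF um] .
    have AE: "AE x in lborel. complex_of_real (\<theta> x) = complex_of_real (B x)"
      "AE x in lborel. complex_of_real (u x $ j) = complex_of_real (U x)"
      "AE \<xi> in lborel. sqg_symbol j \<xi> * h \<xi> = sqg_symbol j \<xi> * b \<xi>"
      using B(2) U(2) b(2) by (eventually_elim, simp)+
    have m: "(\<lambda>x. complex_of_real (B x)) \<in> borel_measurable borel" "(\<lambda>x. complex_of_real (U x)) \<in> borel_measurable borel"
      "(\<lambda>\<xi>. sqg_symbol j \<xi> * b \<xi>) \<in> borel_measurable borel"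
      using B(1) U(1) b(1) by measurable
    have "L2_fourier (\<lambda>x. complex_of_real (B x)) b"
      by (rule L2_fourier_of_transform[OF h(1) m(1) AE(1) b])
    moreover have "L2_fourier (\<lambda>x. complex_of_real (U x)) (\<lambda>\<xi>. sqg_symbol j \<xi> * b \<xi>)"
      by (rule L2_fourier_of_transform[OF h(2) m(2) AE(2) m(3) AE(3)])
    ultimately show ?thesis using U um by blast
  qed
  from choice[OF allI[OF ex]] obtain b where b: "\<forall>j. \<exists>U. L2_fourier (\<lambda>x. complex_of_real (B x)) (b j) \<and> U \<in> borel_measurable borel \<and> (\<lambda>x. u x $ j) \<in> borel_measurable lebesgue \<and>
     (AE x in lborel. u x $ j = U x) \<and> L2_fourier (\<lambda>x. complex_of_real (U x)) (\<lambda>\<xi>. sqg_symbol j \<xi> * b j \<xi>)" ..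
  from choice[OF b] obtain U where bU: "\<And>j. L2_fourier (\<lambda>x. complex_of_real (B x)) (b j)" "\<And>j. U j \<in> borel_measurable borel"
     "\<And>j. (\<lambda>x. u x $ j) \<in> borel_measurable lebesgue"
     "\<And>j. AE x in lborel. u x $ j = U j x" "\<And>j. L2_fourier (\<lambda>x. complex_of_real (U j x)) (\<lambda>\<xi>. sqg_symbol j \<xi> * b j \<xi>)"
    by blast
  have b1m: "b 1 \<in> borel_measurable borel" using L2_fourierD(2)[OF bU(1)] by measurable
  \<comment> \<open>Each component of the velocity comes with its own transform of \<open>B\<close>; they agree almost everywhere.\<close>
  have "L2_fourier (\<lambda>x. complex_of_real (U j x)) (\<lambda>\<xi>. sqg_symbol j \<xi> * b 1 \<xi>)" for j
  proof (rule L2_fourier_cong_AE[OF bU(5)[of j]])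
    show "(\<lambda>\<xi>. sqg_symbol j \<xi> * b 1 \<xi>) \<in> borel_measurable borel" using b1m by measurable
    show "AE x in lborel. sqg_symbol j x * b j x = sqg_symbol j x * b 1 x"
      using L2_fourier_unique_AE[OF bU(1)[of j] bU(1)[of 1]] by eventually_elim simp
  qed
  then have "sqg_rep B U (b 1)" using bU(1) by (simp add: sqg_rep_def)
  then show ?thesis using that B bU(2,3,4) by blast
qed

lemma square_integrable_of_real:
  "square_integrable (\<lambda>x. complex_of_real (f x)) \<Longrightarrow> square_integrable f"
  using measurable_compose[OF _ borel_measurable_Re, of "\<lambda>x. complex_of_real (f x)" borel] by (auto simp: square_integrable_def)

lemma sq_norm_of_real [simp]: "sq_norm (\<lambda>x. complex_of_real (f x)) = sq_norm f"
  by (simp add: sq_norm_def)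

lemma sqg_repD:
  assumes "sqg_rep B U b"
  shows "square_integrable B" "square_integrable (U j)" "square_integrable b"
    "integrable lborel (\<lambda>x. B x * U j x)"
  using assms unfolding sqg_rep_def
  by (auto intro!: integrable_mult_L2 intro: square_integrable_of_real dest: L2_fourierD)

text \<open>Plancherel's theorem, as the symbols are bounded by 1.\<close>

lemma sqg_rep_velocity_diff_le:
  assumes "sqg_rep B U b" "sqg_rep B' U' b'"
  shows "sq_norm (\<lambda>x. U j x - U' j x) \<le> sq_norm (\<lambda>x. B x - B' x)"
    and "sq_norm (\<lambda>\<xi>. b \<xi> - b' \<xi>) = 4 * pi\<^sup>2 * sq_norm (\<lambda>x. B x - B' x)"
proof -
  have B: "L2_fourier (\<lambda>x. complex_of_real (B x) - complex_of_real (B' x)) (\<lambda>\<xi>. b \<xi> - b' \<xi>)"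
    using assms by (auto simp: sqg_rep_def intro: L2_fourier_diff)
  have U: "L2_fourier (\<lambda>x. complex_of_real (U j x) - complex_of_real (U' j x)) (\<lambda>\<xi>. sqg_symbol j \<xi> * b \<xi> - sqg_symbol j \<xi> * b' \<xi>)"
    using assms by (auto simp: sqg_rep_def intro: L2_fourier_diff)
  show 1: "sq_norm (\<lambda>\<xi>. b \<xi> - b' \<xi>) = 4 * pi\<^sup>2 * sq_norm (\<lambda>x. B x - B' x)"
    using Plancherel_L2[OF B] by (simp flip: of_real_diff)
  have "4 * pi\<^sup>2 * sq_norm (\<lambda>x. U j x - U' j x) = sq_norm (\<lambda>\<xi>. sqg_symbol j \<xi> * b \<xi> - sqg_symbol j \<xi> * b' \<xi>)"
    using Plancherel_L2[OF U] by (simp flip: of_real_diff)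
  also have "\<dots> \<le> sq_norm (\<lambda>\<xi>. b \<xi> - b' \<xi>)"
  proof (rule square_integrable_bound(2)[OF L2_fourierD(2)[OF B]])
    show "(\<lambda>\<xi>. sqg_symbol j \<xi> * b \<xi> - sqg_symbol j \<xi> * b' \<xi>) \<in> borel_measurable borel"
      using L2_fourierD(2)[OF U] by measurable
    show "norm (sqg_symbol j \<xi> * b \<xi> - sqg_symbol j \<xi> * b' \<xi>) \<le> norm (b \<xi> - b' \<xi>)" for \<xi>
      using mult_right_mono[OF norm_sqg_symbol_le[of j \<xi>], of "norm (b \<xi> - b' \<xi>)"]
      by (simp add: norm_mult right_diff_distrib[symmetric])
  qed
  finally show "sq_norm (\<lambda>x. U j x - U' j x) \<le> sq_norm (\<lambda>x. B x - B' x)" unfolding 1 by simp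
qed

text \<open>The transform of the divergence of \<open>u \<theta>\<close>, up to the factor \<open>\<i>\<close>.\<close>

definition flux_hat :: "(real^2 \<Rightarrow> real) \<Rightarrow> (2 \<Rightarrow> real^2 \<Rightarrow> real) \<Rightarrow> real^2 \<Rightarrow> complex" where
  "flux_hat B U \<xi> = (\<Sum>j\<in>UNIV. complex_of_real (\<xi> $ j) * FT (\<lambda>x. complex_of_real (B x * U j x)) \<xi>)"

definition cross2 :: "real^2 \<Rightarrow> real^2 \<Rightarrow> real" where
  "cross2 \<xi> \<eta> = \<xi> $ 2 * \<eta> $ 1 - \<xi> $ 1 * \<eta> $ 2"

lemma cross2_measurable [measurable]: "cross2 \<xi> \<in> borel_measurable borel"
  unfolding cross2_def by measurable

lemma cross2_diff: "cross2 \<xi> (\<xi> - \<eta>) = - cross2 \<xi> \<eta>"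
  by (simp add: cross2_def algebra_simps)

lemma abs_cross2_le: "\<bar>cross2 \<xi> \<eta>\<bar> \<le> norm \<xi> * norm \<eta>"
proof (rule power2_le_imp_le)
  have "(cross2 \<xi> \<eta>)\<^sup>2 \<le> (norm \<xi>)\<^sup>2 * (norm \<eta>)\<^sup>2"
    using zero_le_power2[of "\<xi> $ 1 * \<eta> $ 1 + \<xi> $ 2 * \<eta> $ 2"]
    unfolding norm_real2 cross2_def by (simp add: power2_eq_square algebra_simps)
  then show "\<bar>cross2 \<xi> \<eta>\<bar>\<^sup>2 \<le> (norm \<xi> * norm \<eta>)\<^sup>2" by (simp add: power_mult_distrib)
qed simp

text \<open>The symmetrized kernel of the nonlinearity.\<close>

definition sqg_kernel :: "real^2 \<Rightarrow> real^2 \<Rightarrow> real" where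
  "sqg_kernel \<xi> \<eta> = cross2 \<xi> \<eta> * (1 / norm \<eta> - 1 / norm (\<xi> - \<eta>))"

lemma sqg_kernel_measurable [measurable]: "sqg_kernel \<xi> \<in> borel_measurable borel"
  unfolding sqg_kernel_def by measurable

lemma sqg_kernel_reflect: "sqg_kernel \<xi> (\<xi> - \<eta>) = sqg_kernel \<xi> \<eta>"
  by (simp add: sqg_kernel_def cross2_diff algebra_simps)

text \<open>By the symmetry of the kernel let \<open>|\<eta>| \<le> |\<xi> - \<eta>|\<close>. The cross product contributes \<open>|\<xi>| |\<eta>|\<close>, and the
  difference of the reciprocals contributes \<open>|\<xi>| / (|\<eta>| |\<xi> - \<eta>|)\<close> by the triangle inequality.\<close>

lemma abs_sqg_kernel_le: "\<bar>sqg_kernel \<xi> \<eta>\<bar> \<le> (norm \<xi>)\<^sup>2 * (1 / max (norm \<eta>) (norm (\<xi> - \<eta>)))"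
proof -
  have main: "\<bar>sqg_kernel \<xi> \<eta>\<bar> \<le> (norm \<xi>)\<^sup>2 * (1 / norm (\<xi> - \<eta>))" if le: "norm \<eta> \<le> norm (\<xi> - \<eta>)" for \<eta>
  proof (cases "\<eta> = 0")
    case False
    then have p: "norm \<eta> > 0" "norm (\<xi> - \<eta>) > 0" using le by auto
    have "\<bar>1 / norm \<eta> - 1 / norm (\<xi> - \<eta>)\<bar> = (norm (\<xi> - \<eta>) - norm \<eta>) / (norm \<eta> * norm (\<xi> - \<eta>))"
      using p le by (simp add: field_simps)
    also have "\<dots> \<le> norm \<xi> / (norm \<eta> * norm (\<xi> - \<eta>))"
      using p norm_triangle_ineq4[of \<xi> \<eta>] by (intro divide_right_mono) auto
    finally have "\<bar>cross2 \<xi> \<eta>\<bar> * \<bar>1 / norm \<eta> - 1 / norm (\<xi> - \<eta>)\<bar> \<le> (norm \<xi> * norm \<eta>) * (norm \<xi> / (norm \<eta> * norm (\<xi> - \<eta>)))"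
      by (intro mult_mono abs_cross2_le) auto
    then show ?thesis using p by (simp add: sqg_kernel_def abs_mult power2_eq_square)
  qed (simp add: sqg_kernel_def cross2_def)
  show ?thesis
  proof (cases "norm \<eta> \<le> norm (\<xi> - \<eta>)")
    case True then show ?thesis using main[of \<eta>] by (simp add: max_def)
  next
    case False then show ?thesis using main[of "\<xi> - \<eta>"] by (simp add: max_def sqg_kernel_reflect)
  qed
qed

text \<open>The convolution theorem gives the kernel \<open>cross2 \<xi> \<eta> / |\<eta>|\<close>; adding its image under \<open>\<eta> \<mapsto> \<xi> - \<eta>\<close>
  produces \<open>sqg_kernel\<close> and doubles the constant.\<close>

lemma flux_hat_symmetrized:
  assumes rep: "sqg_rep B U b"
  shows "integrable lborel (\<lambda>\<eta>. complex_of_real (sqg_kernel \<xi> \<eta>) * (b \<eta> * b (\<xi> - \<eta>)))"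
    and "8 * pi\<^sup>2 * flux_hat B U \<xi> = \<i> * (\<integral>\<eta>. complex_of_real (sqg_kernel \<xi> \<eta>) * (b \<eta> * b (\<xi> - \<eta>)) \<partial>lborel)"
proof -
  have fB: "L2_fourier (\<lambda>x. complex_of_real (B x)) b"
    and fU: "L2_fourier (\<lambda>x. complex_of_real (U j x)) (\<lambda>\<xi>. sqg_symbol j \<xi> * b \<xi>)" for j
    using rep by (auto simp: sqg_rep_def)
  have [measurable]: "b \<in> borel_measurable borel" using L2_fourierD(2)[OF fB] by measurable
  have sqr: "square_integrable (\<lambda>\<eta>. b (\<xi> - \<eta>))"
    by (rule square_integrable_reflect[OF L2_fourierD(2)[OF fB]])
  have I: "integrable lborel (\<lambda>\<eta>. (sqg_symbol j \<eta> * b \<eta>) * b (\<xi> - \<eta>))" for j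
    by (rule integrable_mult_L2[OF L2_fourierD(2)[OF fU] sqr])
  let ?q = "\<lambda>\<eta>. complex_of_real (cross2 \<xi> \<eta> / norm \<eta>) * (b \<eta> * b (\<xi> - \<eta>))"
  have q: "(\<Sum>j\<in>UNIV. complex_of_real (\<xi> $ j) * ((sqg_symbol j \<eta> * b \<eta>) * b (\<xi> - \<eta>))) = \<i> * ?q \<eta>" for \<eta>
    by (simp add: sum_2 sqg_symbol_def cross2_def field_simps diff_divide_distrib)
  have Iq: "integrable lborel (\<lambda>\<eta>. \<i> * ?q \<eta>)"
    unfolding q[symmetric] by (intro Bochner_Integration.integrable_sum integrable_mult_right I)
  have ii: "- \<i> * (\<i> * z) = z" for z by simp
  have Iq': "integrable lborel ?q"
    using integrable_mult_right[of "- \<i>", OF Iq] unfolding ii .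
  have "4 * pi\<^sup>2 * flux_hat B U \<xi> = (\<Sum>j\<in>UNIV. complex_of_real (\<xi> $ j) * (4 * pi\<^sup>2 * FT (\<lambda>x. complex_of_real (U j x) * complex_of_real (B x)) \<xi>))"
    unfolding flux_hat_def sum_distrib_left by (simp add: mult_ac)
  also have "\<dots> = (\<Sum>j\<in>UNIV. complex_of_real (\<xi> $ j) * (\<integral>\<eta>. (sqg_symbol j \<eta> * b \<eta>) * b (\<xi> - \<eta>) \<partial>lborel))"
    unfolding FT_mult_L2[OF fU fB] ..
  also have "\<dots> = (\<integral>\<eta>. (\<Sum>j\<in>UNIV. complex_of_real (\<xi> $ j) * ((sqg_symbol j \<eta> * b \<eta>) * b (\<xi> - \<eta>))) \<partial>lborel)"
    using I by (subst Bochner_Integration.integral_sum) auto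
  also have "\<dots> = \<i> * (\<integral>\<eta>. ?q \<eta> \<partial>lborel)"
    unfolding q by (rule integral_mult_right_zero)
  finally have 1: "4 * pi\<^sup>2 * flux_hat B U \<xi> = \<i> * (\<integral>\<eta>. ?q \<eta> \<partial>lborel)" .
  have [measurable]: "?q \<in> borel_measurable borel" using Iq' by auto
  have r: "(\<integral>\<eta>. ?q (\<xi> - \<eta>) \<partial>lborel) = (\<integral>\<eta>. ?q \<eta> \<partial>lborel)" "integrable lborel (\<lambda>\<eta>. ?q (\<xi> - \<eta>))"
    using integral_lborel_reflect[of ?q \<xi>] integrable_lborel_reflect[OF Iq', of \<xi>] by auto
  have k: "complex_of_real (sqg_kernel \<xi> \<eta>) * (b \<eta> * b (\<xi> - \<eta>)) = ?q \<eta> + ?q (\<xi> - \<eta>)" for \<eta>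
    by (simp add: sqg_kernel_def cross2_diff algebra_simps diff_divide_distrib)
  show "integrable lborel (\<lambda>\<eta>. complex_of_real (sqg_kernel \<xi> \<eta>) * (b \<eta> * b (\<xi> - \<eta>)))"
    unfolding k by (intro Bochner_Integration.integrable_add Iq' r)
  have "(\<integral>\<eta>. complex_of_real (sqg_kernel \<xi> \<eta>) * (b \<eta> * b (\<xi> - \<eta>)) \<partial>lborel) = 2 * (\<integral>\<eta>. ?q \<eta> \<partial>lborel)"
    unfolding k using Iq' r by simp
  then show "8 * pi\<^sup>2 * flux_hat B U \<xi> = \<i> * (\<integral>\<eta>. complex_of_real (sqg_kernel \<xi> \<eta>) * (b \<eta> * b (\<xi> - \<eta>)) \<partial>lborel)"
    using 1 by (simp add: algebra_simps)
qed

text \<open>Writing \<open>w\<close> and \<open>G\<close> for the difference and the sum of \<open>b\<close> and \<open>b'\<close>, the quadratic expression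
  \<open>b \<eta> * b (\<xi> - \<eta>) - b' \<eta> * b' (\<xi> - \<eta>)\<close> is half of \<open>w \<eta> * G (\<xi> - \<eta>) + w (\<xi> - \<eta>) * G \<eta>\<close>, and the two terms
  have equal integrals against the symmetric kernel.\<close>

lemma norm_flux_hat_diff_le:
  assumes rep: "sqg_rep B U b" and rep': "sqg_rep B' U' b'"
  shows "ennreal (norm (flux_hat B U \<xi> - flux_hat B' U' \<xi>)) \<le>
    ennreal (1 / (8 * pi\<^sup>2)) * (ennreal ((norm \<xi>)\<^sup>2) *
      max_form (\<lambda>\<eta>. ennreal (norm (b \<eta> - b' \<eta>))) (\<lambda>\<eta>. ennreal (norm (b \<eta> + b' \<eta>))) \<xi>)"
proof -
  have [measurable]: "b \<in> borel_measurable borel" "b' \<in> borel_measurable borel"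
    using sqg_repD(3)[OF rep] sqg_repD(3)[OF rep'] by measurable
  let ?w = "\<lambda>\<eta>. b \<eta> - b' \<eta>" and ?G = "\<lambda>\<eta>. b \<eta> + b' \<eta>"
  let ?k = "sqg_kernel \<xi>"
  let ?f = "\<lambda>\<eta>. complex_of_real (?k \<eta>) * (b \<eta> * b (\<xi> - \<eta>)) - complex_of_real (?k \<eta>) * (b' \<eta> * b' (\<xi> - \<eta>))"
  note s = flux_hat_symmetrized[OF rep, of \<xi>] and s' = flux_hat_symmetrized[OF rep', of \<xi>]
  have If: "integrable lborel ?f" using s(1) s'(1) by (rule Bochner_Integration.integrable_diff)
  have "8 * pi\<^sup>2 * (flux_hat B U \<xi> - flux_hat B' U' \<xi>) = \<i> * (\<integral>\<eta>. ?f \<eta> \<partial>lborel)"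
    unfolding right_diff_distrib s(2) s'(2) by (subst Bochner_Integration.integral_diff[OF s(1) s'(1)]) (simp add: right_diff_distrib)
  then have "norm (8 * pi\<^sup>2 * (flux_hat B U \<xi> - flux_hat B' U' \<xi>)) = norm (\<integral>\<eta>. ?f \<eta> \<partial>lborel)"
    by (simp add: norm_mult)
  then have n: "8 * pi\<^sup>2 * norm (flux_hat B U \<xi> - flux_hat B' U' \<xi>) = norm (\<integral>\<eta>. ?f \<eta> \<partial>lborel)"
    by (simp add: norm_mult norm_power)
  have "ennreal (norm (\<integral>\<eta>. ?f \<eta> \<partial>lborel)) \<le> (\<integral>\<^sup>+\<eta>. ennreal (norm (?f \<eta>)) \<partial>lborel)"
    by (rule integral_norm_bound_ennreal[OF If])
  also have "\<dots> \<le> (\<integral>\<^sup>+\<eta>. ennreal (\<bar>?k \<eta>\<bar> / 2 * (norm (?w \<eta>) * norm (?G (\<xi> - \<eta>)))) + ennreal (\<bar>?k \<eta>\<bar> / 2 * (norm (?w (\<xi> - \<eta>)) * norm (?G \<eta>))) \<partial>lborel)"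
  proof (rule nn_integral_mono)
    fix \<eta>
    have "?f \<eta> = complex_of_real (?k \<eta> / 2) * (?w \<eta> * ?G (\<xi> - \<eta>)) + complex_of_real (?k \<eta> / 2) * (?w (\<xi> - \<eta>) * ?G \<eta>)"
      by (simp add: field_simps)
    then have "norm (?f \<eta>) \<le> norm (complex_of_real (?k \<eta> / 2) * (?w \<eta> * ?G (\<xi> - \<eta>))) + norm (complex_of_real (?k \<eta> / 2) * (?w (\<xi> - \<eta>) * ?G \<eta>))"
      by (metis norm_triangle_ineq)
    also have "\<dots> = \<bar>?k \<eta>\<bar> / 2 * (norm (?w \<eta>) * norm (?G (\<xi> - \<eta>))) + \<bar>?k \<eta>\<bar> / 2 * (norm (?w (\<xi> - \<eta>)) * norm (?G \<eta>))"
      by (simp add: norm_mult norm_divide)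
    finally show "ennreal (norm (?f \<eta>)) \<le> ennreal (\<bar>?k \<eta>\<bar> / 2 * (norm (?w \<eta>) * norm (?G (\<xi> - \<eta>)))) + ennreal (\<bar>?k \<eta>\<bar> / 2 * (norm (?w (\<xi> - \<eta>)) * norm (?G \<eta>)))"
      by (subst ennreal_plus[symmetric]) (simp_all only: ennreal_leI mult_nonneg_nonneg norm_ge_zero divide_nonneg_nonneg abs_ge_zero zero_le_numeral)
  qed
  also have "\<dots> = (\<integral>\<^sup>+\<eta>. ennreal (\<bar>?k \<eta>\<bar> / 2 * (norm (?w \<eta>) * norm (?G (\<xi> - \<eta>)))) \<partial>lborel) + (\<integral>\<^sup>+\<eta>. ennreal (\<bar>?k \<eta>\<bar> / 2 * (norm (?w (\<xi> - \<eta>)) * norm (?G \<eta>))) \<partial>lborel)"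
    by (rule nn_integral_add) measurable
  also have "(\<integral>\<^sup>+\<eta>. ennreal (\<bar>?k \<eta>\<bar> / 2 * (norm (?w (\<xi> - \<eta>)) * norm (?G \<eta>))) \<partial>lborel) = (\<integral>\<^sup>+\<eta>. ennreal (\<bar>?k \<eta>\<bar> / 2 * (norm (?w \<eta>) * norm (?G (\<xi> - \<eta>)))) \<partial>lborel)"
    using nn_integral_lborel_reflect[of "\<lambda>\<eta>. ennreal (\<bar>?k \<eta>\<bar> / 2 * (norm (?w (\<xi> - \<eta>)) * norm (?G \<eta>)))" \<xi>]
    by (simp add: sqg_kernel_reflect)
  also have "(\<integral>\<^sup>+\<eta>. ennreal (\<bar>?k \<eta>\<bar> / 2 * (norm (?w \<eta>) * norm (?G (\<xi> - \<eta>)))) \<partial>lborel) + (\<integral>\<^sup>+\<eta>. ennreal (\<bar>?k \<eta>\<bar> / 2 * (norm (?w \<eta>) * norm (?G (\<xi> - \<eta>)))) \<partial>lborel)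
      = (\<integral>\<^sup>+\<eta>. ennreal (\<bar>?k \<eta>\<bar> / 2 * (norm (?w \<eta>) * norm (?G (\<xi> - \<eta>)))) + ennreal (\<bar>?k \<eta>\<bar> / 2 * (norm (?w \<eta>) * norm (?G (\<xi> - \<eta>)))) \<partial>lborel)"
    by (rule nn_integral_add[symmetric]) measurable
  also have "\<dots> \<le> (\<integral>\<^sup>+\<eta>. ennreal ((norm \<xi>)\<^sup>2) * (ennreal (norm (?w \<eta>)) * (ennreal (norm (?G (\<xi> - \<eta>))) * ennreal (1 / max (norm \<eta>) (norm (\<xi> - \<eta>))))) \<partial>lborel)"
  proof (rule nn_integral_mono)
    fix \<eta>
    have "ennreal (\<bar>?k \<eta>\<bar> / 2 * (norm (?w \<eta>) * norm (?G (\<xi> - \<eta>)))) + ennreal (\<bar>?k \<eta>\<bar> / 2 * (norm (?w \<eta>) * norm (?G (\<xi> - \<eta>)))) 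
       = ennreal (\<bar>?k \<eta>\<bar> * (norm (?w \<eta>) * norm (?G (\<xi> - \<eta>))))"
      by (subst ennreal_plus[symmetric]) auto
    also have "\<dots> \<le> ennreal (((norm \<xi>)\<^sup>2 * (1 / max (norm \<eta>) (norm (\<xi> - \<eta>)))) * (norm (?w \<eta>) * norm (?G (\<xi> - \<eta>))))"
      by (intro ennreal_leI mult_right_mono abs_sqg_kernel_le) auto
    also have "\<dots> = ennreal ((norm \<xi>)\<^sup>2) * (ennreal (norm (?w \<eta>)) * (ennreal (norm (?G (\<xi> - \<eta>))) * ennreal (1 / max (norm \<eta>) (norm (\<xi> - \<eta>)))))"
    proof -
      define M where "M = 1 / max (norm \<eta>) (norm (\<xi> - \<eta>))"
      have "0 \<le> M" by (simp add: M_def le_max_iff_disj)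
      then show ?thesis unfolding M_def[symmetric] by (simp add: ennreal_mult mult_ac)
    qed
    finally show "ennreal (\<bar>?k \<eta>\<bar> / 2 * (norm (?w \<eta>) * norm (?G (\<xi> - \<eta>)))) + ennreal (\<bar>?k \<eta>\<bar> / 2 * (norm (?w \<eta>) * norm (?G (\<xi> - \<eta>)))) \<le> \<dots>" .
  qed
  also have "\<dots> = ennreal ((norm \<xi>)\<^sup>2) * max_form (\<lambda>\<eta>. ennreal (norm (?w \<eta>))) (\<lambda>\<eta>. ennreal (norm (?G \<eta>))) \<xi>"
    unfolding max_form_def by (rule nn_integral_cmult) measurable
  finally have "ennreal (1 / (8 * pi\<^sup>2)) * ennreal (8 * pi\<^sup>2 * norm (flux_hat B U \<xi> - flux_hat B' U' \<xi>)) \<le> ennreal (1 / (8 * pi\<^sup>2)) * \<dots>"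
    unfolding n by (rule mult_left_mono) simp
  then show ?thesis by (subst (asm) ennreal_mult[symmetric]) auto
qed

section \<open>The divergence of the heat semigroup\<close>

text \<open>A bound for the gradient of the heat kernel that is continuous in time.\<close>

definition heat_grad_bound :: "real \<Rightarrow> real" where
  "heat_grad_bound r = 1 / (4 * pi * r * sqrt r)"

lemma abs_heat_grad_le:
  assumes "r > 0"
  shows "\<bar>heat_grad r j z\<bar> \<le> heat_grad_bound r"
proof -
  define u where "u = norm z / (2 * sqrt r)"
  have "u \<le> exp (u\<^sup>2)"
  proof -
    have "u \<le> 1 + u\<^sup>2"
      using zero_le_power2[of "u - 1 / 2"] unfolding power2_diff by (simp add: power2_eq_square)
    also have "\<dots> \<le> exp (u\<^sup>2)" by (rule exp_ge_add_one_self)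
    finally show ?thesis .
  qed
  then have u: "u * exp (- u\<^sup>2) \<le> 1"
    by (simp add: exp_minus divide_simps)
  have u2: "u\<^sup>2 = (norm z)\<^sup>2 / (4 * r)"
    using assms by (simp add: u_def power_divide power_mult_distrib)
  have "\<bar>heat_grad r j z\<bar> \<le> norm z / (2 * r) * (exp (- u\<^sup>2) / (4 * pi * r))"
    unfolding heat_grad_def heat_kernel_def u2 using assms component_le_norm_cart[of z j]
    by (auto simp: abs_mult intro!: mult_mono divide_right_mono)
  also have "\<dots> = (u * exp (- u\<^sup>2)) * heat_grad_bound r"
    using assms real_sqrt_mult_self[of r] by (simp add: u_def heat_grad_bound_def field_simps)
  also have "\<dots> \<le> 1 * heat_grad_bound r"
    using u assms by (intro mult_right_mono) (auto simp: heat_grad_bound_def)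
  finally show ?thesis by simp
qed

lemma has_derivative_heat_kernel:
  assumes "r > 0"
  shows "(heat_kernel r has_derivative (\<lambda>h. \<Sum>j\<in>UNIV. heat_grad r j z * h $ j)) (at z)"
proof -
  have hk: "heat_kernel r = (\<lambda>z. 1 / (4 * pi * r) * exp (- (z \<bullet> z) / (4 * r)))"
    by (simp add: fun_eq_iff heat_kernel_def power2_norm_eq_inner)
  have "((\<lambda>z::real^2. - (z \<bullet> z) / (4 * r)) has_derivative (\<lambda>h. - (z \<bullet> h) / (2 * r))) (at z)"
    using assms by (auto intro!: derivative_eq_intros simp: inner_commute field_simps)
  from has_derivative_mult_right[OF has_derivative_exp[OF this], of "1 / (4 * pi * r)"]
  have "(heat_kernel r has_derivative (\<lambda>h. 1 / (4 * pi * r) * (exp (- (z \<bullet> z) / (4 * r)) * (- (z \<bullet> h) / (2 * r))))) (at z)"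
    unfolding hk by (simp add: mult.commute)
  moreover have "1 / (4 * pi * r) * (exp (- (z \<bullet> z) / (4 * r)) * (- (z \<bullet> h) / (2 * r))) = (\<Sum>j\<in>UNIV. heat_grad r j z * h $ j)" for h
  proof -
    have "(\<Sum>j\<in>UNIV. heat_grad r j z * h $ j) = heat_kernel r z * (- (z \<bullet> h) / (2 * r))"
      by (simp add: heat_grad_def sum_2 inner_real2 diff_divide_distrib algebra_simps)
    then show ?thesis unfolding hk by simp
  qed
  ultimately show ?thesis by simp
qed

lemma norm_sum_mult_component_le:
  fixes h :: "real^2"
  assumes "\<And>j. \<bar>a j\<bar> \<le> C"
  shows "\<bar>\<Sum>j\<in>UNIV. a j * h $ j\<bar> \<le> 2 * C * norm h"
proof -
  have "\<bar>a j * h $ j\<bar> \<le> C * norm h" for j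
    unfolding abs_mult using assms[of j] component_le_norm_cart[of h j]
    by (intro mult_mono) (auto intro: order_trans[OF abs_ge_zero])
  from this[of 1] this[of 2] show ?thesis
    unfolding sum_2 by linarith
qed

text \<open>The difference quotients are dominated by \<open>4 * C * |H|\<close> because \<open>\<phi>\<close> is Lipschitz, so that dominated
  convergence applies along every sequence; this yields the full derivative and not only the partial
  ones.\<close>

lemma has_derivative_convolution:
  fixes \<phi> :: "real^2 \<Rightarrow> real" and p :: "2 \<Rightarrow> real^2 \<Rightarrow> real"
  assumes der: "\<And>z. (\<phi> has_derivative (\<lambda>h. \<Sum>j\<in>UNIV. p j z * h $ j)) (at z)"
    and bd: "\<And>j z. \<bar>p j z\<bar> \<le> C" and p[measurable]: "\<And>j. p j \<in> borel_measurable borel"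
    and H: "integrable lborel H" and \<phi>i: "\<And>x. integrable lborel (\<lambda>y. \<phi> (x - y) * H y)"
  shows "((\<lambda>x. \<integral>y. \<phi> (x - y) * H y \<partial>lborel) has_derivative
     (\<lambda>h. \<Sum>j\<in>UNIV. (\<integral>y. p j (x - y) * H y \<partial>lborel) * h $ j)) (at x)"
proof -
  have [measurable]: "H \<in> borel_measurable borel" using H by auto
  have [measurable]: "\<phi> \<in> borel_measurable borel"
    using has_derivative_continuous[OF der] by (intro borel_measurable_continuous_onI) (auto simp: continuous_on_eq_continuous_at)
  have C0: "0 \<le> C" using bd[of 1 0] by linarith
  have lip: "\<bar>\<phi> (z + h) - \<phi> z\<bar> \<le> 2 * C * norm h" for z h
  proof -
    have "norm (\<phi> (z + h) - \<phi> z) \<le> 2 * C * norm (z + h - z)"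
    proof (rule differentiable_bound[of UNIV \<phi> "\<lambda>z h. \<Sum>j\<in>UNIV. p j z * h $ j"])
      fix z
      show "onorm (\<lambda>h::real^2. \<Sum>j\<in>UNIV. p j z * h $ j) \<le> 2 * C"
        using norm_sum_mult_component_le[OF bd] by (intro onorm_le) auto
    qed (use der in auto)
    then show ?thesis by simp
  qed
  have ip: "integrable lborel (\<lambda>y. p j (x - y) * H y)" for j
    by (rule Bochner_Integration.integrable_bound[OF integrable_mult_right[OF H, of C]])
      (auto simp: abs_mult intro!: mult_right_mono bd order_trans[OF bd abs_ge_self])
  let ?D = "\<lambda>h. \<Sum>j\<in>UNIV. (\<integral>y. p j (x - y) * H y \<partial>lborel) * h $ j"
  let ?\<Phi> = "\<lambda>x. \<integral>y. \<phi> (x - y) * H y \<partial>lborel"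
  have lin: "bounded_linear ?D"
    by (intro bounded_linear_sum bounded_linear_const_mult bounded_linear_vec_nth)
  show ?thesis
    unfolding has_derivative_at_within
  proof (intro conjI lin, subst tendsto_at_iff_sequentially, intro allI impI)
    fix X :: "nat \<Rightarrow> real^2"
    assume X: "\<forall>n. X n \<in> UNIV - {x}" "X \<longlonglongrightarrow> x"
    let ?h = "\<lambda>n. X n - x"
    let ?q = "\<lambda>n y. (1 / norm (?h n)) * (\<phi> (x - y + ?h n) - \<phi> (x - y) - (\<Sum>j\<in>UNIV. p j (x - y) * ?h n $ j)) * H y"
    have h0: "norm (?h n) > 0" for n using X(1) by auto
    have "(\<lambda>n. \<integral>y. ?q n y \<partial>lborel) \<longlonglongrightarrow> (\<integral>y. 0 \<partial>(lborel :: (real^2) measure))"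
    proof (rule integral_dominated_convergence[where w="\<lambda>y. 4 * C * norm (H y)"])
      show "AE y in lborel. (\<lambda>n. ?q n y) \<longlonglongrightarrow> 0"
      proof (rule AE_I2)
        fix y
        have "((\<lambda>z. ((\<phi> z - \<phi> (x - y)) - (\<Sum>j\<in>UNIV. p j (x - y) * (z - (x - y)) $ j)) /\<^sub>R norm (z - (x - y))) \<longlongrightarrow> 0) (at (x - y))"
          using der[of "x - y"] by (simp add: has_derivative_at_within)
        then have L: "\<forall>Z. (\<forall>i. Z i \<in> UNIV - {x - y}) \<longrightarrow> Z \<longlonglongrightarrow> x - y \<longrightarrow>
            ((\<lambda>z. ((\<phi> z - \<phi> (x - y)) - (\<Sum>j\<in>UNIV. p j (x - y) * (z - (x - y)) $ j)) /\<^sub>R norm (z - (x - y))) \<circ> Z) \<longlonglongrightarrow> 0"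
          unfolding tendsto_at_iff_sequentially .
        have c1: "(\<lambda>n. x - y + ?h n) \<longlonglongrightarrow> x - y"
          using tendsto_add[OF tendsto_const[of "x - y"] LIM_zero[OF X(2)]] by simp
        have c2: "\<forall>n. x - y + ?h n \<in> UNIV - {x - y}" using X(1) by auto
        note L[THEN spec[of _ "\<lambda>n. x - y + ?h n"], THEN mp, OF c2, THEN mp, OF c1]
        then have "(\<lambda>n. (1 / norm (?h n)) * (\<phi> (x - y + ?h n) - \<phi> (x - y) - (\<Sum>j\<in>UNIV. p j (x - y) * ?h n $ j))) \<longlonglongrightarrow> 0"
          by (simp add: o_def divide_inverse)
        from tendsto_mult_left_zero[OF this, of "H y"] show "(\<lambda>n. ?q n y) \<longlonglongrightarrow> 0" .
      qed
      show "AE y in lborel. norm (?q n y) \<le> 4 * C * norm (H y)" for n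
      proof (rule AE_I2)
        fix y
        have "\<bar>\<phi> (x - y + ?h n) - \<phi> (x - y) - (\<Sum>j\<in>UNIV. p j (x - y) * ?h n $ j)\<bar> \<le> 2 * C * norm (?h n) + 2 * C * norm (?h n)"
          using lip[of "x - y" "?h n"] norm_sum_mult_component_le[of "\<lambda>j. p j (x - y)" C "?h n", OF bd] by linarith
        then have "(1 / norm (?h n)) * \<bar>\<phi> (x - y + ?h n) - \<phi> (x - y) - (\<Sum>j\<in>UNIV. p j (x - y) * ?h n $ j)\<bar> \<le> 4 * C"
          using h0[of n] by (simp add: field_simps)
        then show "norm (?q n y) \<le> 4 * C * norm (H y)"
          unfolding real_norm_def abs_mult by (intro mult_right_mono) auto
      qed
    qed (use H in auto)
    moreover have "(\<integral>y. ?q n y \<partial>lborel) = (1 / norm (?h n)) * (?\<Phi> (X n) - ?\<Phi> x - ?D (?h n))" for n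
    proof -
      have "(\<integral>y. ?q n y \<partial>lborel) = (\<integral>y. (1 / norm (?h n)) * (\<phi> (X n - y) * H y - \<phi> (x - y) * H y - (\<Sum>j\<in>UNIV. (p j (x - y) * H y) * ?h n $ j)) \<partial>lborel)"
        by (intro Bochner_Integration.integral_cong) (auto simp: algebra_simps sum_distrib_left sum_distrib_right)
      also have "\<dots> = (1 / norm (?h n)) * (?\<Phi> (X n) - ?\<Phi> x - (\<integral>y. (\<Sum>j\<in>UNIV. (p j (x - y) * H y) * ?h n $ j) \<partial>lborel))"
        using \<phi>i ip by (subst integral_mult_right_zero) simp
      also have "(\<integral>y. (\<Sum>j\<in>UNIV. (p j (x - y) * H y) * ?h n $ j) \<partial>lborel) = ?D (?h n)"
        using ip by (subst Bochner_Integration.integral_sum) auto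
      finally show ?thesis .
    qed
    ultimately show "((\<lambda>z. (?\<Phi> z - ?\<Phi> x - ?D (z - x)) /\<^sub>R norm (z - x)) \<circ> X) \<longlonglongrightarrow> 0"
      by (simp add: o_def divide_inverse)
  qed
qed

text \<open>The divergence of the heat semigroup acting on the vector field with the components \<open>H\<close>.\<close>

definition div_heat :: "real \<Rightarrow> (2 \<Rightarrow> real^2 \<Rightarrow> real) \<Rightarrow> real^2 \<Rightarrow> real" where
  "div_heat r H x = (\<Sum>j\<in>UNIV. \<integral>y. heat_grad r j (x - y) * H j y \<partial>lborel)"

lemma heat_semigroup_component:
  fixes F :: "real^2 \<Rightarrow> real^2"
  assumes r: "r > 0" and Fm: "\<And>j. (\<lambda>x. F x $ j) \<in> borel_measurable lebesgue"
    and eq: "\<And>j. AE x in lborel. F x $ j = H j x" and H: "\<And>j. integrable lborel (H j)"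
  shows "heat_semigroup r F x $ j = (\<integral>y. heat_kernel r (x - y) * H j y \<partial>lborel)"
    and "integrable lborel (\<lambda>y. heat_kernel r (x - y) * H j y)"
proof -
  have [measurable]: "H j \<in> borel_measurable borel" for j using H[of j] by auto
  have kb: "\<bar>heat_kernel r z\<bar> \<le> 1 / (4 * pi * r)" for z
    using r by (simp add: heat_kernel_def divide_right_mono)
  have I: "integrable lborel (\<lambda>y. heat_kernel r (x - y) * H j y)" for j
  proof (rule Bochner_Integration.integrable_bound[OF integrable_mult_right[OF H[of j], of "1 / (4 * pi * r)"]])
    show "AE y in lborel. norm (heat_kernel r (x - y) * H j y) \<le> norm (1 / (4 * pi * r) * H j y)"
      using mult_right_mono[OF kb abs_ge_zero] r by (intro AE_I2) (simp add: abs_mult)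
  qed measurable
  then show "integrable lborel (\<lambda>y. heat_kernel r (x - y) * H j y)" .
  have expand: "v = (\<Sum>j\<in>UNIV. (v $ j) *\<^sub>R axis j 1)" for v :: "real^2"
    by (auto simp: vec_eq_iff sum_2 forall_2 axis_def)
  let ?E = "\<lambda>y. \<Sum>j\<in>UNIV. (heat_kernel r (x - y) * H j y) *\<^sub>R axis j 1 :: real^2"
  have Fm': "F \<in> borel_measurable lebesgue"
    by (subst expand[of "F _", abs_def]) (intro borel_measurable_sum borel_measurable_scaleR Fm borel_measurable_const)
  have Km: "(\<lambda>y. heat_kernel r (x - y)) \<in> borel_measurable lebesgue"
    by (rule measurable_lebesgue_of_borel) measurable
  have Em: "?E \<in> borel_measurable borel" by measurable
  have "heat_semigroup r F x = (\<integral>y. heat_kernel r (x - y) *\<^sub>R F y \<partial>lebesgue)"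
    using r by (simp add: heat_semigroup_def)
  also have "\<dots> = (\<integral>y. ?E y \<partial>lebesgue)"
  proof (rule integral_cong_AE)
    have "AE y in lborel. F y $ 1 = H 1 y \<and> F y $ 2 = H 2 y"
      using eq[of 1] eq[of 2] by eventually_elim simp
    then show "AE y in lebesgue. heat_kernel r (x - y) *\<^sub>R F y = ?E y"
      by (intro AE_lborel_lebesgue, eventually_elim) (subst expand[of "F _"], simp add: sum_2 scaleR_add_right)
  qed (use Km Fm' measurable_lebesgue_of_borel[OF Em] in \<open>auto intro!: borel_measurable_scaleR\<close>)
  also have "\<dots> = (\<integral>y. ?E y \<partial>lborel)"
    using Em by (intro integral_completion) simp
  also have "\<dots> = (\<Sum>j\<in>UNIV. (\<integral>y. heat_kernel r (x - y) * H j y \<partial>lborel) *\<^sub>R axis j 1)"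
    using I by (subst Bochner_Integration.integral_sum) auto
  finally show "heat_semigroup r F x $ j = (\<integral>y. heat_kernel r (x - y) * H j y \<partial>lborel)"
    using exhaust_2[of j] by (auto simp: sum_2 axis_def)
qed

lemma divergence_heat_semigroup:
  fixes F :: "real^2 \<Rightarrow> real^2"
  assumes r: "r > 0" and Fm: "\<And>j. (\<lambda>x. F x $ j) \<in> borel_measurable lebesgue"
    and eq: "\<And>j. AE x in lborel. F x $ j = H j x" and H: "\<And>j. integrable lborel (H j)"
  shows "divergence (heat_semigroup r F) x = div_heat r H x"
  unfolding divergence_def div_heat_def
proof (rule sum.cong[OF refl])
  fix j :: 2
  let ?D = "\<lambda>h. \<Sum>i\<in>UNIV. (\<integral>y. heat_grad r i (x - y) * H j y \<partial>lborel) * h $ i"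
  note comp = heat_semigroup_component[OF assms]
  have "((\<lambda>x. \<integral>y. heat_kernel r (x - y) * H j y \<partial>lborel) has_derivative ?D) (at x)"
    by (rule has_derivative_convolution[OF has_derivative_heat_kernel[OF r] abs_heat_grad_le[OF r] heat_grad_measurable H comp(2)])
  then have "((\<lambda>y. heat_semigroup r F y $ j) has_derivative ?D) (at x)"
    by (simp add: comp(1))
  then have "frechet_derivative (\<lambda>y. heat_semigroup r F y $ j) (at x) (axis j 1) = ?D (axis j 1)"
    by (rule fun_cong[OF frechet_derivative_at, symmetric])
  also have "\<dots> = (\<integral>y. heat_grad r j (x - y) * H j y \<partial>lborel)"
    using exhaust_2[of j] by (auto simp: sum_2 axis_def)
  finally show "frechet_derivative (\<lambda>y. heat_semigroup r F y $ j) (at x) (axis j 1) = (\<integral>y. heat_grad r j (x - y) * H j y \<partial>lborel)" .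
qed

lemma
  fixes \<phi> H :: "real^2 \<Rightarrow> complex"
  assumes \<phi>: "integrable lborel \<phi>" and H: "integrable lborel H"
  shows integrable_convolution: "integrable lborel (\<lambda>x. \<integral>y. \<phi> (x - y) * H y \<partial>lborel)"
    and convolution_L1_le: "(\<integral>x. norm (\<integral>y. \<phi> (x - y) * H y \<partial>lborel) \<partial>lborel) \<le> (\<integral>x. norm (\<phi> x) \<partial>lborel) * (\<integral>x. norm (H x) \<partial>lborel)"
    and FT_convolution: "FT (\<lambda>x. \<integral>y. \<phi> (x - y) * H y \<partial>lborel) \<xi> = FT \<phi> \<xi> * FT H \<xi>"
proof -
  have [measurable]: "\<phi> \<in> borel_measurable borel" "H \<in> borel_measurable borel" using \<phi> H by auto
  have I: "integrable (lborel \<Otimes>\<^sub>M lborel) (\<lambda>(y, x). c x * (\<phi> (x - y) * H y))"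
    if c[measurable]: "c \<in> borel_measurable borel" and c1: "\<And>x. norm (c x) = 1" for c :: "real^2 \<Rightarrow> complex"
  proof (rule lborel_pair.Fubini_integrable)
    have "integrable lborel (\<lambda>x. c x * (\<phi> (x - y) * H y))" for y
      by (rule Bochner_Integration.integrable_bound[OF integrable_mult_left[OF integrable_lborel_shift[OF \<phi>, of y], of "H y"]])
        (auto simp: norm_mult c1)
    then show "AE y in lborel. integrable lborel (\<lambda>x. case (y, x) of (y, x) \<Rightarrow> c x * (\<phi> (x - y) * H y))" by simp
    have "(\<integral>x. norm (case (y, x) of (y, x) \<Rightarrow> c x * (\<phi> (x - y) * H y)) \<partial>lborel) = (\<integral>x. norm (\<phi> x) \<partial>lborel) * norm (H y)" for y
      using integral_lborel_shift[of "\<lambda>x. norm (\<phi> x)" y] by (simp add: norm_mult c1)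
    then show "integrable lborel (\<lambda>y. \<integral>x. norm (case (y, x) of (y, x) \<Rightarrow> c x * (\<phi> (x - y) * H y)) \<partial>lborel)"
      using H by simp
  qed measurable
  note I1 = I[of "\<lambda>x. 1", simplified]
  show "integrable lborel (\<lambda>x. \<integral>y. \<phi> (x - y) * H y \<partial>lborel)"
    using lborel_pair.integrable_snd[OF I1] by simp
  then have i: "integrable lborel (\<lambda>x. norm (\<integral>y. \<phi> (x - y) * H y \<partial>lborel))" by simp
  have In: "integrable (lborel \<Otimes>\<^sub>M lborel) (\<lambda>(y, x). norm (\<phi> (x - y) * H y))"
    using integrable_norm[OF I1] by (simp add: case_prod_unfold)
  have "(\<integral>x. norm (\<integral>y. \<phi> (x - y) * H y \<partial>lborel) \<partial>lborel) \<le> (\<integral>x. (\<integral>y. norm (\<phi> (x - y) * H y) \<partial>lborel) \<partial>lborel)"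
    by (intro integral_mono i lborel_pair.integrable_snd[OF In] integral_norm_bound)
  also have "\<dots> = (\<integral>y. (\<integral>x. norm (\<phi> (x - y) * H y) \<partial>lborel) \<partial>lborel)"
    by (rule lborel_pair.Fubini_integral[OF In])
  also have "\<dots> = (\<integral>x. norm (\<phi> x) \<partial>lborel) * (\<integral>x. norm (H x) \<partial>lborel)"
    using integral_lborel_shift[of "\<lambda>x. norm (\<phi> x)"] by (simp add: norm_mult)
  finally show "(\<integral>x. norm (\<integral>y. \<phi> (x - y) * H y \<partial>lborel) \<partial>lborel) \<le> (\<integral>x. norm (\<phi> x) \<partial>lborel) * (\<integral>x. norm (H x) \<partial>lborel)" .
  have Ic: "integrable (lborel \<Otimes>\<^sub>M lborel) (\<lambda>(y, x). cis (- (x \<bullet> \<xi>)) * (\<phi> (x - y) * H y))"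
    by (rule I) auto
  have "FT (\<lambda>x. \<integral>y. \<phi> (x - y) * H y \<partial>lborel) \<xi> = (\<integral>x. (\<integral>y. cis (- (x \<bullet> \<xi>)) * (\<phi> (x - y) * H y) \<partial>lborel) \<partial>lborel)"
    by (simp add: FT_def)
  also have "\<dots> = (\<integral>y. (\<integral>x. cis (- (x \<bullet> \<xi>)) * (\<phi> (x - y) * H y) \<partial>lborel) \<partial>lborel)"
    by (rule lborel_pair.Fubini_integral[OF Ic])
  also have "\<dots> = (\<integral>y. FT \<phi> \<xi> * (cis (- (y \<bullet> \<xi>)) * H y) \<partial>lborel)"
  proof (rule Bochner_Integration.integral_cong[OF refl])
    fix y :: "real^2"
    have "(\<integral>x. cis (- (x \<bullet> \<xi>)) * (\<phi> (x - y) * H y) \<partial>lborel) = (\<integral>x. (cis (- ((x - y) \<bullet> \<xi>)) * \<phi> (x - y)) * (cis (- (y \<bullet> \<xi>)) * H y) \<partial>lborel)"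
    proof (rule Bochner_Integration.integral_cong[OF refl])
      fix x :: "real^2"
      have "cis (- (x \<bullet> \<xi>)) = cis (- ((x - y) \<bullet> \<xi>)) * cis (- (y \<bullet> \<xi>))"
        by (simp add: cis_mult inner_diff_left)
      then show "cis (- (x \<bullet> \<xi>)) * (\<phi> (x - y) * H y) = (cis (- ((x - y) \<bullet> \<xi>)) * \<phi> (x - y)) * (cis (- (y \<bullet> \<xi>)) * H y)"
        by (simp only: mult_ac)
    qed
    also have "\<dots> = (\<integral>x. cis (- ((x - y) \<bullet> \<xi>)) * \<phi> (x - y) \<partial>lborel) * (cis (- (y \<bullet> \<xi>)) * H y)"
      by (rule integral_mult_left_zero)
    also have "(\<integral>x. cis (- ((x - y) \<bullet> \<xi>)) * \<phi> (x - y) \<partial>lborel) = FT \<phi> \<xi>"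
      unfolding FT_def by (rule integral_lborel_shift[of "\<lambda>x. cis (- (x \<bullet> \<xi>)) * \<phi> x"]) measurable
    finally show "(\<integral>x. cis (- (x \<bullet> \<xi>)) * (\<phi> (x - y) * H y) \<partial>lborel) = FT \<phi> \<xi> * (cis (- (y \<bullet> \<xi>)) * H y)" .
  qed
  also have "\<dots> = FT \<phi> \<xi> * FT H \<xi>"
    unfolding FT_def[of H] by (rule integral_mult_right_zero)
  finally show "FT (\<lambda>x. \<integral>y. \<phi> (x - y) * H y \<partial>lborel) \<xi> = FT \<phi> \<xi> * FT H \<xi>" .
qed

lemma integrable_of_real_iff:
  "integrable M (\<lambda>x. complex_of_real (f x)) \<longleftrightarrow> integrable M f"
  using integrable_Re[of M "\<lambda>x. complex_of_real (f x)"] by auto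

lemma
  assumes r: "r > 0" and H: "\<And>j. integrable lborel (H j)"
  shows integrable_div_heat: "integrable lborel (div_heat r H)"
    and div_heat_L1_le: "(\<integral>x. \<bar>div_heat r H x\<bar> \<partial>lborel) \<le> 1 / sqrt (pi * r) * (\<Sum>j\<in>UNIV. \<integral>x. \<bar>H j x\<bar> \<partial>lborel)"
    and FT_div_heat: "FT (\<lambda>x. complex_of_real (div_heat r H x)) \<xi> =
      \<i> * exp (- r * (norm \<xi>)\<^sup>2) * (\<Sum>j\<in>UNIV. complex_of_real (\<xi> $ j) * FT (\<lambda>x. complex_of_real (H j x)) \<xi>)"
proof -
  let ?c = "\<lambda>j x. \<integral>y. heat_grad r j (x - y) * H j y \<partial>lborel"
  let ?cc = "\<lambda>j x. \<integral>y. complex_of_real (heat_grad r j (x - y)) * complex_of_real (H j y) \<partial>lborel"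
  have cc: "?cc j x = complex_of_real (?c j x)" for j x
    by (simp only: of_real_mult[symmetric] integral_complex_of_real)
  have g: "integrable lborel (\<lambda>x. complex_of_real (heat_grad r j x))" "integrable lborel (\<lambda>x. complex_of_real (H j x))" for j
    using integrable_heat_grad[OF r] H by (auto simp: integrable_of_real_iff)
  have ccj: "integrable lborel (\<lambda>x. complex_of_real (?c j x))" for j
    using integrable_convolution[OF g(1)[of j] g(2)[of j]] by (simp only: cc)
  then have cj: "integrable lborel (?c j)" for j
    unfolding integrable_of_real_iff .
  show "integrable lborel (div_heat r H)"
    unfolding div_heat_def[abs_def] by (intro Bochner_Integration.integrable_sum cj)
  then have "integrable lborel (\<lambda>x. \<bar>div_heat r H x\<bar>)" by simp
  then have "(\<integral>x. \<bar>div_heat r H x\<bar> \<partial>lborel) \<le> (\<integral>x. (\<Sum>j\<in>UNIV. \<bar>?c j x\<bar>) \<partial>lborel)"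
    unfolding div_heat_def using cj by (intro integral_mono) auto
  also have "\<dots> = (\<Sum>j\<in>UNIV. \<integral>x. \<bar>?c j x\<bar> \<partial>lborel)"
    using cj by (intro Bochner_Integration.integral_sum) auto
  also have "\<dots> \<le> (\<Sum>j\<in>UNIV. 1 / sqrt (pi * r) * (\<integral>x. \<bar>H j x\<bar> \<partial>lborel))"
  proof (rule sum_mono)
    fix j
    show "(\<integral>x. \<bar>?c j x\<bar> \<partial>lborel) \<le> 1 / sqrt (pi * r) * (\<integral>x. \<bar>H j x\<bar> \<partial>lborel)"
      using convolution_L1_le[OF g(1)[of j] g(2)[of j]] unfolding cc norm_of_real real_norm_def heat_grad_L1[OF r] .
  qed
  also have "\<dots> = 1 / sqrt (pi * r) * (\<Sum>j\<in>UNIV. \<integral>x. \<bar>H j x\<bar> \<partial>lborel)"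
    by (rule sum_distrib_left[symmetric])
  finally show "(\<integral>x. \<bar>div_heat r H x\<bar> \<partial>lborel) \<le> 1 / sqrt (pi * r) * (\<Sum>j\<in>UNIV. \<integral>x. \<bar>H j x\<bar> \<partial>lborel)" .
  have "FT (\<lambda>x. complex_of_real (div_heat r H x)) \<xi> = (\<integral>x. (\<Sum>j\<in>UNIV. cis (- (x \<bullet> \<xi>)) * complex_of_real (?c j x)) \<partial>lborel)"
    by (simp add: FT_def div_heat_def sum_distrib_left)
  also have "\<dots> = (\<Sum>j\<in>UNIV. FT (\<lambda>x. complex_of_real (?c j x)) \<xi>)"
    unfolding FT_def by (intro Bochner_Integration.integral_sum integrable_cis_mult ccj) measurable
  also have "\<dots> = (\<Sum>j\<in>UNIV. \<i> * (\<xi> $ j) * exp (- r * (norm \<xi>)\<^sup>2) * FT (\<lambda>x. complex_of_real (H j x)) \<xi>)"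
  proof (rule sum.cong[OF refl])
    fix j
    show "FT (\<lambda>x. complex_of_real (?c j x)) \<xi> = \<i> * (\<xi> $ j) * exp (- r * (norm \<xi>)\<^sup>2) * FT (\<lambda>x. complex_of_real (H j x)) \<xi>"
      using FT_convolution[OF g(1)[of j] g(2)[of j], of \<xi>] unfolding cc heat_grad_fourier[OF r] .
  qed
  also have "\<dots> = \<i> * exp (- r * (norm \<xi>)\<^sup>2) * (\<Sum>j\<in>UNIV. complex_of_real (\<xi> $ j) * FT (\<lambda>x. complex_of_real (H j x)) \<xi>)"
    by (simp add: sum_distrib_left mult_ac)
  finally show "FT (\<lambda>x. complex_of_real (div_heat r H x)) \<xi> =
      \<i> * exp (- r * (norm \<xi>)\<^sup>2) * (\<Sum>j\<in>UNIV. complex_of_real (\<xi> $ j) * FT (\<lambda>x. complex_of_real (H j x)) \<xi>)" .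
qed

section \<open>Families depending continuously on time, and Duhamel's formula\<close>

definition L1_continuous_on :: "real set \<Rightarrow> (real \<Rightarrow> real^2 \<Rightarrow> real) \<Rightarrow> bool" where
  "L1_continuous_on S K \<longleftrightarrow> (\<forall>s\<in>S. integrable lborel (K s)) \<and>
     (\<forall>s\<in>S. \<forall>\<sigma>. (\<forall>n. \<sigma> n \<in> S) \<longrightarrow> \<sigma> \<longlonglongrightarrow> s \<longrightarrow> (\<lambda>n. \<integral>x. norm (K (\<sigma> n) x - K s x) \<partial>lborel) \<longlonglongrightarrow> 0)"

lemma L1_continuous_onD:
  assumes "L1_continuous_on S K"
  shows "s \<in> S \<Longrightarrow> integrable lborel (K s)"
    and "\<lbrakk>s \<in> S; \<And>n. \<sigma> n \<in> S; \<sigma> \<longlonglongrightarrow> s\<rbrakk> \<Longrightarrow> (\<lambda>n. \<integral>x. norm (K (\<sigma> n) x - K s x) \<partial>lborel) \<longlonglongrightarrow> 0"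
  using assms by (auto simp: L1_continuous_on_def)

text \<open>One limit theorem serves both Fourier integrals and convolutions with the gradient of the heat kernel:
  the kernels converge boundedly and pointwise, the densities converge in \<open>L\<^sup>1\<close>.\<close>

lemma kernel_integral_tendsto:
  fixes k h :: "nat \<Rightarrow> 'a::euclidean_space \<Rightarrow> 'b::{real_normed_field, banach, second_countable_topology}"
  assumes [measurable]: "\<And>n. k n \<in> borel_measurable borel" "k' \<in> borel_measurable borel"
    and bd: "\<And>n y. norm (k n y) \<le> M" and pw: "\<And>y. (\<lambda>n. k n y) \<longlonglongrightarrow> k' y"
    and h: "\<And>n. integrable lborel (h n)" "integrable lborel h'"
    and lim: "(\<lambda>n. \<integral>y. norm (h n y - h' y) \<partial>lborel) \<longlonglongrightarrow> 0"
  shows "(\<lambda>n. \<integral>y. k n y * h n y \<partial>lborel) \<longlonglongrightarrow> (\<integral>y. k' y * h' y \<partial>lborel)"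
proof -
  have [measurable]: "h n \<in> borel_measurable borel" "h' \<in> borel_measurable borel" for n using h by auto
  have M0: "0 \<le> M" using bd[of 0 0] norm_ge_zero[of "k 0 0"] by linarith
  have I: "integrable lborel (\<lambda>y. k n y * f y)" if "integrable lborel f" for n f
  proof (rule Bochner_Integration.integrable_bound[OF integrable_mult_right[OF integrable_norm[OF that], of M]])
    show "AE y in lborel. norm (k n y * f y) \<le> norm (M * norm (f y))"
      using mult_right_mono[OF bd norm_ge_zero] M0 by (intro AE_I2) (simp add: norm_mult)
  qed (use that in measurable)
  have 1: "(\<lambda>n. \<integral>y. k n y * h' y \<partial>lborel) \<longlonglongrightarrow> (\<integral>y. k' y * h' y \<partial>lborel)"
  proof (rule integral_dominated_convergence[where w="\<lambda>y. M * norm (h' y)"])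
    show "AE y in lborel. (\<lambda>n. k n y * h' y) \<longlonglongrightarrow> k' y * h' y"
      by (intro AE_I2 tendsto_mult pw tendsto_const)
    show "AE y in lborel. norm (k n y * h' y) \<le> M * norm (h' y)" for n
      using mult_right_mono[OF bd norm_ge_zero] by (intro AE_I2) (simp add: norm_mult)
  qed (use h in auto)
  have 2: "(\<lambda>n. \<integral>y. k n y * (h n y - h' y) \<partial>lborel) \<longlonglongrightarrow> 0"
  proof (rule Lim_null_comparison)
    show "(\<lambda>n. M * (\<integral>y. norm (h n y - h' y) \<partial>lborel)) \<longlonglongrightarrow> 0"
      using tendsto_mult_right_zero[OF lim, of M] .
    have "norm (\<integral>y. k n y * (h n y - h' y) \<partial>lborel) \<le> (\<integral>y. M * norm (h n y - h' y) \<partial>lborel)" for n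
    proof (rule order_trans[OF integral_norm_bound integral_mono])
      have d: "integrable lborel (\<lambda>y. h n y - h' y)" using h by auto
      show "integrable lborel (\<lambda>y. norm (k n y * (h n y - h' y)))" by (rule integrable_norm[OF I[OF d]])
      show "integrable lborel (\<lambda>y. M * norm (h n y - h' y))" using d by (intro integrable_mult_right integrable_norm)
      show "norm (k n y * (h n y - h' y)) \<le> M * norm (h n y - h' y)" for y
        using mult_right_mono[OF bd norm_ge_zero] by (simp add: norm_mult)
    qed
    then show "\<forall>\<^sub>F n in sequentially. norm (\<integral>y. k n y * (h n y - h' y) \<partial>lborel) \<le> M * (\<integral>y. norm (h n y - h' y) \<partial>lborel)"
      by simp
  qed
  have "(\<integral>y. k n y * h n y \<partial>lborel) = (\<integral>y. k n y * (h n y - h' y) \<partial>lborel) + (\<integral>y. k n y * h' y \<partial>lborel)" for n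
    using I[OF h(1)[of n], of n] I[OF h(2), of n] by (simp add: right_diff_distrib)
  then show ?thesis using tendsto_add[OF 2 1] by simp
qed

lemma continuous_on_FT:
  assumes K: "L1_continuous_on S K"
  shows "continuous_on (S \<times> UNIV) (\<lambda>(s, \<xi>). FT (\<lambda>x. complex_of_real (K s x)) \<xi>)"
  unfolding continuous_on_sequentially
proof (intro allI ballI impI, elim conjE)
  fix X :: "nat \<Rightarrow> real \<times> (real^2)" and a
  assume a: "a \<in> S \<times> UNIV" and X: "\<forall>n. X n \<in> S \<times> UNIV" "X \<longlonglongrightarrow> a"
  let ?s = "\<lambda>n. fst (X n)" and ?\<xi> = "\<lambda>n. snd (X n)"
  have S: "fst a \<in> S" "\<And>n. ?s n \<in> S" using a X(1) by (auto simp: mem_Times_iff)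
  note lim = tendsto_fst[OF X(2)] tendsto_snd[OF X(2)]
  have i: "integrable lborel (\<lambda>x. complex_of_real (K s x))" if "s \<in> S" for s
    using L1_continuous_onD(1)[OF K that] by simp
  have "(\<lambda>n. \<integral>y. cis (- (y \<bullet> ?\<xi> n)) * complex_of_real (K (?s n) y) \<partial>lborel) \<longlonglongrightarrow> (\<integral>y. cis (- (y \<bullet> snd a)) * complex_of_real (K (fst a) y) \<partial>lborel)"
  proof (rule kernel_integral_tendsto[where M=1])
    show "(\<lambda>n. cis (- (y \<bullet> ?\<xi> n))) \<longlonglongrightarrow> cis (- (y \<bullet> snd a))" for y
      by (intro tendsto_intros lim)
    show "(\<lambda>n. \<integral>y. norm (complex_of_real (K (?s n) y) - complex_of_real (K (fst a) y)) \<partial>lborel) \<longlonglongrightarrow> 0"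
      using L1_continuous_onD(2)[OF K S lim(1)] by (simp flip: of_real_diff)
  qed (use S i in auto)
  then show "((\<lambda>(s, \<xi>). FT (\<lambda>x. complex_of_real (K s x)) \<xi>) \<circ> X) \<longlonglongrightarrow> (case a of (s, \<xi>) \<Rightarrow> FT (\<lambda>x. complex_of_real (K s x)) \<xi>)"
    by (simp add: FT_def o_def case_prod_unfold)
qed

text \<open>The bound on the gradient kernel blows up as \<open>s\<close> tends to \<open>t\<close>, but it stays bounded along a sequence of
  times that converges to a time before \<open>t\<close>.\<close>

lemma continuous_on_div_heat:
  assumes K: "\<And>j. L1_continuous_on S (\<lambda>s. H s j)" and t: "\<And>s. s \<in> S \<Longrightarrow> s < t"
  shows "continuous_on (S \<times> UNIV) (\<lambda>(s, x). div_heat (t - s) (H s) x)"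
  unfolding continuous_on_sequentially
proof (intro allI ballI impI, elim conjE)
  fix X :: "nat \<Rightarrow> real \<times> (real^2)" and a
  assume a: "a \<in> S \<times> UNIV" and X: "\<forall>n. X n \<in> S \<times> UNIV" "X \<longlonglongrightarrow> a"
  let ?s = "\<lambda>n. fst (X n)" and ?x = "\<lambda>n. snd (X n)"
  have S: "fst a \<in> S" "\<And>n. ?s n \<in> S" using a X(1) by (auto simp: mem_Times_iff)
  note lim = tendsto_fst[OF X(2)] tendsto_snd[OF X(2)]
  have p: "t - fst a > 0" "t - ?s n > 0" for n using t S by auto
  have "(\<lambda>n. heat_grad_bound (t - ?s n)) \<longlonglongrightarrow> heat_grad_bound (t - fst a)"
    unfolding heat_grad_bound_def using p by (intro tendsto_intros lim) auto
  then have "Bseq (\<lambda>n. heat_grad_bound (t - ?s n))"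
    by (intro convergent_imp_Bseq) (auto simp: convergent_def)
  then obtain M where M: "\<And>n. norm (heat_grad_bound (t - ?s n)) \<le> M" by (auto simp: Bseq_def)
  have "(\<lambda>n. \<Sum>j\<in>UNIV. \<integral>y. heat_grad (t - ?s n) j (?x n - y) * H (?s n) j y \<partial>lborel) \<longlonglongrightarrow>
     (\<Sum>j\<in>UNIV. \<integral>y. heat_grad (t - fst a) j (snd a - y) * H (fst a) j y \<partial>lborel)"
  proof (rule tendsto_sum)
    fix j :: 2
    show "(\<lambda>n. \<integral>y. heat_grad (t - ?s n) j (?x n - y) * H (?s n) j y \<partial>lborel) \<longlonglongrightarrow>
      (\<integral>y. heat_grad (t - fst a) j (snd a - y) * H (fst a) j y \<partial>lborel)"
    proof (rule kernel_integral_tendsto[where M=M])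
      show "norm (heat_grad (t - ?s n) j (?x n - y)) \<le> M" for n y
        using abs_heat_grad_le[OF p(2)[of n], of j "?x n - y"] M[of n] by simp
      show "(\<lambda>n. heat_grad (t - ?s n) j (?x n - y)) \<longlonglongrightarrow> heat_grad (t - fst a) j (snd a - y)" for y
        unfolding heat_grad_def heat_kernel_def using p by (intro tendsto_intros lim) auto
      show "(\<lambda>n. \<integral>y. norm (H (?s n) j y - H (fst a) j y) \<partial>lborel) \<longlonglongrightarrow> 0"
        by (rule L1_continuous_onD(2)[OF K S lim(1)])
    qed (use S L1_continuous_onD(1)[OF K] in auto)
  qed
  then show "((\<lambda>(s, x). div_heat (t - s) (H s) x) \<circ> X) \<longlonglongrightarrow> (case a of (s, x) \<Rightarrow> div_heat (t - s) (H s) x)"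
    by (simp add: div_heat_def o_def case_prod_unfold)
qed

lemma L1_continuous_on_subset: "L1_continuous_on S K \<Longrightarrow> A \<subseteq> S \<Longrightarrow> L1_continuous_on A K"
  unfolding L1_continuous_on_def by blast

lemma L1_continuous_on_bounded:
  assumes K: "L1_continuous_on S K" and S: "compact S"
  obtains M where "\<And>s. s \<in> S \<Longrightarrow> (\<integral>x. \<bar>K s x\<bar> \<partial>lborel) \<le> M"
proof -
  have "continuous_on S (\<lambda>s. \<integral>x. \<bar>K s x\<bar> \<partial>lborel)"
    unfolding continuous_on_sequentially
  proof (intro allI ballI impI, elim conjE)
    fix \<sigma> s assume s: "s \<in> S" "\<forall>n. \<sigma> n \<in> S" "\<sigma> \<longlonglongrightarrow> s"
    have i: "integrable lborel (K s)" "integrable lborel (K (\<sigma> n))" for n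
      using L1_continuous_onD(1)[OF K] s by auto
    have "(\<lambda>n. \<integral>x. \<bar>K (\<sigma> n) x\<bar> \<partial>lborel) \<longlonglongrightarrow> (\<integral>x. \<bar>K s x\<bar> \<partial>lborel)"
    proof (rule integral_tendsto_of_L1)
      have le: "(\<integral>x. norm (\<bar>K (\<sigma> n) x\<bar> - \<bar>K s x\<bar>) \<partial>lborel) \<le> (\<integral>x. norm (K (\<sigma> n) x - K s x) \<partial>lborel)" for n
        using i by (intro integral_mono) auto
      show "(\<lambda>n. \<integral>x. norm (\<bar>K (\<sigma> n) x\<bar> - \<bar>K s x\<bar>) \<partial>lborel) \<longlonglongrightarrow> 0"
        by (rule Lim_null_comparison[OF always_eventually L1_continuous_onD(2)[OF K s(1) s(2)[rule_format] s(3)]])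
          (use le in simp)
    qed (use i in auto)
    then show "((\<lambda>s. \<integral>x. \<bar>K s x\<bar> \<partial>lborel) \<circ> \<sigma>) \<longlonglongrightarrow> (\<integral>x. \<bar>K s x\<bar> \<partial>lborel)"
      by (simp add: o_def)
  qed
  from compact_imp_bounded[OF compact_continuous_image[OF this S]]
  obtain M where M: "\<And>s. s \<in> S \<Longrightarrow> norm (\<integral>x. \<bar>K s x\<bar> \<partial>lborel) \<le> M"
    by (auto simp: bounded_iff)
  have "(\<integral>x. \<bar>K s x\<bar> \<partial>lborel) \<le> M" if "s \<in> S" for s
    using M[OF that] by simp
  then show ?thesis by (rule that)
qed

lemma integrable_inverse_sqrt:
  "integrable lborel (\<lambda>s. indicator {0..<t} s * (1 / sqrt (pi * (t - s))))"
proof (cases "t > 0")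
  case True
  have "set_integrable lborel (einterval 0 t) (\<lambda>s. 1 / sqrt (t - s))"
  proof (rule interval_integral_FTC_nonneg(1)[where F="\<lambda>s. - 2 * sqrt (t - s)"])
    show "((\<lambda>s. - 2 * sqrt (t - s)) has_real_derivative 1 / sqrt (t - s)) (at s)" if "0 < ereal s" "ereal s < ereal t" for s
      using that by (auto intro!: derivative_eq_intros simp: field_simps)
    show "isCont (\<lambda>s. 1 / sqrt (t - s)) s" if "0 < ereal s" "ereal s < ereal t" for s
      using that by (intro continuous_intros) auto
    have c: "isCont (\<lambda>s. - 2 * sqrt (t - s)) s" for s by (intro continuous_intros)
    show "(((\<lambda>s. - 2 * sqrt (t - s)) \<circ> real_of_ereal) \<longlongrightarrow> - 2 * sqrt (t - 0)) (at_right 0)"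
      using c[of 0] by (simp add: zero_ereal_def ereal_tendsto_simps1 isCont_def filterlim_at_split)
    show "(((\<lambda>s. - 2 * sqrt (t - s)) \<circ> real_of_ereal) \<longlongrightarrow> - 2 * sqrt (t - t)) (at_left (ereal t))"
      using c[of t] by (simp add: ereal_tendsto_simps1 isCont_def filterlim_at_split)
  qed (use True in \<open>auto simp: zero_ereal_def\<close>)
  then have 1: "integrable lborel (\<lambda>s. (1 / sqrt pi) * (indicator (einterval 0 t) s *\<^sub>R (1 / sqrt (t - s))))"
    unfolding set_integrable_def by (rule integrable_mult_right)
  have 2: "AE s in lborel. (1 / sqrt pi) * (indicator (einterval 0 t) s *\<^sub>R (1 / sqrt (t - s))) = indicator {0..<t} s * (1 / sqrt (pi * (t - s)))"
    using AE_lborel_singleton[of 0]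
    by eventually_elim (auto simp: indicator_def einterval_def zero_ereal_def real_sqrt_mult)
  show ?thesis
    by (rule integrable_cong_AE_imp[OF 1 _ 2]) measurable
qed simp

text \<open>The \<open>L\<^sup>1\<close> norm of \<open>div_heat (t - s) (H s)\<close> is of order \<open>(t - s)\<^sup>-\<^sup>1\<^sup>/\<^sup>2\<close>, which is integrable in time. So
  Fubini's theorem applies, and the transform of each slice is known from \<open>FT_div_heat\<close>.\<close>

lemma duhamel_fourier:
  assumes H: "\<And>j. L1_continuous_on {0..T} (\<lambda>s. H s j)" and t: "t \<in> {0..T}"
    and w[measurable]: "w \<in> borel_measurable borel"
    and eq: "AE x in lborel. w x = - (LINT s:{0..<t}|lebesgue. div_heat (t - s) (H s) x)"
  shows "integrable lborel w"
    and "FT (\<lambda>x. complex_of_real (w x)) \<xi> = - (\<integral>s. indicator {0..<t} s *\<^sub>R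
       (\<i> * exp (- (t - s) * (norm \<xi>)\<^sup>2) * (\<Sum>j\<in>UNIV. complex_of_real (\<xi> $ j) * FT (\<lambda>x. complex_of_real (H s j x)) \<xi>)) \<partial>lborel)"
proof -
  \<comment> \<open>The cut-off makes a function on the whole plane of times and points that is Borel measurable,
    since it is continuous before time \<open>t\<close>.\<close>
  define P where "P s x = indicator {0..<t} s * div_heat (t - s) (H s) x" for s x
  have Pm[measurable]: "(\<lambda>p. P (fst p) (snd p)) \<in> borel_measurable (lborel \<Otimes>\<^sub>M lborel)"
  proof -
    have "continuous_on ({0..<t} \<times> UNIV) (\<lambda>p. div_heat (t - fst p) (H (fst p)) (snd p))"
    proof -
      have "L1_continuous_on {0..<t} (\<lambda>s. H s j)" for j
        by (rule L1_continuous_on_subset[OF H]) (use t in auto)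
      from continuous_on_div_heat[of "{0..<t}" H t, OF this] show ?thesis
        unfolding case_prod_unfold by simp
    qed
    then have "(\<lambda>p. indicator ({0..<t} \<times> UNIV) p *\<^sub>R div_heat (t - fst p) (H (fst p)) (snd p)) \<in> borel_measurable borel"
      by (intro borel_measurable_continuous_on_indicator) (auto intro!: borel_Times)
    then show ?thesis
      unfolding lborel_prod P_def by (simp add: indicator_times)
  qed
  have Ps[measurable]: "(\<lambda>s. P s x) \<in> borel_measurable borel" for x
    using measurable_Pair1[OF Pm, of x] by simp
  have Px[measurable]: "P s \<in> borel_measurable borel" for s
    using measurable_Pair2[OF Pm, of s] by simp
  have int: "integrable lborel (H s j)" if "s \<in> {0..<t}" for s j
    using that t by (intro L1_continuous_onD(1)[OF H]) auto
  obtain M where M: "\<And>j s. s \<in> {0..T} \<Longrightarrow> (\<integral>x. \<bar>H s j x\<bar> \<partial>lborel) \<le> M j"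
  proof -
    have "\<forall>j. \<exists>M. \<forall>s\<in>{0..T}. (\<integral>x. \<bar>H s j x\<bar> \<partial>lborel) \<le> M"
    proof
      fix j
      obtain M where "\<And>s. s \<in> {0..T} \<Longrightarrow> (\<integral>x. \<bar>H s j x\<bar> \<partial>lborel) \<le> M"
        by (rule L1_continuous_on_bounded[OF H[of j] compact_Icc]) blast
      then show "\<exists>M. \<forall>s\<in>{0..T}. (\<integral>x. \<bar>H s j x\<bar> \<partial>lborel) \<le> M" by blast
    qed
    from choice[OF this] show ?thesis using that by blast
  qed
  have PI: "integrable lborel (P s)" for s
  proof (cases "s \<in> {0..<t}")
    case True
    have "integrable lborel (div_heat (t - s) (H s))"
      by (rule integrable_div_heat[OF _ int[OF True]]) (use True in simp)
    then show ?thesis using True by (simp add: P_def[abs_def])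
  qed (simp add: P_def[abs_def])
  have P1: "(\<integral>x. \<bar>P s x\<bar> \<partial>lborel) \<le> indicator {0..<t} s * (1 / sqrt (pi * (t - s))) * (\<Sum>j\<in>UNIV. M j)" for s
  proof (cases "s \<in> {0..<t}")
    case True
    have "(\<integral>x. \<bar>P s x\<bar> \<partial>lborel) \<le> 1 / sqrt (pi * (t - s)) * (\<Sum>j\<in>UNIV. \<integral>x. \<bar>H s j x\<bar> \<partial>lborel)"
      unfolding P_def using div_heat_L1_le[OF _ int[OF True], of "t - s"] True by simp
    also have "\<dots> \<le> 1 / sqrt (pi * (t - s)) * (\<Sum>j\<in>UNIV. M j)"
      using True t by (intro mult_left_mono sum_mono M) auto
    finally show ?thesis using True by simp
  qed (simp add: P_def)
  have I: "integrable (lborel \<Otimes>\<^sub>M lborel) (\<lambda>(s, x). c x * complex_of_real (P s x))"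
    if c[measurable]: "c \<in> borel_measurable borel" and c1: "\<And>x. norm (c x) = 1" for c :: "real^2 \<Rightarrow> complex"
  proof (rule lborel_pair.Fubini_integrable)
    have "integrable lborel (\<lambda>x. c x * complex_of_real (P s x))" for s
      by (rule Bochner_Integration.integrable_bound[OF PI[of s]]) (auto simp: norm_mult c1)
    then show "AE s in lborel. integrable lborel (\<lambda>x. case (s, x) of (s, x) \<Rightarrow> c x * complex_of_real (P s x))" by simp
    have e: "(\<integral>x. norm (case (s, x) of (s, x) \<Rightarrow> c x * complex_of_real (P s x)) \<partial>lborel) = (\<integral>x. \<bar>P s x\<bar> \<partial>lborel)" for s
      by (simp add: norm_mult c1)
    show "integrable lborel (\<lambda>s. \<integral>x. norm (case (s, x) of (s, x) \<Rightarrow> c x * complex_of_real (P s x)) \<partial>lborel)"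
      unfolding e
    proof (rule Bochner_Integration.integrable_bound)
      show "integrable lborel (\<lambda>s. indicator {0..<t} s * (1 / sqrt (pi * (t - s))) * (\<Sum>j\<in>UNIV. M j))"
        by (rule integrable_mult_left[OF integrable_inverse_sqrt])
      show "AE s in lborel. norm (\<integral>x. \<bar>P s x\<bar> \<partial>lborel) \<le> norm (indicator {0..<t} s * (1 / sqrt (pi * (t - s))) * (\<Sum>j\<in>UNIV. M j))"
      proof (rule AE_I2)
        fix s
        have "0 \<le> (\<integral>x. \<bar>P s x\<bar> \<partial>lborel)" by simp
        then show "norm (\<integral>x. \<bar>P s x\<bar> \<partial>lborel) \<le> norm (indicator {0..<t} s * (1 / sqrt (pi * (t - s))) * (\<Sum>j\<in>UNIV. M j))"
          using P1[of s] unfolding real_norm_def by linarith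
      qed
      have "(\<lambda>p. \<bar>P (fst p) (snd p)\<bar>) \<in> borel_measurable (lborel \<Otimes>\<^sub>M lborel)" by measurable
      from lborel.borel_measurable_lebesgue_integral[of "\<lambda>s x. \<bar>P s x\<bar>"] this
      show "(\<lambda>s. \<integral>x. \<bar>P s x\<bar> \<partial>lborel) \<in> borel_measurable lborel"
        by (simp add: case_prod_unfold)
    qed
    show "(\<lambda>(s, x). c x * complex_of_real (P s x)) \<in> borel_measurable (lborel \<Otimes>\<^sub>M lborel)"
      unfolding case_prod_unfold using Pm by measurable
  qed
  have set: "(LINT s:{0..<t}|lebesgue. div_heat (t - s) (H s) x) = (\<integral>s. P s x \<partial>lborel)" for x
    unfolding set_lebesgue_integral_def P_def[symmetric] real_scaleR_def
    by (rule integral_completion) simp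
  have eq': "AE x in lborel. complex_of_real (w x) = - (\<integral>s. complex_of_real (P s x) \<partial>lborel)"
    using eq unfolding set by eventually_elim (simp only: integral_complex_of_real of_real_minus)
  have I1: "integrable (lborel \<Otimes>\<^sub>M lborel) (\<lambda>(s, x). complex_of_real (P s x))"
    using I[of "\<lambda>x. 1"] by simp
  have "integrable lborel (\<lambda>x. \<integral>s. complex_of_real (P s x) \<partial>lborel)"
    by (rule lborel_pair.integrable_snd[OF I1])
  then have 1: "integrable lborel (\<lambda>x. - (\<integral>s. complex_of_real (P s x) \<partial>lborel))"
    by (rule Bochner_Integration.integrable_minus)
  have 2: "AE x in lborel. - (\<integral>s. complex_of_real (P s x) \<partial>lborel) = complex_of_real (w x)"
    using eq' by eventually_elim simp
  have "integrable lborel (\<lambda>x. complex_of_real (w x))"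
    by (rule integrable_cong_AE_imp[OF 1 _ 2]) measurable
  then show iw: "integrable lborel w" by (simp only: integrable_of_real_iff)
  have Ic: "integrable (lborel \<Otimes>\<^sub>M lborel) (\<lambda>(s, x). cis (- (x \<bullet> \<xi>)) * complex_of_real (P s x))"
    by (rule I) auto
  have "FT (\<lambda>x. complex_of_real (w x)) \<xi> = (\<integral>x. - (\<integral>s. cis (- (x \<bullet> \<xi>)) * complex_of_real (P s x) \<partial>lborel) \<partial>lborel)"
    unfolding FT_def
  proof (rule integral_cong_AE)
    show "AE x in lborel. cis (- (x \<bullet> \<xi>)) * complex_of_real (w x) = - (\<integral>s. cis (- (x \<bullet> \<xi>)) * complex_of_real (P s x) \<partial>lborel)"
      using eq' by eventually_elim simp
    show "(\<lambda>x. - (\<integral>s. cis (- (x \<bullet> \<xi>)) * complex_of_real (P s x) \<partial>lborel)) \<in> borel_measurable lborel"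
      using borel_measurable_integrable[OF lborel_pair.integrable_snd[OF Ic]] by (rule borel_measurable_uminus)
  qed measurable
  also have "\<dots> = - (\<integral>s. (\<integral>x. cis (- (x \<bullet> \<xi>)) * complex_of_real (P s x) \<partial>lborel) \<partial>lborel)"
    using lborel_pair.Fubini_integral[OF Ic] by simp
  also have "(\<lambda>s. \<integral>x. cis (- (x \<bullet> \<xi>)) * complex_of_real (P s x) \<partial>lborel) = (\<lambda>s. indicator {0..<t} s *\<^sub>R
       (\<i> * exp (- (t - s) * (norm \<xi>)\<^sup>2) * (\<Sum>j\<in>UNIV. complex_of_real (\<xi> $ j) * FT (\<lambda>x. complex_of_real (H s j x)) \<xi>)))"
  proof
    fix s
    show "(\<integral>x. cis (- (x \<bullet> \<xi>)) * complex_of_real (P s x) \<partial>lborel) = indicator {0..<t} s *\<^sub>R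
       (\<i> * exp (- (t - s) * (norm \<xi>)\<^sup>2) * (\<Sum>j\<in>UNIV. complex_of_real (\<xi> $ j) * FT (\<lambda>x. complex_of_real (H s j x)) \<xi>))"
    proof (cases "s \<in> {0..<t}")
      case True
      then have "(\<integral>x. cis (- (x \<bullet> \<xi>)) * complex_of_real (P s x) \<partial>lborel) = FT (\<lambda>x. complex_of_real (div_heat (t - s) (H s) x)) \<xi>"
        by (simp add: P_def FT_def)
      also have "\<dots> = \<i> * exp (- (t - s) * (norm \<xi>)\<^sup>2) * (\<Sum>j\<in>UNIV. complex_of_real (\<xi> $ j) * FT (\<lambda>x. complex_of_real (H s j x)) \<xi>)"
        using True by (intro FT_div_heat int) auto
      finally show ?thesis using True by simp
    qed (simp add: P_def)
  qed
  finally show "FT (\<lambda>x. complex_of_real (w x)) \<xi> = - (\<integral>s. indicator {0..<t} s *\<^sub>R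
       (\<i> * exp (- (t - s) * (norm \<xi>)\<^sup>2) * (\<Sum>j\<in>UNIV. complex_of_real (\<xi> $ j) * FT (\<lambda>x. complex_of_real (H s j x)) \<xi>)) \<partial>lborel)" .
qed

section \<open>Continuity in time of the flux\<close>

definition L2_continuous_on ::
    "real set \<Rightarrow> (real \<Rightarrow> real^2 \<Rightarrow> 'b::{real_normed_field, second_countable_topology, banach}) \<Rightarrow> bool" where
  "L2_continuous_on S K \<longleftrightarrow> (\<forall>s\<in>S. square_integrable (K s)) \<and>
     (\<forall>s\<in>S. \<forall>\<sigma>. (\<forall>n. \<sigma> n \<in> S) \<longrightarrow> \<sigma> \<longlonglongrightarrow> s \<longrightarrow> (\<lambda>n. sq_norm (\<lambda>x. K (\<sigma> n) x - K s x)) \<longlonglongrightarrow> 0)"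

lemma L2_continuous_onD:
  assumes "L2_continuous_on S K"
  shows "s \<in> S \<Longrightarrow> square_integrable (K s)"
    and "\<lbrakk>s \<in> S; \<And>n. \<sigma> n \<in> S; \<sigma> \<longlonglongrightarrow> s\<rbrakk> \<Longrightarrow> (\<lambda>n. sq_norm (\<lambda>x. K (\<sigma> n) x - K s x)) \<longlonglongrightarrow> 0"
  using assms by (auto simp: L2_continuous_on_def)

lemma L1_continuous_on_mult:
  assumes f: "L2_continuous_on S f" and g: "L2_continuous_on S g"
  shows "L1_continuous_on S (\<lambda>s x. f s x * g s x)"
  unfolding L1_continuous_on_def
proof (intro conjI ballI allI impI)
  show "integrable lborel (\<lambda>x. f s x * g s x)" if "s \<in> S" for s
    by (intro integrable_mult_L2 L2_continuous_onD(1)[OF f] L2_continuous_onD(1)[OF g] that)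
  fix s \<sigma> assume s: "s \<in> S" "\<forall>n. \<sigma> n \<in> S" "\<sigma> \<longlonglongrightarrow> s"
  show "(\<lambda>n. \<integral>x. norm (f (\<sigma> n) x * g (\<sigma> n) x - f s x * g s x) \<partial>lborel) \<longlonglongrightarrow> 0"
    using s L2_continuous_onD[OF f] L2_continuous_onD[OF g] by (intro L1_tendsto_mult_L2) auto
qed

lemma L1_continuous_on_diff:
  assumes f: "L1_continuous_on S f" and g: "L1_continuous_on S g"
  shows "L1_continuous_on S (\<lambda>s x. f s x - g s x)"
  unfolding L1_continuous_on_def
proof (intro conjI ballI allI impI)
  show "integrable lborel (\<lambda>x. f s x - g s x)" if "s \<in> S" for s
    by (intro Bochner_Integration.integrable_diff L1_continuous_onD(1)[OF f] L1_continuous_onD(1)[OF g] that)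
  fix s \<sigma> assume s: "s \<in> S" "\<forall>n. \<sigma> n \<in> S" "\<sigma> \<longlonglongrightarrow> s"
  let ?F = "\<lambda>n. \<integral>x. norm (f (\<sigma> n) x - f s x) \<partial>lborel" and ?G = "\<lambda>n. \<integral>x. norm (g (\<sigma> n) x - g s x) \<partial>lborel"
  let ?D = "\<lambda>n. \<integral>x. norm (f (\<sigma> n) x - g (\<sigma> n) x - (f s x - g s x)) \<partial>lborel"
  have "?D n \<le> ?F n + ?G n" for n
  proof -
    have i: "integrable lborel (f s)" "integrable lborel (f (\<sigma> n))" "integrable lborel (g s)" "integrable lborel (g (\<sigma> n))"
      using s L1_continuous_onD(1)[OF f] L1_continuous_onD(1)[OF g] by auto
    have "?D n \<le> (\<integral>x. norm (f (\<sigma> n) x - f s x) + norm (g (\<sigma> n) x - g s x) \<partial>lborel)"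
      using i by (intro integral_mono) auto
    then show ?thesis using i by simp
  qed
  moreover have "(\<lambda>n. ?F n + ?G n) \<longlonglongrightarrow> 0"
    using tendsto_add[OF L1_continuous_onD(2)[OF f s(1) s(2)[rule_format] s(3)] L1_continuous_onD(2)[OF g s(1) s(2)[rule_format] s(3)]] by simp
  ultimately show "?D \<longlonglongrightarrow> 0"
    by - (rule Lim_null_comparison[OF always_eventually], simp_all)
qed

lemma L2_continuous_on_of_continuous_L2:
  assumes c: "continuous_L2 S \<theta>" and B: "\<And>t. t \<in> S \<Longrightarrow> B t \<in> borel_measurable borel"
    and eq: "\<And>t. t \<in> S \<Longrightarrow> AE x in lborel. \<theta> t x = B t x"
  shows "L2_continuous_on S B"
proof -
  have sq: "square_integrable (B t)" if "t \<in> S" for t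
    using square_integrable_of_L2[OF _ B eq] c that by (auto simp: continuous_L2_def)
  show ?thesis
    unfolding L2_continuous_on_def
  proof (intro conjI ballI allI impI)
    fix s \<sigma> assume s: "s \<in> S" "\<forall>n. \<sigma> n \<in> S" "\<sigma> \<longlonglongrightarrow> s"
    let ?\<phi> = "\<lambda>r. \<integral>\<^sup>+x. ennreal ((norm (\<theta> r x - \<theta> s x))\<^sup>2) \<partial>lebesgue"
    have "(?\<phi> \<longlongrightarrow> ?\<phi> s) (at s within S)"
      using c s(1) by (simp add: continuous_L2_def L2_tendsto_def)
    then have "continuous (at s within S) ?\<phi>"
      by (simp add: continuous_within)
    from continuous_within_tendsto_compose[OF this always_eventually s(3)] s(2)
    have "(\<lambda>n. ?\<phi> (\<sigma> n)) \<longlonglongrightarrow> ?\<phi> s" by simp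
    then have "L2_tendsto (\<lambda>n. \<theta> (\<sigma> n)) (\<theta> s) sequentially"
      by (simp add: L2_tendsto_def)
    then show "(\<lambda>n. sq_norm (\<lambda>x. B (\<sigma> n) x - B s x)) \<longlonglongrightarrow> 0"
      by (rule L2_tendsto_sq_norm) (use s eq sq in \<open>auto intro!: square_integrable_diff\<close>)
  qed (rule sq)
qed

text \<open>Plancherel's theorem transfers the continuity to the velocity and to the transform.\<close>

lemma sqg_rep_continuous:
  assumes rep: "\<And>t. t \<in> S \<Longrightarrow> sqg_rep (B t) (U t) (b t)" and B: "L2_continuous_on S B"
  shows "L2_continuous_on S (\<lambda>t. U t j)" "L2_continuous_on S b"
proof -
  have s: "square_integrable (U t j)" "square_integrable (b t)" if "t \<in> S" for t
    using sqg_repD[OF rep[OF that]] by auto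
  show "L2_continuous_on S (\<lambda>t. U t j)"
    unfolding L2_continuous_on_def
  proof (intro conjI ballI allI impI)
    fix s \<sigma> assume s: "s \<in> S" "\<forall>n. \<sigma> n \<in> S" "\<sigma> \<longlonglongrightarrow> s"
    have "sq_norm (\<lambda>x. U (\<sigma> n) j x - U s j x) \<le> sq_norm (\<lambda>x. B (\<sigma> n) x - B s x)" for n
      using s by (intro sqg_rep_velocity_diff_le(1)[OF rep rep]) auto
    then show "(\<lambda>n. sq_norm (\<lambda>x. U (\<sigma> n) j x - U s j x)) \<longlonglongrightarrow> 0"
      using L2_continuous_onD(2)[OF B s(1) s(2)[rule_format] s(3)]
      by - (rule Lim_null_comparison[OF always_eventually], simp_all)
  qed (rule s)
  show "L2_continuous_on S b"
    unfolding L2_continuous_on_def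
  proof (intro conjI ballI allI impI)
    fix s \<sigma> assume s: "s \<in> S" "\<forall>n. \<sigma> n \<in> S" "\<sigma> \<longlonglongrightarrow> s"
    have "sq_norm (\<lambda>x. b (\<sigma> n) x - b s x) = 4 * pi\<^sup>2 * sq_norm (\<lambda>x. B (\<sigma> n) x - B s x)" for n
      using s by (intro sqg_rep_velocity_diff_le(2)[OF rep rep]) auto
    then show "(\<lambda>n. sq_norm (\<lambda>x. b (\<sigma> n) x - b s x)) \<longlonglongrightarrow> 0"
      using tendsto_mult_right_zero[OF L2_continuous_onD(2)[OF B s(1) s(2)[rule_format] s(3)]] by simp
  qed (rule s)
qed

lemma L2_continuous_on_add:
  assumes f: "L2_continuous_on S f" and g: "L2_continuous_on S g"
  shows "L2_continuous_on S (\<lambda>s x. f s x + g s x)"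
  unfolding L2_continuous_on_def
proof (intro conjI ballI allI impI)
  show "square_integrable (\<lambda>x. f s x + g s x)" if "s \<in> S" for s
    by (intro square_integrable_add L2_continuous_onD(1)[OF f] L2_continuous_onD(1)[OF g] that)
  fix s \<sigma> assume s: "s \<in> S" "\<forall>n. \<sigma> n \<in> S" "\<sigma> \<longlonglongrightarrow> s"
  let ?F = "\<lambda>n. sq_norm (\<lambda>x. f (\<sigma> n) x - f s x)" and ?G = "\<lambda>n. sq_norm (\<lambda>x. g (\<sigma> n) x - g s x)"
  have "sq_norm (\<lambda>x. f (\<sigma> n) x + g (\<sigma> n) x - (f s x + g s x)) \<le> 2 * ?F n + 2 * ?G n" for n
    using sq_norm_add_le[of "\<lambda>x. f (\<sigma> n) x - f s x" "\<lambda>x. g (\<sigma> n) x - g s x"] s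
      square_integrable_diff[OF L2_continuous_onD(1)[OF f] L2_continuous_onD(1)[OF f], of "\<sigma> n" s]
      square_integrable_diff[OF L2_continuous_onD(1)[OF g] L2_continuous_onD(1)[OF g], of "\<sigma> n" s]
    by (simp add: algebra_simps)
  moreover have "(\<lambda>n. 2 * ?F n + 2 * ?G n) \<longlonglongrightarrow> 0"
    using tendsto_add[OF tendsto_mult_right_zero[OF L2_continuous_onD(2)[OF f s(1) s(2)[rule_format] s(3)], of 2]
      tendsto_mult_right_zero[OF L2_continuous_onD(2)[OF g s(1) s(2)[rule_format] s(3)], of 2]] by simp
  ultimately show "(\<lambda>n. sq_norm (\<lambda>x. f (\<sigma> n) x + g (\<sigma> n) x - (f s x + g s x))) \<longlonglongrightarrow> 0"
    by - (rule Lim_null_comparison[OF always_eventually], simp_all)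
qed

text \<open>A sequence of times that violates the bound with growing radii has a limit point; there the tails of the
  limit function tend to zero, and the tails of the nearby functions differ from them by little.\<close>

lemma L2_continuous_uniform_tail:
  assumes K: "L2_continuous_on S K" and S: "compact S" and \<epsilon>: "\<epsilon> > 0"
  obtains N :: nat where "\<And>s. s \<in> S \<Longrightarrow> sq_norm (\<lambda>x. truncate_ball N (K s) x - K s x) \<le> \<epsilon>"
proof (rule ccontr)
  assume no: "\<not> thesis"
  let ?tail = "\<lambda>n s. sq_norm (\<lambda>x. truncate_ball n (K s) x - K s x)"
  have "\<exists>s\<in>S. ?tail n s > \<epsilon>" for n
    using no that by (meson not_le)
  then obtain \<sigma> where \<sigma>: "\<And>n. \<sigma> n \<in> S" "\<And>n. ?tail n (\<sigma> n) > \<epsilon>" by metis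
  from S obtain s r where s: "s \<in> S" and r: "strict_mono (r :: nat \<Rightarrow> nat)" and lim: "(\<sigma> \<circ> r) \<longlonglongrightarrow> s"
    unfolding compact_def using \<sigma>(1) by metis
  have lim': "(\<lambda>n. \<sigma> (r n)) \<longlonglongrightarrow> s" using lim by (simp add: o_def)
  let ?d = "\<lambda>n. sq_norm (\<lambda>x. K (\<sigma> (r n)) x - K s x)"
  have "?tail (r n) (\<sigma> (r n)) \<le> 2 * ?d n + 2 * ?tail (r n) s" for n
  proof -
    note i = L2_continuous_onD(1)[OF K \<sigma>(1)[of "r n"]] L2_continuous_onD(1)[OF K s]
    let ?D = "\<lambda>x. K (\<sigma> (r n)) x - K s x"
    have D: "square_integrable ?D" by (rule square_integrable_diff[OF i])
    have T: "square_integrable (\<lambda>x. truncate_ball m f x - f x)" if "square_integrable f" for m and f :: "real^2 \<Rightarrow> 'a"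
      by (intro square_integrable_diff square_integrable_truncate_ball that)
    have eq: "truncate_ball (r n) (K (\<sigma> (r n))) x - K (\<sigma> (r n)) x = (truncate_ball (r n) ?D x - ?D x) + (truncate_ball (r n) (K s) x - K s x)" for x
      by (simp add: truncate_ball_def scaleR_diff_right)
    have "?tail (r n) (\<sigma> (r n)) \<le> 2 * sq_norm (\<lambda>x. truncate_ball (r n) ?D x - ?D x) + 2 * ?tail (r n) s"
      unfolding eq by (rule sq_norm_add_le[OF T[OF D] T[OF i(2)]])
    moreover have "sq_norm (\<lambda>x. truncate_ball (r n) ?D x - ?D x) \<le> sq_norm ?D"
      by (rule square_integrable_bound(2)[OF D square_integrable_measurable[OF T[OF D]]])
        (auto simp: truncate_ball_def indicator_def norm_minus_commute)
    ultimately show ?thesis by linarith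
  qed
  moreover have "(\<lambda>n. 2 * ?d n + 2 * ?tail (r n) s) \<longlonglongrightarrow> 2 * 0 + 2 * 0"
    using LIMSEQ_subseq_LIMSEQ[OF truncate_ball_L2_tendsto[OF L2_continuous_onD(1)[OF K s]] r]
    by (intro tendsto_intros L2_continuous_onD(2)[OF K s \<sigma>(1) lim']) (simp add: o_def)
  then have "\<forall>\<^sub>F n in sequentially. 2 * ?d n + 2 * ?tail (r n) s < \<epsilon>"
    using \<epsilon> by (intro order_tendstoD) auto
  then obtain n where "2 * ?d n + 2 * ?tail (r n) s < \<epsilon>"
    by (auto simp: eventually_sequentially)
  ultimately show False using \<sigma>(2)[of "r n"] by (meson not_le order.strict_trans1 less_asym)
qed

lemma L2_continuous_bounded:
  assumes K: "L2_continuous_on S K" and S: "compact S"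
  obtains M where "\<And>s. s \<in> S \<Longrightarrow> sq_norm (K s) \<le> M"
proof (rule ccontr)
  assume no: "\<not> thesis"
  have "\<exists>s\<in>S. sq_norm (K s) > real n" for n
    using no that by (meson not_le)
  then obtain \<sigma> where \<sigma>: "\<And>n. \<sigma> n \<in> S" "\<And>n. sq_norm (K (\<sigma> n)) > real n" by metis
  from S obtain s r where s: "s \<in> S" and r: "strict_mono (r :: nat \<Rightarrow> nat)" and lim: "(\<sigma> \<circ> r) \<longlonglongrightarrow> s"
    unfolding compact_def using \<sigma>(1) by metis
  have lim': "(\<lambda>n. \<sigma> (r n)) \<longlonglongrightarrow> s" using lim by (simp add: o_def)
  let ?d = "\<lambda>n. sq_norm (\<lambda>x. K (\<sigma> (r n)) x - K s x)"
  have "?d \<longlonglongrightarrow> 0" by (rule L2_continuous_onD(2)[OF K s \<sigma>(1) lim'])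
  then obtain N where N: "\<And>n. n \<ge> N \<Longrightarrow> ?d n < 1"
    using order_tendstoD(2)[of ?d 0 sequentially 1] by (auto simp: eventually_sequentially)
  obtain m :: nat where m: "real m > 2 + 2 * sq_norm (K s)" using reals_Archimedean2 by blast
  define n where "n = max N m"
  have "sq_norm (K (\<sigma> (r n))) \<le> 2 * ?d n + 2 * sq_norm (K s)"
    using sq_norm_add_le[OF square_integrable_diff[OF L2_continuous_onD(1)[OF K \<sigma>(1)] L2_continuous_onD(1)[OF K s]] L2_continuous_onD(1)[OF K s], of "r n"]
    by simp
  also have "\<dots> < real m" using N[of n] m by (simp add: n_def)
  also have "\<dots> \<le> real (r n)" using seq_suble[OF r, of n] by (simp add: n_def)
  finally show False using \<sigma>(2)[of "r n"] by simp
qed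

section \<open>Mild solutions\<close>

lemma integrable_heat_grad_mult:
  assumes "r > 0" "integrable lborel f"
  shows "integrable lborel (\<lambda>y. heat_grad r j (x - y) * f y)"
proof (rule Bochner_Integration.integrable_bound[OF integrable_mult_right[OF assms(2), of "heat_grad_bound r"]])
  have "0 \<le> heat_grad_bound r" using assms(1) by (simp add: heat_grad_bound_def)
  then show "AE y in lborel. norm (heat_grad r j (x - y) * f y) \<le> norm (heat_grad_bound r * f y)"
    using mult_right_mono[OF abs_heat_grad_le[OF assms(1)] abs_ge_zero] by (intro AE_I2) (simp add: abs_mult)
qed (use assms in measurable)

lemma div_heat_diff:
  assumes "r > 0" "\<And>j. integrable lborel (f j)" "\<And>j. integrable lborel (g j)"
  shows "div_heat r (\<lambda>j x. f j x - g j x) x = div_heat r f x - div_heat r g x"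
  unfolding div_heat_def sum_subtractf[symmetric] right_diff_distrib
  by (intro sum.cong refl Bochner_Integration.integral_diff integrable_heat_grad_mult assms)

text \<open>The interface to the definitions: the representatives at the different times are chosen independently,
  which affects neither the flux in \<open>L\<^sup>1\<close> nor the integrand in Duhamel's formula.\<close>

lemma mild_solution_rep:
  assumes "mild_solution T \<theta>\<^sub>0 \<theta>"
  obtains B U b where "\<And>t. t \<in> {0..T} \<Longrightarrow> sqg_rep (B t) (U t) (b t)"
    and "\<And>t. t \<in> {0..T} \<Longrightarrow> AE x in lborel. \<theta> t x = B t x"
    and "L2_continuous_on {0..T} B"
    and "\<And>t. t \<in> {0..T} \<Longrightarrow> AE x in lborel. set_integrable lebesgue {0..<t} (\<lambda>s. div_heat (t - s) (\<lambda>j x. B s x * U s j x) x) \<and>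
       B t x = heat_semigroup t \<theta>\<^sub>0 x - (LINT s:{0..<t}|lebesgue. div_heat (t - s) (\<lambda>j x. B s x * U s j x) x)"
proof -
  obtain u where c: "continuous_L2 {0..T} \<theta>" and u: "\<And>t. t \<in> {0..T} \<Longrightarrow> is_sqg_velocity (\<theta> t) (u t)"
    and mild: "\<And>t. t \<in> {0..T} \<Longrightarrow> AE x in lebesgue.
           set_integrable lebesgue {0..<t}
             (\<lambda>s. divergence (heat_semigroup (t - s) (\<lambda>y. \<theta> s y *\<^sub>R u s y)) x) \<and>
           \<theta> t x = heat_semigroup t \<theta>\<^sub>0 x -
             (LINT s:{0..<t}|lebesgue. divergence (heat_semigroup (t - s) (\<lambda>y. \<theta> s y *\<^sub>R u s y)) x)"
    using assms unfolding mild_solution_def by blast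
  have L2: "L2 (\<theta> t)" if "t \<in> {0..T}" for t using c that by (simp add: continuous_L2_def)
  have "\<forall>t\<in>{0..T}. \<exists>p. case p of (B, U, b) \<Rightarrow> sqg_rep B U b \<and> (AE x in lborel. \<theta> t x = B x) \<and> (\<forall>j. AE x in lborel. u t x $ j = U j x) \<and>
    B \<in> borel_measurable borel \<and> (\<forall>j. (\<lambda>x. u t x $ j) \<in> borel_measurable lebesgue)"
  proof
    fix t assume t: "t \<in> {0..T}"
    obtain B U b where "sqg_rep B U b" "AE x in lborel. \<theta> t x = B x" "\<And>j. AE x in lborel. u t x $ j = U j x"
      "B \<in> borel_measurable borel" "\<And>j. U j \<in> borel_measurable borel" "\<And>j. (\<lambda>x. u t x $ j) \<in> borel_measurable lebesgue"
      by (rule sqg_rep_exists[OF L2[OF t] u[OF t]]) blast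
    then show "\<exists>p. case p of (B, U, b) \<Rightarrow> sqg_rep B U b \<and> (AE x in lborel. \<theta> t x = B x) \<and> (\<forall>j. AE x in lborel. u t x $ j = U j x) \<and>
      B \<in> borel_measurable borel \<and> (\<forall>j. (\<lambda>x. u t x $ j) \<in> borel_measurable lebesgue)"
      by (intro exI[of _ "(B, U, b)"]) simp
  qed
  from bchoice[OF this] obtain p where p: "\<forall>t\<in>{0..T}. case p t of (B, U, b) \<Rightarrow> sqg_rep B U b \<and> (AE x in lborel. \<theta> t x = B x) \<and> (\<forall>j. AE x in lborel. u t x $ j = U j x) \<and>
    B \<in> borel_measurable borel \<and> (\<forall>j. (\<lambda>x. u t x $ j) \<in> borel_measurable lebesgue)" ..
  define B U b where "B t = fst (p t)" and "U t = fst (snd (p t))" and "b t = snd (snd (p t))" for t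
  have rep: "sqg_rep (B t) (U t) (b t)" and B: "AE x in lborel. \<theta> t x = B t x" and U: "AE x in lborel. u t x $ j = U t j x"
    and m: "B t \<in> borel_measurable borel" "(\<lambda>x. u t x $ j) \<in> borel_measurable lebesgue" if "t \<in> {0..T}" for t j
    using p that by (auto simp: B_def U_def b_def case_prod_unfold)
  show ?thesis
  proof (rule that[OF rep B])
    show "L2_continuous_on {0..T} B"
      by (rule L2_continuous_on_of_continuous_L2[OF c m(1) B])
    fix t assume t: "t \<in> {0..T}"
    have d: "divergence (heat_semigroup (t - s) (\<lambda>y. \<theta> s y *\<^sub>R u s y)) x = div_heat (t - s) (\<lambda>j x. B s x * U s j x) x"
      if s: "s \<in> {0..<t}" for s x
    proof (rule divergence_heat_semigroup)
      have sT: "s \<in> {0..T}" using s t by auto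
      show "t - s > 0" using s by simp
      show "(\<lambda>x. (\<theta> s x *\<^sub>R u s x) $ j) \<in> borel_measurable lebesgue" for j
        using L2[OF sT] m(2)[OF sT, of j] by (auto simp: L2_def)
      show "AE x in lborel. (\<theta> s x *\<^sub>R u s x) $ j = B s x * U s j x" for j
        using B[OF sT] U[OF sT, of j] by eventually_elim simp
      show "integrable lborel (\<lambda>x. B s x * U s j x)" for j
        by (rule sqg_repD(4)[OF rep[OF sT]])
    qed
    have e: "set_integrable lebesgue {0..<t} (\<lambda>s. divergence (heat_semigroup (t - s) (\<lambda>y. \<theta> s y *\<^sub>R u s y)) x) =
        set_integrable lebesgue {0..<t} (\<lambda>s. div_heat (t - s) (\<lambda>j x. B s x * U s j x) x)"
      "(LINT s:{0..<t}|lebesgue. divergence (heat_semigroup (t - s) (\<lambda>y. \<theta> s y *\<^sub>R u s y)) x) =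
        (LINT s:{0..<t}|lebesgue. div_heat (t - s) (\<lambda>j x. B s x * U s j x) x)" for x
      unfolding set_integrable_def set_lebesgue_integral_def
      by (intro Bochner_Integration.integrable_cong Bochner_Integration.integral_cong refl; use d in \<open>auto simp: indicator_def\<close>)+
    have "AE x in lborel. set_integrable lebesgue {0..<t}
             (\<lambda>s. divergence (heat_semigroup (t - s) (\<lambda>y. \<theta> s y *\<^sub>R u s y)) x) \<and>
           \<theta> t x = heat_semigroup t \<theta>\<^sub>0 x -
             (LINT s:{0..<t}|lebesgue. divergence (heat_semigroup (t - s) (\<lambda>y. \<theta> s y *\<^sub>R u s y)) x)"
      using mild[OF t] unfolding AE_completion_iff .
    with B[OF t] show "AE x in lborel. set_integrable lebesgue {0..<t} (\<lambda>s. div_heat (t - s) (\<lambda>j x. B s x * U s j x) x) \<and>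
       B t x = heat_semigroup t \<theta>\<^sub>0 x - (LINT s:{0..<t}|lebesgue. div_heat (t - s) (\<lambda>j x. B s x * U s j x) x)"
      by eventually_elim (simp add: e)
  qed
qed

lemma heat_semigroup_cong_AE:
  fixes f g :: "real^2 \<Rightarrow> real"
  assumes "L2 f" "L2 g" "AE x in lebesgue. f x = g x" "t \<noteq> 0"
  shows "heat_semigroup t f x = heat_semigroup t g x"
proof -
  have [measurable]: "f \<in> borel_measurable lebesgue" "g \<in> borel_measurable lebesgue"
    using assms by (auto simp: L2_def)
  have [measurable]: "(\<lambda>y. heat_kernel t (x - y)) \<in> borel_measurable lebesgue"
    by (rule measurable_lebesgue_of_borel) measurable
  have "(\<integral>y. heat_kernel t (x - y) *\<^sub>R f y \<partial>lebesgue) = (\<integral>y. heat_kernel t (x - y) *\<^sub>R g y \<partial>lebesgue)"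
  proof (rule integral_cong_AE)
    show "AE y in lebesgue. heat_kernel t (x - y) *\<^sub>R f y = heat_kernel t (x - y) *\<^sub>R g y"
      using assms(3) by eventually_elim simp
  qed measurable
  then show ?thesis using assms(4) by (simp add: heat_semigroup_def)
qed

text \<open>At time 0 the time integral extends over the empty set.\<close>

lemma mild_solution_initial:
  assumes "mild_solution T \<theta>\<^sub>0 \<theta>" "T > 0"
  shows "AE x in lebesgue. \<theta> 0 x = \<theta>\<^sub>0 x"
proof -
  have "(LINT s:{0..<0::real}|lebesgue. f s) = 0" for f :: "real \<Rightarrow> real"
    by (simp add: set_lebesgue_integral_def)
  moreover obtain u where "\<forall>t\<in>{0..T}. AE x in lebesgue.
           set_integrable lebesgue {0..<t}
             (\<lambda>s. divergence (heat_semigroup (t - s) (\<lambda>y. \<theta> s y *\<^sub>R u s y)) x) \<and>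
           \<theta> t x = heat_semigroup t \<theta>\<^sub>0 x -
             (LINT s:{0..<t}|lebesgue. divergence (heat_semigroup (t - s) (\<lambda>y. \<theta> s y *\<^sub>R u s y)) x)"
    using assms(1) unfolding mild_solution_def by blast
  from bspec[OF this, of 0] assms(2) calculation show ?thesis
    by (auto simp: heat_semigroup_def elim: eventually_mono)
qed

section \<open>Young's inequality in time\<close>

lemma nn_integral_exp_decay:
  assumes a: "a > 0"
  shows "(\<integral>\<^sup>+r. ennreal (exp (- a * r)) * indicator {0..} r \<partial>lborel) = ennreal (1 / a)"
proof -
  have "(\<integral>\<^sup>+r. ennreal (exp (- a * r)) * indicator {0..} r \<partial>lborel) = ennreal (0 - (- exp (- a * 0) / a))"
  proof (rule nn_integral_FTC_atLeast)
    show "((\<lambda>r. - exp (- a * r) / a) has_real_derivative exp (- a * r)) (at r)" for r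
      using a by (auto intro!: derivative_eq_intros)
    have "filterlim (\<lambda>r. a * r) at_top at_top"
      by (rule filterlim_tendsto_pos_mult_at_top[OF tendsto_const a filterlim_ident])
    then have "filterlim (\<lambda>r. - (a * r)) at_bot at_top"
      by (simp add: filterlim_uminus_at_top)
    from filterlim_compose[OF exp_at_bot this]
    have "((\<lambda>r. exp (- (a * r)) * (- 1 / a)) \<longlongrightarrow> 0 * (- 1 / a)) at_top"
      by (intro tendsto_mult tendsto_const)
    then show "((\<lambda>r. - exp (- a * r) / a) \<longlongrightarrow> 0) at_top" by simp
  qed auto
  then show ?thesis by simp
qed

definition decay_kernel :: "real \<Rightarrow> real \<Rightarrow> ennreal" where
  "decay_kernel a r = ennreal (exp (- a * r)) * indicator {0..} r"

lemma decay_kernel_measurable [measurable]: "(\<lambda>p. decay_kernel (fst p) (snd p)) \<in> borel_measurable borel"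
  "decay_kernel a \<in> borel_measurable borel"
proof -
  have [measurable]: "(\<lambda>p. indicator {0..} (snd p) :: ennreal) \<in> borel_measurable (borel :: (real \<times> real) measure)"
    by (rule measurable_compose[OF borel_measurable_continuous_onI]) (auto intro: continuous_intros)
  have [measurable]: "(\<lambda>p. exp (- fst p * snd p)) \<in> borel_measurable (borel :: (real \<times> real) measure)"
    by (intro borel_measurable_continuous_onI continuous_intros)
  show "(\<lambda>p. decay_kernel (fst p) (snd p)) \<in> borel_measurable borel"
    unfolding decay_kernel_def by measurable
  show "decay_kernel a \<in> borel_measurable borel"
    unfolding decay_kernel_def by measurable
qed

text \<open>Convolution with the decay kernel, whose integral is \<open>1 / a\<close>. The Cauchy-Schwarz inequality splits the
  kernel into two equal factors \<open>q\<close>.\<close>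

lemma young_in_time:
  fixes n :: "real \<Rightarrow> ennreal"
  assumes [measurable]: "n \<in> borel_measurable borel" and a: "a > 0"
  shows "(\<integral>\<^sup>+t. (\<integral>\<^sup>+s. decay_kernel a (t - s) * n s \<partial>lborel)\<^sup>2 \<partial>lborel) \<le> ennreal (1 / a\<^sup>2) * (\<integral>\<^sup>+s. (n s)\<^sup>2 \<partial>lborel)"
proof -
  let ?k = "decay_kernel a"
  define q where "q r = ennreal (exp (- (a / 2) * r)) * indicator {0..} r" for r :: real
  have [measurable]: "q \<in> borel_measurable borel" unfolding q_def by measurable
  have q2: "q r * q r = ?k r" for r
    by (auto simp: q_def decay_kernel_def indicator_def ennreal_mult'[symmetric] exp_add[symmetric])
  have k1: "(\<integral>\<^sup>+r. ?k r \<partial>lborel) = ennreal (1 / a)"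
    unfolding decay_kernel_def by (rule nn_integral_exp_decay[OF a])
  have "(\<integral>\<^sup>+s. ?k (t - s) * n s \<partial>lborel)\<^sup>2 \<le> ennreal (1 / a) * (\<integral>\<^sup>+s. ?k (t - s) * (n s)\<^sup>2 \<partial>lborel)" for t
  proof -
    have "(\<integral>\<^sup>+s. ?k (t - s) * n s \<partial>lborel) = (\<integral>\<^sup>+s. q (t - s) * (q (t - s) * n s) \<partial>lborel)"
      by (simp add: q2[symmetric] mult_ac)
    also have "\<dots>\<^sup>2 \<le> (\<integral>\<^sup>+s. (q (t - s))\<^sup>2 \<partial>lborel) * (\<integral>\<^sup>+s. (q (t - s) * n s)\<^sup>2 \<partial>lborel)"
      by (rule Cauchy_Schwarz_nn_integral) measurable
    also have "(\<integral>\<^sup>+s. (q (t - s))\<^sup>2 \<partial>lborel) = ennreal (1 / a)"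
      unfolding power2_eq_square q2 using nn_integral_lborel_reflect[of ?k t] k1 by simp
    also have "(\<integral>\<^sup>+s. (q (t - s) * n s)\<^sup>2 \<partial>lborel) = (\<integral>\<^sup>+s. ?k (t - s) * (n s)\<^sup>2 \<partial>lborel)"
      by (simp add: q2[symmetric] power2_eq_square mult_ac)
    finally show ?thesis .
  qed
  then have "(\<integral>\<^sup>+t. (\<integral>\<^sup>+s. ?k (t - s) * n s \<partial>lborel)\<^sup>2 \<partial>lborel) \<le> (\<integral>\<^sup>+t. ennreal (1 / a) * (\<integral>\<^sup>+s. ?k (t - s) * (n s)\<^sup>2 \<partial>lborel) \<partial>lborel)"
    by (intro nn_integral_mono)
  also have "\<dots> = ennreal (1 / a) * (\<integral>\<^sup>+t. (\<integral>\<^sup>+s. ?k (t - s) * (n s)\<^sup>2 \<partial>lborel) \<partial>lborel)"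
    by (rule nn_integral_cmult) measurable
  also have "(\<integral>\<^sup>+t. (\<integral>\<^sup>+s. ?k (t - s) * (n s)\<^sup>2 \<partial>lborel) \<partial>lborel) = (\<integral>\<^sup>+s. (\<integral>\<^sup>+t. ?k (t - s) * (n s)\<^sup>2 \<partial>lborel) \<partial>lborel)"
    by (rule lborel_pair.Fubini') measurable
  also have "\<dots> = (\<integral>\<^sup>+s. ennreal (1 / a) * (n s)\<^sup>2 \<partial>lborel)"
    using nn_integral_lborel_shift[of ?k] k1 by (simp add: nn_integral_multc)
  also have "\<dots> = ennreal (1 / a) * (\<integral>\<^sup>+s. (n s)\<^sup>2 \<partial>lborel)"
    by (rule nn_integral_cmult) measurable
  finally show ?thesis
    using a by (simp add: mult.assoc[symmetric] ennreal_mult[symmetric] power2_eq_square)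
qed

section \<open>Uniqueness\<close>

lemma flux_hat_diff:
  assumes "\<And>j. integrable lborel (\<lambda>x. B x * U j x)" "\<And>j. integrable lborel (\<lambda>x. B' x * U' j x)"
  shows "flux_hat B U \<xi> - flux_hat B' U' \<xi> =
    (\<Sum>j\<in>UNIV. complex_of_real (\<xi> $ j) * FT (\<lambda>x. complex_of_real (B x * U j x - B' x * U' j x)) \<xi>)"
  unfolding flux_hat_def sum_subtractf[symmetric] right_diff_distrib[symmetric] of_real_diff
  using assms by (subst FT_diff) (auto simp: integrable_of_real_iff simp del: of_real_mult)

text \<open>The constant of \<open>damped_max_form_L2\<close> is \<open>1 / (32 * pi\<^sup>3) \<le> 1\<close>. With the tail at most \<open>1 / 16\<close> and \<open>l\<close>
  large, both summands there are at most \<open>1 / 4\<close>.\<close>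

lemma contraction_step:
  assumes rep: "sqg_rep B U b" and rep': "sqg_rep B' U' b'" and l: "l > 0"
    and tail: "sq_norm (\<lambda>x. truncate_ball N (\<lambda>x. b x + b' x) x - (b x + b' x)) \<le> 1 / 16"
    and M: "sq_norm (\<lambda>x. b x + b' x) \<le> M" and lM: "(real N)\<^sup>2 * M \<le> l / 4"
  shows "(\<integral>\<^sup>+\<xi>. (ennreal (norm (flux_hat B U \<xi> - flux_hat B' U' \<xi>) / (l + (norm \<xi>)\<^sup>2)))\<^sup>2 \<partial>lborel)
    \<le> ennreal (1 / 2) * ennreal (sq_norm (\<lambda>x. b x - b' x))"
proof -
  note sb = sqg_repD(3)[OF rep] sqg_repD(3)[OF rep']
  have [measurable]: "b \<in> borel_measurable borel" "b' \<in> borel_measurable borel" using sb by measurable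
  let ?N = "\<lambda>\<xi>. flux_hat B U \<xi> - flux_hat B' U' \<xi>"
  let ?m = "\<lambda>\<xi>. ennreal (norm (?N \<xi>) / (l + (norm \<xi>)\<^sup>2))"
  let ?h = "\<lambda>x. ennreal (norm (b x - b' x))" and ?g = "\<lambda>x. norm (b x + b' x)"
  have i: "integrable lborel (\<lambda>x. B x * U j x)" "integrable lborel (\<lambda>x. B' x * U' j x)" for j
    using sqg_repD(4)[OF rep] sqg_repD(4)[OF rep'] by auto
  have ic: "integrable lborel (\<lambda>x. complex_of_real (B x * U j x - B' x * U' j x))" for j
    using i[of j] unfolding integrable_of_real_iff by (rule Bochner_Integration.integrable_diff)
  have Nm[measurable]: "?N \<in> borel_measurable borel"
    unfolding flux_hat_diff[OF i] using ic by measurable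
  have p: "l + (norm \<xi>)\<^sup>2 > 0" for \<xi> :: "real^2" using l by (simp add: add_pos_nonneg)
  have H: "(\<integral>\<^sup>+x. (?h x)\<^sup>2 \<partial>lborel) = ennreal (sq_norm (\<lambda>x. b x - b' x))"
    using nn_integral_eq_sq_norm[OF square_integrable_diff[OF sb]] by (simp add: ennreal_power)
  have G: "(\<integral>\<^sup>+x. (ennreal (?g x))\<^sup>2 \<partial>lborel) \<le> ennreal M"
    using nn_integral_eq_sq_norm[OF square_integrable_add[OF sb]] M by (simp add: ennreal_power ennreal_leI)
  have sa: "square_integrable (\<lambda>x. truncate_ball N (\<lambda>x. b x + b' x) x - (b x + b' x))"
    by (intro square_integrable_diff square_integrable_truncate_ball square_integrable_add sb)
  have G1: "(\<integral>\<^sup>+x. (ennreal (?g x * indicator (- cball 0 (real N)) x))\<^sup>2 \<partial>lborel) \<le> ennreal (1 / 16)"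
  proof -
    have "(\<integral>\<^sup>+x. (ennreal (?g x * indicator (- cball 0 (real N)) x))\<^sup>2 \<partial>lborel) =
       (\<integral>\<^sup>+x. ennreal ((norm (truncate_ball N (\<lambda>x. b x + b' x) x - (b x + b' x)))\<^sup>2) \<partial>lborel)"
      by (intro nn_integral_cong) (auto simp: truncate_ball_def indicator_def ennreal_power norm_minus_commute)
    also have "\<dots> \<le> ennreal (1 / 16)"
      unfolding nn_integral_eq_sq_norm[OF sa] using tail by (rule ennreal_leI)
    finally show ?thesis .
  qed
  have "(\<integral>\<^sup>+\<xi>. (?m \<xi>)\<^sup>2 \<partial>lborel) \<le> ennreal (2 * pi * (1 / (8 * pi\<^sup>2))\<^sup>2) *
     ((4 * (\<integral>\<^sup>+x. (ennreal (?g x * indicator (- cball 0 (real N)) x))\<^sup>2 \<partial>lborel) + ennreal ((real N)\<^sup>2 / l) * (\<integral>\<^sup>+x. (ennreal (?g x))\<^sup>2 \<partial>lborel))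
      * (\<integral>\<^sup>+x. (?h x)\<^sup>2 \<partial>lborel))"
  proof (rule damped_max_form_L2)
    show "?m \<xi> \<le> ennreal (1 / (8 * pi\<^sup>2)) * (ennreal ((norm \<xi>)\<^sup>2 / (l + (norm \<xi>)\<^sup>2)) * max_form ?h (\<lambda>x. ennreal (?g x)) \<xi>)" for \<xi>
    proof -
      have "?m \<xi> = ennreal (1 / (l + (norm \<xi>)\<^sup>2)) * ennreal (norm (?N \<xi>))"
        using p[of \<xi>] by (subst ennreal_mult[symmetric]) auto
      also have "\<dots> \<le> ennreal (1 / (l + (norm \<xi>)\<^sup>2)) * (ennreal (1 / (8 * pi\<^sup>2)) * (ennreal ((norm \<xi>)\<^sup>2) * max_form ?h (\<lambda>x. ennreal (?g x)) \<xi>))"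
        by (intro mult_left_mono norm_flux_hat_diff_le[OF rep rep']) simp
      also have "\<dots> = ennreal (1 / (8 * pi\<^sup>2)) * ((ennreal (1 / (l + (norm \<xi>)\<^sup>2)) * ennreal ((norm \<xi>)\<^sup>2)) * max_form ?h (\<lambda>x. ennreal (?g x)) \<xi>)"
        by (simp only: mult_ac)
      also have "ennreal (1 / (l + (norm \<xi>)\<^sup>2)) * ennreal ((norm \<xi>)\<^sup>2) = ennreal ((norm \<xi>)\<^sup>2 / (l + (norm \<xi>)\<^sup>2))"
        using p[of \<xi>] by (subst ennreal_mult[symmetric]) auto
      finally show ?thesis .
    qed
    fix n :: nat
    \<comment> \<open>The transform of an \<open>L\<^sup>1\<close> flux is bounded, so that \<open>?m\<close> is bounded on balls.\<close>
    define C where "C = (\<Sum>j\<in>UNIV. \<integral>x. norm (complex_of_real (B x * U j x - B' x * U' j x)) \<partial>lborel)"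
    have C0: "C \<ge> 0" by (simp add: C_def sum_nonneg)
    have le: "?m \<xi> * indicator (cball 0 (real n)) \<xi> \<le> ennreal (real n * C / l) * indicator (cball 0 (real n)) \<xi>" for \<xi>
    proof (cases "\<xi> \<in> cball 0 (real n)")
      case True
      have "norm (?N \<xi>) \<le> (\<Sum>j\<in>UNIV. norm (complex_of_real (\<xi> $ j) * FT (\<lambda>x. complex_of_real (B x * U j x - B' x * U' j x)) \<xi>))"
        unfolding flux_hat_diff[OF i] by (rule norm_sum)
      also have "\<dots> \<le> (\<Sum>j\<in>UNIV. real n * (\<integral>x. norm (complex_of_real (B x * U j x - B' x * U' j x)) \<partial>lborel))"
      proof (rule sum_mono)
        fix j
        have "\<bar>\<xi> $ j\<bar> \<le> real n" using True component_le_norm_cart[of \<xi> j] by simp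
        then show "norm (complex_of_real (\<xi> $ j) * FT (\<lambda>x. complex_of_real (B x * U j x - B' x * U' j x)) \<xi>)
            \<le> real n * (\<integral>x. norm (complex_of_real (B x * U j x - B' x * U' j x)) \<partial>lborel)"
          unfolding norm_mult norm_of_real[of "\<xi> $ j"] by (intro mult_mono norm_FT_le[OF ic]) auto
      qed
      also have "\<dots> = real n * C" unfolding C_def by (rule sum_distrib_left[symmetric])
      finally have "norm (?N \<xi>) / (l + (norm \<xi>)\<^sup>2) \<le> real n * C / l"
        using l C0 by (intro frac_le) auto
      then show ?thesis using True by (simp add: ennreal_leI)
    qed simp
    have "(\<integral>\<^sup>+\<xi>. (?m \<xi> * indicator (cball 0 (real n)) \<xi>)\<^sup>2 \<partial>lborel) \<le> (\<integral>\<^sup>+\<xi>. (ennreal (real n * C / l))\<^sup>2 * indicator (cball 0 (real n)) (\<xi> :: real^2) \<partial>lborel)"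
    proof (rule nn_integral_mono)
      fix \<xi> :: "real^2"
      show "(?m \<xi> * indicator (cball 0 (real n)) \<xi>)\<^sup>2 \<le> (ennreal (real n * C / l))\<^sup>2 * indicator (cball 0 (real n)) \<xi>"
        using power_mono[OF le[of \<xi>], of 2] by (cases "\<xi> \<in> cball 0 (real n)") simp_all
    qed
    also have "\<dots> = (ennreal (real n * C / l))\<^sup>2 * emeasure lborel (cball (0::real^2) (real n))"
      by (rule nn_integral_cmult_indicator) simp
    also have "\<dots> < \<infinity>"
      by (simp add: emeasure_cball_real2 ennreal_mult_less_top power_less_top_ennreal)
    finally show "(\<integral>\<^sup>+\<xi>. (?m \<xi> * indicator (cball 0 (real n)) \<xi>)\<^sup>2 \<partial>lborel) < \<infinity>" .
  qed (use l in \<open>auto | measurable\<close>)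
  also have "\<dots> \<le> 1 * ((4 * ennreal (1 / 16) + ennreal ((real N)\<^sup>2 / l) * ennreal M) * ennreal (sq_norm (\<lambda>x. b x - b' x)))"
    unfolding H
  proof (intro mult_mono add_mono G G1 order_refl)
    have "1 \<le> pi\<^sup>2 * pi" using pi_gt3 by (intro order_trans[OF _ mult_mono[of 1 "pi\<^sup>2" 1 pi]]) (auto simp: one_le_power)
    then have "2 * pi * (1 / (8 * pi\<^sup>2))\<^sup>2 \<le> 1"
      using pi_gt_zero by (simp add: power2_eq_square field_simps)
    then show "ennreal (2 * pi * (1 / (8 * pi\<^sup>2))\<^sup>2) \<le> 1"
      using ennreal_leI by fastforce
  qed auto
  also have "\<dots> \<le> ennreal (1 / 2) * ennreal (sq_norm (\<lambda>x. b x - b' x))"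
  proof -
    have "0 \<le> M" using M sq_norm_nonneg[of "\<lambda>x. b x + b' x"] by linarith
    moreover have "4 * ennreal (1 / 16) = ennreal (1 / 4)"
      using ennreal_mult[of 4 "1 / 16"] by simp
    ultimately have "4 * ennreal (1 / 16) + ennreal ((real N)\<^sup>2 / l) * ennreal M = ennreal (1 / 4 + (real N)\<^sup>2 / l * M)"
      using l by (simp add: ennreal_mult[symmetric] ennreal_plus[symmetric] del: ennreal_plus)
    also have "\<dots> \<le> ennreal (1 / 2)"
      using l lM by (intro ennreal_leI) (simp add: field_simps)
    finally show ?thesis by (simp add: mult_right_mono)
  qed
  finally show ?thesis .
qed

lemma norm_integral_le_nn_integral:
  "ennreal (norm (integral\<^sup>L M f)) \<le> (\<integral>\<^sup>+x. ennreal (norm (f x)) \<partial>M)"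
  by (cases "integrable M f") (auto simp: not_integrable_integral_eq intro: integral_norm_bound_ennreal)

theorem theorem1p2:
  fixes T :: real
    and \<theta> \<theta>' :: "real \<Rightarrow> real^2 \<Rightarrow> real"
    and \<theta>\<^sub>0 \<theta>\<^sub>0' :: "real^2 \<Rightarrow> real"
  assumes "T > 0"
    and "mild_solution T \<theta>\<^sub>0 \<theta>"
    and "mild_solution T \<theta>\<^sub>0' \<theta>'"
    and "AE x in lebesgue. \<theta> 0 x = \<theta>' 0 x"
  shows "\<forall>t\<in>{0..T}. AE x in lebesgue. \<theta> t x = \<theta>' t x"
proof
  fix t\<^sub>1 assume t\<^sub>1: "t\<^sub>1 \<in> {0..T}"
  obtain B U b where rep: "\<And>t. t \<in> {0..T} \<Longrightarrow> sqg_rep (B t) (U t) (b t)"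
    and B: "\<And>t. t \<in> {0..T} \<Longrightarrow> AE x in lborel. \<theta> t x = B t x" and Bc: "L2_continuous_on {0..T} B"
    and mild: "\<And>t. t \<in> {0..T} \<Longrightarrow> AE x in lborel. set_integrable lebesgue {0..<t} (\<lambda>s. div_heat (t - s) (\<lambda>j x. B s x * U s j x) x) \<and>
       B t x = heat_semigroup t \<theta>\<^sub>0 x - (LINT s:{0..<t}|lebesgue. div_heat (t - s) (\<lambda>j x. B s x * U s j x) x)"
    by (rule mild_solution_rep[OF assms(2)]) blast
  obtain B' U' b' where rep': "\<And>t. t \<in> {0..T} \<Longrightarrow> sqg_rep (B' t) (U' t) (b' t)"
    and B': "\<And>t. t \<in> {0..T} \<Longrightarrow> AE x in lborel. \<theta>' t x = B' t x" and Bc': "L2_continuous_on {0..T} B'"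
    and mild': "\<And>t. t \<in> {0..T} \<Longrightarrow> AE x in lborel. set_integrable lebesgue {0..<t} (\<lambda>s. div_heat (t - s) (\<lambda>j x. B' s x * U' s j x) x) \<and>
       B' t x = heat_semigroup t \<theta>\<^sub>0' x - (LINT s:{0..<t}|lebesgue. div_heat (t - s) (\<lambda>j x. B' s x * U' s j x) x)"
    by (rule mild_solution_rep[OF assms(3)]) blast
  \<comment> \<open>The difference of the fluxes, its transform contracted with \<open>\<xi>\<close>, the difference of the
    solutions, and its transform.\<close>
  define H where "H s j x = B s x * U s j x - B' s x * U' s j x" for s j x
  define N where "N s \<xi> = (\<Sum>j\<in>UNIV. complex_of_real (\<xi> $ j) * FT (\<lambda>x. complex_of_real (H s j x)) \<xi>)" for s \<xi>
  define w where "w t x = B t x - B' t x" for t x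
  define W where "W t = FT (\<lambda>x. complex_of_real (w t x))" for t
  have int: "integrable lborel (\<lambda>x. B s x * U s j x)" "integrable lborel (\<lambda>x. B' s x * U' s j x)" if "s \<in> {0..T}" for s j
    using sqg_repD(4)[OF rep[OF that]] sqg_repD(4)[OF rep'[OF that]] by auto
  have HL: "L1_continuous_on {0..T} (\<lambda>s. H s j)" for j
    unfolding H_def[abs_def]
    by (intro L1_continuous_on_diff L1_continuous_on_mult Bc Bc' sqg_rep_continuous(1)[OF rep Bc] sqg_rep_continuous(1)[OF rep' Bc'])
  have N_flux: "flux_hat (B s) (U s) \<xi> - flux_hat (B' s) (U' s) \<xi> = N s \<xi>" if "s \<in> {0..T}" for s \<xi>
    unfolding N_def H_def by (rule flux_hat_diff[OF int(1)[OF that] int(2)[OF that]])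
  have wm[measurable]: "w t \<in> borel_measurable borel" if "t \<in> {0..T}" for t
    using sqg_repD(1)[OF rep[OF that]] sqg_repD(1)[OF rep'[OF that]] unfolding w_def[abs_def] by measurable
  have \<theta>0: "AE x in lebesgue. \<theta>\<^sub>0 x = \<theta>\<^sub>0' x"
    using mild_solution_initial[OF assms(2,1)] mild_solution_initial[OF assms(3,1)] assms(4) by eventually_elim simp
  have duh: "AE x in lborel. w t x = - (LINT s:{0..<t}|lebesgue. div_heat (t - s) (H s) x)" if t: "t \<in> {0..T}" for t
  proof -
    have h: "AE x in lborel. heat_semigroup t \<theta>\<^sub>0 x = heat_semigroup t \<theta>\<^sub>0' x"
    proof (cases "t = 0")
      case True
      then show ?thesis using \<theta>0 unfolding AE_completion_iff by (simp add: heat_semigroup_def)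
    next
      case False
      have "L2 \<theta>\<^sub>0" "L2 \<theta>\<^sub>0'" using assms(2,3) by (simp_all add: mild_solution_def)
      from heat_semigroup_cong_AE[OF this \<theta>0 False] show ?thesis by simp
    qed
    from mild[OF t] mild'[OF t] h show ?thesis
    proof eventually_elim
      case (elim x)
      let ?f = "\<lambda>s. div_heat (t - s) (\<lambda>j x. B s x * U s j x) x" and ?g = "\<lambda>s. div_heat (t - s) (\<lambda>j x. B' s x * U' s j x) x"
      have "(LINT s:{0..<t}|lebesgue. div_heat (t - s) (H s) x) = (LINT s:{0..<t}|lebesgue. ?f s - ?g s)"
      proof (rule set_lebesgue_integral_cong)
        show "\<forall>s. s \<in> {0..<t} \<longrightarrow> div_heat (t - s) (H s) x = ?f s - ?g s"
        proof (intro allI impI)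
          fix s assume s: "s \<in> {0..<t}"
          then have "s \<in> {0..T}" using t by auto
          then show "div_heat (t - s) (H s) x = ?f s - ?g s"
            unfolding H_def[abs_def] using s by (intro div_heat_diff int) auto
        qed
      qed simp
      also have "\<dots> = (LINT s:{0..<t}|lebesgue. ?f s) - (LINT s:{0..<t}|lebesgue. ?g s)"
        by (rule set_integral_diff(2)) (use elim in auto)
      finally show ?case using elim by (simp add: w_def)
    qed
  qed
  note duhamel = duhamel_fourier[OF HL _ wm duh]
  have Wb: "AE \<xi> in lborel. b t \<xi> - b' t \<xi> = W t \<xi>" if t: "t \<in> {0..T}" for t
  proof -
    have "L2_fourier (\<lambda>x. complex_of_real (w t x)) (\<lambda>\<xi>. b t \<xi> - b' t \<xi>)"
      using L2_fourier_diff[of "\<lambda>x. complex_of_real (B t x)" "b t" "\<lambda>x. complex_of_real (B' t x)" "b' t"] rep[OF t] rep'[OF t]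
      by (simp add: sqg_rep_def w_def)
    moreover have "integrable lborel (\<lambda>x. complex_of_real (w t x))"
      using duhamel(1)[OF t t t] by simp
    ultimately show ?thesis unfolding W_def by (rule L2_fourier_unique)
  qed
  have bc: "L2_continuous_on {0..T} b" "L2_continuous_on {0..T} b'"
    using sqg_rep_continuous(2)[OF rep Bc] sqg_rep_continuous(2)[OF rep' Bc'] by auto
  have Gc: "L2_continuous_on {0..T} (\<lambda>s x. b s x + b' s x)"
    by (rule L2_continuous_on_add[OF bc])
  \<comment> \<open>Radius and damping that make \<open>contraction_step\<close> available at all times simultaneously.\<close>
  obtain K where tail: "\<And>s. s \<in> {0..T} \<Longrightarrow> sq_norm (\<lambda>x. truncate_ball K (\<lambda>x. b s x + b' s x) x - (b s x + b' s x)) \<le> 1 / 16"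
    by (rule L2_continuous_uniform_tail[OF Gc compact_Icc, of "1 / 16"]) auto
  obtain M where M: "\<And>s. s \<in> {0..T} \<Longrightarrow> sq_norm (\<lambda>x. b s x + b' s x) \<le> M"
    by (rule L2_continuous_bounded[OF Gc compact_Icc]) blast
  obtain M1 where M1: "\<And>s. s \<in> {0..T} \<Longrightarrow> sq_norm (b s) \<le> M1"
    by (rule L2_continuous_bounded[OF bc(1) compact_Icc]) blast
  obtain M2 where M2: "\<And>s. s \<in> {0..T} \<Longrightarrow> sq_norm (b' s) \<le> M2"
    by (rule L2_continuous_bounded[OF bc(2) compact_Icc]) blast
  define l where "l = 4 * (real K)\<^sup>2 * \<bar>M\<bar> + 1"
  have l: "l > 0" by (simp add: l_def add_nonneg_pos)
  have lM: "(real K)\<^sup>2 * M \<le> l / 4"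
    using mult_left_mono[OF abs_ge_self[of M], of "(real K)\<^sup>2"] by (simp add: l_def)
  define a where "a \<xi> = l + (norm \<xi>)\<^sup>2" for \<xi> :: "real^2"
  have a: "a \<xi> > 0" for \<xi> using l by (simp add: a_def add_pos_nonneg)
  have am[measurable]: "a \<in> borel_measurable borel" unfolding a_def[abs_def] by measurable
  \<comment> \<open>The weighted source \<open>n\<close> and the majorant \<open>V\<close> of the weighted solution. Unlike the transforms \<open>b\<close>
    and \<open>b'\<close>, which are chosen separately at each time, both are certainly jointly measurable.\<close>
  define n where "n s \<xi> = indicator {0..T} s * ennreal (exp (- l * s) * norm (N s \<xi>))" for s \<xi>
  define V where "V t \<xi> = (\<integral>\<^sup>+s. decay_kernel (a \<xi>) (t - s) * n s \<xi> \<partial>lborel)" for t \<xi>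
  have contN: "continuous_on ({0..T} \<times> UNIV) (\<lambda>p. N (fst p) (snd p))"
  proof -
    have "continuous_on ({0..T} \<times> UNIV) (\<lambda>p. FT (\<lambda>x. complex_of_real (H (fst p) j x)) (snd p))" for j
      using continuous_on_FT[OF HL[of j]] by (simp add: case_prod_unfold)
    then show ?thesis unfolding N_def by (intro continuous_intros)
  qed
  have Nm[measurable]: "N s \<in> borel_measurable borel" if "s \<in> {0..T}" for s
  proof (rule borel_measurable_continuous_onI)
    have "continuous_on UNIV (\<lambda>\<xi>. N (fst (s, \<xi>)) (snd (s, \<xi>)))"
      by (rule continuous_on_compose2[OF contN]) (use that in \<open>auto intro!: continuous_intros\<close>)
    then show "continuous_on UNIV (N s)" by simp
  qed
  have n_m[measurable]: "(\<lambda>p. n (fst p) (snd p)) \<in> borel_measurable (lborel \<Otimes>\<^sub>M lborel)"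
  proof -
    have "continuous_on ({0..T} \<times> UNIV) (\<lambda>p. exp (- l * fst p) * norm (N (fst p) (snd p)))"
      by (intro continuous_intros contN)
    then have "(\<lambda>p. indicator ({0..T} \<times> UNIV) p *\<^sub>R (exp (- l * fst p) * norm (N (fst p) (snd p)))) \<in> borel_measurable borel"
      by (intro borel_measurable_continuous_on_indicator) (auto intro!: borel_Times)
    then have "(\<lambda>p. ennreal (indicator ({0..T} \<times> UNIV) p *\<^sub>R (exp (- l * fst p) * norm (N (fst p) (snd p))))) \<in> borel_measurable (lborel \<Otimes>\<^sub>M lborel)"
      unfolding lborel_prod by simp
    moreover have "(\<lambda>p. ennreal (indicator ({0..T} \<times> UNIV) p *\<^sub>R (exp (- l * fst p) * norm (N (fst p) (snd p))))) = (\<lambda>p. n (fst p) (snd p))"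
      by (auto simp: fun_eq_iff n_def indicator_def)
    ultimately show ?thesis by (simp only:)
  qed
  have n1[measurable]: "(\<lambda>s. n s \<xi>) \<in> borel_measurable borel" for \<xi>
    using measurable_Pair1[OF n_m, of \<xi>] by simp
  have n2[measurable]: "n s \<in> borel_measurable borel" for s
    using measurable_Pair2[OF n_m, of s] by simp
  have Vm[measurable]: "(\<lambda>p. V (fst p) (snd p)) \<in> borel_measurable (lborel \<Otimes>\<^sub>M lborel)"
  proof -
    have "(\<lambda>q. decay_kernel (a (snd (fst q))) (fst (fst q) - snd q)) \<in> borel_measurable ((lborel \<Otimes>\<^sub>M lborel) \<Otimes>\<^sub>M lborel)"
      by (rule measurable_compose[OF _ decay_kernel_measurable(1), of "\<lambda>q. (a (snd (fst q)), fst (fst q) - snd q)", simplified])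
        (simp add: borel_prod[symmetric])
    moreover have "(\<lambda>q. n (snd q) (snd (fst q))) \<in> borel_measurable ((lborel \<Otimes>\<^sub>M lborel) \<Otimes>\<^sub>M lborel)"
      by (rule measurable_compose[OF _ n_m, of "\<lambda>q. (snd q, snd (fst q))", simplified]) measurable
    ultimately have "(\<lambda>(p, s). decay_kernel (a (snd p)) (fst p - s) * n s (snd p)) \<in> borel_measurable ((lborel \<Otimes>\<^sub>M lborel) \<Otimes>\<^sub>M lborel)"
      unfolding case_prod_unfold by (rule borel_measurable_times_ennreal)
    then show ?thesis
      unfolding V_def by (rule lborel.borel_measurable_nn_integral)
  qed
  have n_swap[measurable]: "(\<lambda>p. n (snd p) (fst p)) \<in> borel_measurable (lborel \<Otimes>\<^sub>M lborel)"
    by (rule measurable_compose[OF _ n_m, of "\<lambda>p. (snd p, fst p)", simplified]) measurable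
  have nn_m[measurable]: "(\<lambda>\<xi>. \<integral>\<^sup>+s. (n s \<xi>)\<^sup>2 \<partial>lborel) \<in> borel_measurable lborel"
    by (rule lborel.borel_measurable_nn_integral) (use n_swap in \<open>simp add: case_prod_unfold\<close>)
  have WV: "ennreal (exp (- l * t) * norm (W t \<xi>)) \<le> V t \<xi>" if t: "t \<in> {0..T}" for t \<xi>
  proof -
    let ?F = "\<lambda>s. indicator {0..<t} s *\<^sub>R (\<i> * exp (- (t - s) * (norm \<xi>)\<^sup>2) * N s \<xi>)"
    have "norm (W t \<xi>) = norm (\<integral>s. ?F s \<partial>lborel)"
      unfolding W_def duhamel(2)[OF t t t] N_def by simp
    then have "ennreal (exp (- l * t) * norm (W t \<xi>)) = ennreal (exp (- l * t)) * ennreal (norm (\<integral>s. ?F s \<partial>lborel))"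
      by (simp only: ennreal_mult exp_ge_zero norm_ge_zero)
    also have "\<dots> \<le> ennreal (exp (- l * t)) * (\<integral>\<^sup>+s. ennreal (norm (?F s)) \<partial>lborel)"
      by (intro mult_left_mono norm_integral_le_nn_integral) simp
    also have "\<dots> = (\<integral>\<^sup>+s. ennreal (exp (- l * t)) * ennreal (norm (?F s)) \<partial>lborel)"
    proof (rule nn_integral_cmult[symmetric])
      have "continuous_on {0..<t} (\<lambda>s. N (fst (s, \<xi>)) (snd (s, \<xi>)))"
        by (rule continuous_on_compose2[OF contN]) (use t in \<open>auto intro!: continuous_intros\<close>)
      then have "continuous_on {0..<t} (\<lambda>s. N s \<xi>)" by simp
      then have "continuous_on {0..<t} (\<lambda>s. \<i> * exp (- (t - s) * (norm \<xi>)\<^sup>2) * N s \<xi>)"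
        by (intro continuous_intros)
      then have "?F \<in> borel_measurable borel"
        by (intro borel_measurable_continuous_on_indicator) auto
      then show "(\<lambda>s. ennreal (norm (?F s))) \<in> borel_measurable lborel"
        unfolding measurable_lborel1 measurable_lborel2 by (rule measurable_compose) measurable
    qed
    also have "\<dots> \<le> V t \<xi>"
      unfolding V_def
    proof (rule nn_integral_mono)
      fix s
      show "ennreal (exp (- l * t)) * ennreal (norm (?F s)) \<le> decay_kernel (a \<xi>) (t - s) * n s \<xi>"
      proof (cases "s \<in> {0..<t}")
        case True
        then have s: "s \<in> {0..T}" "0 \<le> t - s" using t by auto
        have "exp (- l * t) * exp (- (t - s) * (norm \<xi>)\<^sup>2) = exp (- a \<xi> * (t - s)) * exp (- l * s)"
          by (simp add: exp_add[symmetric] a_def algebra_simps)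
        then have "exp (- l * t) * norm (?F s) = exp (- a \<xi> * (t - s)) * (exp (- l * s) * norm (N s \<xi>))"
          using True by (simp add: norm_mult mult.assoc[symmetric])
        then show ?thesis
          using s by (simp add: decay_kernel_def n_def ennreal_mult[symmetric])
      qed simp
    qed
    finally show ?thesis .
  qed
  \<comment> \<open>\<open>\<Delta>\<close> is the weighted norm in time and frequency that turns out to be at most half of itself.\<close>
  define D where "D s = (\<integral>\<^sup>+\<xi>. (ennreal (norm (N s \<xi>) / a \<xi>))\<^sup>2 \<partial>lborel)" for s
  define \<Delta> where "\<Delta> = (\<integral>\<^sup>+\<xi>. ennreal (1 / (a \<xi>)\<^sup>2) * (\<integral>\<^sup>+s. (n s \<xi>)\<^sup>2 \<partial>lborel) \<partial>lborel)"
  have Dle: "D s \<le> ennreal (1 / 2) * ennreal (sq_norm (\<lambda>x. b s x - b' s x))" if s: "s \<in> {0..T}" for s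
    using contraction_step[OF rep[OF s] rep'[OF s] l tail[OF s] M[OF s] lM] unfolding N_flux[OF s] D_def a_def .
  have \<Delta>: "\<Delta> = (\<integral>\<^sup>+s. indicator {0..T} s * (ennreal ((exp (- l * s))\<^sup>2) * D s) \<partial>lborel)"
  proof -
    have "\<Delta> = (\<integral>\<^sup>+\<xi>. (\<integral>\<^sup>+s. ennreal (1 / (a \<xi>)\<^sup>2) * (n s \<xi>)\<^sup>2 \<partial>lborel) \<partial>lborel)"
      unfolding \<Delta>_def by (intro nn_integral_cong nn_integral_cmult[symmetric]) measurable
    also have "\<dots> = (\<integral>\<^sup>+s. (\<integral>\<^sup>+\<xi>. ennreal (1 / (a \<xi>)\<^sup>2) * (n s \<xi>)\<^sup>2 \<partial>lborel) \<partial>lborel)"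
    proof (rule lborel_pair.Fubini')
      have "(\<lambda>p. ennreal (1 / (a (snd p))\<^sup>2) * (n (fst p) (snd p))\<^sup>2) \<in> borel_measurable (lborel \<Otimes>\<^sub>M lborel)"
        by measurable
      then show "(\<lambda>(s, \<xi>). ennreal (1 / (a \<xi>)\<^sup>2) * (n s \<xi>)\<^sup>2) \<in> borel_measurable (lborel \<Otimes>\<^sub>M lborel)"
        by (simp add: case_prod_unfold)
    qed
    also have "\<dots> = (\<integral>\<^sup>+s. indicator {0..T} s * (ennreal ((exp (- l * s))\<^sup>2) * D s) \<partial>lborel)"
    proof (rule nn_integral_cong)
      fix s
      show "(\<integral>\<^sup>+\<xi>. ennreal (1 / (a \<xi>)\<^sup>2) * (n s \<xi>)\<^sup>2 \<partial>lborel) = indicator {0..T} s * (ennreal ((exp (- l * s))\<^sup>2) * D s)"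
      proof (cases "s \<in> {0..T}")
        case True
        have "ennreal (1 / (a \<xi>)\<^sup>2) * (n s \<xi>)\<^sup>2 = ennreal ((exp (- l * s))\<^sup>2) * (ennreal (norm (N s \<xi>) / a \<xi>))\<^sup>2" for \<xi>
          using True a[of \<xi>] unfolding n_def
          by (simp add: ennreal_power ennreal_mult[symmetric] power_mult_distrib power_divide)
        then show ?thesis
          using True Nm[OF True] unfolding D_def by (simp add: nn_integral_cmult)
      qed (simp add: n_def)
    qed
    finally show ?thesis .
  qed
  \<comment> \<open>Finite, because the solutions are bounded in \<open>L\<^sup>2\<close> on the compact time interval.\<close>
  have \<Delta>_fin: "\<Delta> < \<infinity>"
  proof -
    have "\<Delta> \<le> (\<integral>\<^sup>+s. ennreal (M1 + M2) * indicator {0..T} s \<partial>lborel)"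
      unfolding \<Delta>
    proof (rule nn_integral_mono)
      fix s
      show "indicator {0..T} s * (ennreal ((exp (- l * s))\<^sup>2) * D s) \<le> ennreal (M1 + M2) * indicator {0..T} s"
      proof (cases "s \<in> {0..T}")
        case True
        have "sq_norm (\<lambda>x. b s x - b' s x) \<le> 2 * (M1 + M2)"
          using sq_norm_diff_le[of "b s" "b' s"] L2_continuous_onD(1)[OF bc(1) True] L2_continuous_onD(1)[OF bc(2) True] M1[OF True] M2[OF True] by simp
        then have "ennreal (1 / 2) * ennreal (sq_norm (\<lambda>x. b s x - b' s x)) \<le> ennreal (M1 + M2)"
          by (subst ennreal_mult[symmetric]) (auto intro!: ennreal_leI)
        with Dle[OF True] have "D s \<le> ennreal (M1 + M2)" by (rule order_trans)
        moreover have "ennreal ((exp (- l * s))\<^sup>2) \<le> 1"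
          using True l by (auto simp: power_le_one)
        ultimately have "ennreal ((exp (- l * s))\<^sup>2) * D s \<le> 1 * ennreal (M1 + M2)"
          by (intro mult_mono) auto
        then show ?thesis using True by simp
      qed simp
    qed
    also have "\<dots> = ennreal (M1 + M2) * emeasure lborel {0..T}"
      by (rule nn_integral_cmult_indicator) simp
    also have "\<dots> < \<infinity>" using assms(1) by (simp add: ennreal_mult_less_top)
    finally show ?thesis .
  qed
  \<comment> \<open>Contraction in frequency at each time, and then Young's inequality in time at each frequency.\<close>
  have "\<Delta> \<le> (\<integral>\<^sup>+s. ennreal (1 / 2) * (\<integral>\<^sup>+\<xi>. (V s \<xi>)\<^sup>2 \<partial>lborel) \<partial>lborel)"
    unfolding \<Delta>
  proof (rule nn_integral_mono)
    fix s
    show "indicator {0..T} s * (ennreal ((exp (- l * s))\<^sup>2) * D s) \<le> ennreal (1 / 2) * (\<integral>\<^sup>+\<xi>. (V s \<xi>)\<^sup>2 \<partial>lborel)"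
    proof (cases "s \<in> {0..T}")
      case True
      have Wm: "W s \<in> borel_measurable borel" unfolding W_def using wm[OF True] by measurable
      have sq: "square_integrable (\<lambda>x. b s x - b' s x)"
        by (intro square_integrable_diff L2_continuous_onD(1)[OF bc(1) True] L2_continuous_onD(1)[OF bc(2) True])
      have "ennreal (sq_norm (\<lambda>x. b s x - b' s x)) = (\<integral>\<^sup>+\<xi>. ennreal ((norm (W s \<xi>))\<^sup>2) \<partial>lborel)"
        unfolding nn_integral_eq_sq_norm[OF sq, symmetric]
        by (rule nn_integral_cong_AE, use Wb[OF True] in eventually_elim) simp
      then have "ennreal ((exp (- l * s))\<^sup>2) * ennreal (sq_norm (\<lambda>x. b s x - b' s x)) = (\<integral>\<^sup>+\<xi>. ennreal ((exp (- l * s))\<^sup>2) * ennreal ((norm (W s \<xi>))\<^sup>2) \<partial>lborel)"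
        using Wm by (simp add: nn_integral_cmult)
      also have "\<dots> \<le> (\<integral>\<^sup>+\<xi>. (V s \<xi>)\<^sup>2 \<partial>lborel)"
      proof (rule nn_integral_mono)
        fix \<xi>
        have "ennreal ((exp (- l * s))\<^sup>2) * ennreal ((norm (W s \<xi>))\<^sup>2) = (ennreal (exp (- l * s) * norm (W s \<xi>)))\<^sup>2"
          by (simp add: ennreal_power ennreal_mult[symmetric] power_mult_distrib)
        also have "\<dots> \<le> (V s \<xi>)\<^sup>2" by (intro power_mono WV[OF True]) simp
        finally show "ennreal ((exp (- l * s))\<^sup>2) * ennreal ((norm (W s \<xi>))\<^sup>2) \<le> (V s \<xi>)\<^sup>2" .
      qed
      finally have 1: "ennreal ((exp (- l * s))\<^sup>2) * ennreal (sq_norm (\<lambda>x. b s x - b' s x)) \<le> (\<integral>\<^sup>+\<xi>. (V s \<xi>)\<^sup>2 \<partial>lborel)" .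
      have "ennreal ((exp (- l * s))\<^sup>2) * D s \<le> ennreal ((exp (- l * s))\<^sup>2) * (ennreal (1 / 2) * ennreal (sq_norm (\<lambda>x. b s x - b' s x)))"
        by (intro mult_left_mono Dle[OF True]) simp
      also have "\<dots> = ennreal (1 / 2) * (ennreal ((exp (- l * s))\<^sup>2) * ennreal (sq_norm (\<lambda>x. b s x - b' s x)))"
        by (simp only: mult_ac)
      also have "\<dots> \<le> ennreal (1 / 2) * (\<integral>\<^sup>+\<xi>. (V s \<xi>)\<^sup>2 \<partial>lborel)"
        by (intro mult_left_mono 1) simp
      finally show ?thesis using True by simp
    qed simp
  qed
  also have "\<dots> = ennreal (1 / 2) * (\<integral>\<^sup>+s. (\<integral>\<^sup>+\<xi>. (V s \<xi>)\<^sup>2 \<partial>lborel) \<partial>lborel)"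
  proof (rule nn_integral_cmult)
    show "(\<lambda>s. \<integral>\<^sup>+\<xi>. (V s \<xi>)\<^sup>2 \<partial>lborel) \<in> borel_measurable lborel"
      by (rule lborel.borel_measurable_nn_integral) (use Vm in \<open>simp add: case_prod_unfold\<close>)
  qed
  also have "(\<integral>\<^sup>+s. (\<integral>\<^sup>+\<xi>. (V s \<xi>)\<^sup>2 \<partial>lborel) \<partial>lborel) = (\<integral>\<^sup>+\<xi>. (\<integral>\<^sup>+s. (V s \<xi>)\<^sup>2 \<partial>lborel) \<partial>lborel)"
    by (rule lborel_pair.Fubini'[symmetric]) (use Vm in \<open>simp add: case_prod_unfold\<close>)
  also have "ennreal (1 / 2) * \<dots> \<le> ennreal (1 / 2) * \<Delta>"
    unfolding \<Delta>_def V_def by (intro mult_left_mono nn_integral_mono young_in_time n1 a) simp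
  finally have "\<Delta> \<le> ennreal (1 / 2) * \<Delta>" .
  then have "\<Delta> = 0"
  proof (cases \<Delta>)
    case (real r)
    have "ennreal r \<le> ennreal (1 / 2 * r)"
      using \<open>\<Delta> \<le> ennreal (1 / 2) * \<Delta>\<close> ennreal_mult[OF _ real(1), of "1 / 2"] unfolding real(2) by simp
    then show ?thesis using real by simp
  qed (use \<Delta>_fin in simp)
  then have "AE \<xi> in lborel. ennreal (1 / (a \<xi>)\<^sup>2) * (\<integral>\<^sup>+s. (n s \<xi>)\<^sup>2 \<partial>lborel) = 0"
    unfolding \<Delta>_def by (subst (asm) nn_integral_0_iff_AE) measurable
  \<comment> \<open>For almost every frequency the source vanishes at almost all times, so \<open>V\<close> vanishes at every time.\<close>
  then have W0: "AE \<xi> in lborel. W t\<^sub>1 \<xi> = 0"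
  proof eventually_elim
    case (elim \<xi>)
    have "(\<integral>\<^sup>+s. (n s \<xi>)\<^sup>2 \<partial>lborel) = 0" using elim a[of \<xi>] by (simp add: ennreal_eq_0_iff)
    then have "AE s in lborel. n s \<xi> = 0" by (subst (asm) nn_integral_0_iff_AE) auto
    then have "AE s in lborel. decay_kernel (a \<xi>) (t\<^sub>1 - s) * n s \<xi> = 0" by eventually_elim simp
    then have "V t\<^sub>1 \<xi> = 0" unfolding V_def by (subst nn_integral_0_iff_AE) auto
    with WV[OF t\<^sub>1, of \<xi>] show ?case by (simp add: ennreal_eq_0_iff mult_le_0_iff not_le)
  qed
  have sb: "square_integrable (\<lambda>\<xi>. b t\<^sub>1 \<xi> - b' t\<^sub>1 \<xi>)"
    by (intro square_integrable_diff L2_continuous_onD(1)[OF bc(1) t\<^sub>1] L2_continuous_onD(1)[OF bc(2) t\<^sub>1])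
  have "AE \<xi> in lborel. (norm (b t\<^sub>1 \<xi> - b' t\<^sub>1 \<xi>))\<^sup>2 = 0"
    using Wb[OF t\<^sub>1] W0 by eventually_elim simp
  then have "sq_norm (\<lambda>\<xi>. b t\<^sub>1 \<xi> - b' t\<^sub>1 \<xi>) = 0"
    unfolding sq_norm_def by (rule integral_eq_zero_AE)
  then have "sq_norm (w t\<^sub>1) = 0"
    using sqg_rep_velocity_diff_le(2)[OF rep[OF t\<^sub>1] rep'[OF t\<^sub>1]] by (simp add: w_def[abs_def])
  then have "AE x in lborel. w t\<^sub>1 x = 0"
    unfolding w_def[abs_def]
    by (intro AE_eq_0_of_sq_norm square_integrable_diff L2_continuous_onD(1)[OF Bc t\<^sub>1] L2_continuous_onD(1)[OF Bc' t\<^sub>1])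
  with B[OF t\<^sub>1] B'[OF t\<^sub>1] have "AE x in lborel. \<theta> t\<^sub>1 x = \<theta>' t\<^sub>1 x"
    by eventually_elim (simp add: w_def)
  then show "AE x in lebesgue. \<theta> t\<^sub>1 x = \<theta>' t\<^sub>1 x"
    by (rule AE_completion)
qed

end
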